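(* For each integer $n \ge 1$ put $$A_n = M_{k(1)}(\mathbb{C}) \oplus M_{k(2)}(\mathbb{C}) \oplus \cdots \oplus M_{k(n)}(\mathbb{C}), \qquad k(1) = 1, \quad k(j) = 2^{j-2} \ \text{ for } j \ge 2,$$ so that $k(n+1) = k(1) + k(2) + \cdots + k(n)$ for all $n \ge 1$, and let $\varphi_n \colon A_n \to A_{n+1}$ be the unital injective $^*$-homomorphism $$\varphi_n(x_1, x_2, \dots, x_n) = \big(x_1, x_2, \dots, x_n, \mathrm{diag}(x_1, x_2, \dots, x_n)\big).$$ Let $A$ be the $C^*$-algebra inductive limit of the sequence $A_1 \xrightarrow{\varphi_1} A_2 \xrightarrow{\varphi_2} A_3 \to \cdots$. Then the unital AF-algebra $A$ is just-infinite and residually finite dimensional. In particular, residually finite dimensional just-infinite unital AF-algebras exist.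
   Context: A $C^*$-algebra $A$ is just-infinite if it is infinite dimensional and $A/I$ is finite dimensional for each non-zero closed two-sided ideal $I$ of $A$. A $C^*$-algebra is residually finite dimensional (RFD) if it admits a separating family of finite dimensional representations. An AF-algebra is a $C^*$-algebra which is the completion of an increasing union of finite dimensional sub-$C^*$-algebras. Here $\mathrm{diag}(x_1,\dots,x_n)$ denotes the block diagonal matrix in $M_{k(n+1)}(\mathbb{C})$ with blocks $x_j \in M_{k(j)}(\mathbb{C})$. *)

theory Defs
  imports "HOL-Algebra.QuotRing" "Jordan_Normal_Form.VS_Connect"
    "Jordan_Normal_Form.Schur_Decomposition"
begin

hide_const (open) Multiset.mult Polynomial.smult Modules.module_hom

section \<open>C*-algebras\<close>

text \<open>C*-algebras are not assumed to be unital. The field \<^const>\<open>one\<close> inherited from the ring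
  record is unconstrained, except under \<open>unital\<close> below.\<close>

record 'a cstar = "(complex, 'a) module" +
  star :: "'a \<Rightarrow> 'a"
  cnorm :: "'a \<Rightarrow> real"

definition norm_converges :: "('a, 'b) cstar_scheme \<Rightarrow> (nat \<Rightarrow> 'a) \<Rightarrow> 'a \<Rightarrow> bool" where
  "norm_converges A s x \<longleftrightarrow> (\<lambda>n. cnorm A (s n \<ominus>\<^bsub>A\<^esub> x)) \<longlonglongrightarrow> 0"

definition norm_Cauchy :: "('a, 'b) cstar_scheme \<Rightarrow> (nat \<Rightarrow> 'a) \<Rightarrow> bool" where
  "norm_Cauchy A s \<longleftrightarrow> (\<forall>e>0. \<exists>N. \<forall>m\<ge>N. \<forall>n\<ge>N. cnorm A (s m \<ominus>\<^bsub>A\<^esub> s n) < e)"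

definition norm_closure :: "('a, 'b) cstar_scheme \<Rightarrow> 'a set \<Rightarrow> 'a set" where
  "norm_closure A S = {x \<in> carrier A. \<forall>e>0. \<exists>y\<in>S. cnorm A (x \<ominus>\<^bsub>A\<^esub> y) < e}"

locale cstar_algebra = vectorspace class_ring A for A :: "('a, 'b) cstar_scheme" (structure) +
  assumes mult_closed:
      "\<lbrakk>x \<in> carrier A; y \<in> carrier A\<rbrakk> \<Longrightarrow> x \<otimes> y \<in> carrier A"
    and mult_assoc:
      "\<lbrakk>x \<in> carrier A; y \<in> carrier A; z \<in> carrier A\<rbrakk> \<Longrightarrow> (x \<otimes> y) \<otimes> z = x \<otimes> (y \<otimes> z)"
    and mult_add_left:
      "\<lbrakk>x \<in> carrier A; y \<in> carrier A; z \<in> carrier A\<rbrakk> \<Longrightarrow> (x \<oplus> y) \<otimes> z = x \<otimes> z \<oplus> y \<otimes> z"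
    and mult_add_right:
      "\<lbrakk>x \<in> carrier A; y \<in> carrier A; z \<in> carrier A\<rbrakk> \<Longrightarrow> z \<otimes> (x \<oplus> y) = z \<otimes> x \<oplus> z \<otimes> y"
    and smult_mult_left:
      "\<lbrakk>x \<in> carrier A; y \<in> carrier A\<rbrakk> \<Longrightarrow> (c \<odot> x) \<otimes> y = c \<odot> (x \<otimes> y)"
    and smult_mult_right:
      "\<lbrakk>x \<in> carrier A; y \<in> carrier A\<rbrakk> \<Longrightarrow> x \<otimes> (c \<odot> y) = c \<odot> (x \<otimes> y)"
    and star_closed: "x \<in> carrier A \<Longrightarrow> star A x \<in> carrier A"
    and star_star: "x \<in> carrier A \<Longrightarrow> star A (star A x) = x"
    and star_add:
      "\<lbrakk>x \<in> carrier A; y \<in> carrier A\<rbrakk> \<Longrightarrow> star A (x \<oplus> y) = star A x \<oplus> star A y"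
    and star_smult: "x \<in> carrier A \<Longrightarrow> star A (c \<odot> x) = cnj c \<odot> star A x"
    and star_mult:
      "\<lbrakk>x \<in> carrier A; y \<in> carrier A\<rbrakk> \<Longrightarrow> star A (x \<otimes> y) = star A y \<otimes> star A x"
    and norm_nonneg: "x \<in> carrier A \<Longrightarrow> 0 \<le> cnorm A x"
    and norm_eq_zero: "x \<in> carrier A \<Longrightarrow> cnorm A x = 0 \<longleftrightarrow> x = \<zero>"
    and norm_triangle:
      "\<lbrakk>x \<in> carrier A; y \<in> carrier A\<rbrakk> \<Longrightarrow> cnorm A (x \<oplus> y) \<le> cnorm A x + cnorm A y"
    and norm_smult: "x \<in> carrier A \<Longrightarrow> cnorm A (c \<odot> x) = cmod c * cnorm A x"
    and norm_mult_le:
      "\<lbrakk>x \<in> carrier A; y \<in> carrier A\<rbrakk> \<Longrightarrow> cnorm A (x \<otimes> y) \<le> cnorm A x * cnorm A y"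
    and cstar_identity: "x \<in> carrier A \<Longrightarrow> cnorm A (star A x \<otimes> x) = (cnorm A x)\<^sup>2"
    and complete:
      "\<lbrakk>\<forall>n. s n \<in> carrier A; norm_Cauchy A s\<rbrakk> \<Longrightarrow> \<exists>x\<in>carrier A. norm_converges A s x"

definition unital :: "('a, 'b) cstar_scheme \<Rightarrow> bool" where
  "unital A \<longleftrightarrow> \<one>\<^bsub>A\<^esub> \<in> carrier A \<and>
     (\<forall>x\<in>carrier A. \<one>\<^bsub>A\<^esub> \<otimes>\<^bsub>A\<^esub> x = x \<and> x \<otimes>\<^bsub>A\<^esub> \<one>\<^bsub>A\<^esub> = x)"

definition finite_dimensional :: "('a, 'b) cstar_scheme \<Rightarrow> bool" where
  "finite_dimensional A \<longleftrightarrow> vectorspace.fin_dim class_ring A"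

definition star_hom :: "('a, 'b) cstar_scheme \<Rightarrow> ('c, 'd) cstar_scheme \<Rightarrow> ('a \<Rightarrow> 'c) set" where
  "star_hom A B = {f \<in> module_hom class_ring A B.
     (\<forall>x\<in>carrier A. \<forall>y\<in>carrier A. f (x \<otimes>\<^bsub>A\<^esub> y) = f x \<otimes>\<^bsub>B\<^esub> f y) \<and>
     (\<forall>x\<in>carrier A. f (star A x) = star B (f x))}"

definition closed_ideal :: "'a set \<Rightarrow> ('a, 'b) cstar_scheme \<Rightarrow> bool" where
  "closed_ideal I A \<longleftrightarrow> submodule class_ring I A \<and>
     (\<forall>a\<in>carrier A. \<forall>x\<in>I. a \<otimes>\<^bsub>A\<^esub> x \<in> I \<and> x \<otimes>\<^bsub>A\<^esub> a \<in> I) \<and>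
     norm_closure A I \<subseteq> I"

definition sub_cstar :: "'a set \<Rightarrow> ('a, 'b) cstar_scheme \<Rightarrow> bool" where
  "sub_cstar F A \<longleftrightarrow> submodule class_ring F A \<and>
     (\<forall>x\<in>F. \<forall>y\<in>F. x \<otimes>\<^bsub>A\<^esub> y \<in> F) \<and> (\<forall>x\<in>F. star A x \<in> F) \<and> norm_closure A F \<subseteq> F"

text \<open>The ring part is that of \<^const>\<open>FactRing\<close>; the unions avoid choosing representatives.\<close>

definition cstar_quot :: "'a cstar \<Rightarrow> 'a set \<Rightarrow> 'a set cstar" where
  "cstar_quot A I =
    \<lparr>carrier = A_RCOSETS A I, mult = rcoset_mult A I, one = I +>\<^bsub>A\<^esub> \<one>\<^bsub>A\<^esub>,
     zero = I, add = set_add A,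
     smult = (\<lambda>c X. \<Union>x\<in>X. I +>\<^bsub>A\<^esub> (c \<odot>\<^bsub>A\<^esub> x)),
     star = (\<lambda>X. \<Union>x\<in>X. I +>\<^bsub>A\<^esub> star A x),
     cnorm = (\<lambda>X. INF x\<in>X. cnorm A x)\<rparr>"

definition just_infinite :: "'a cstar \<Rightarrow> bool" where
  "just_infinite A \<longleftrightarrow> \<not> finite_dimensional A \<and>
     (\<forall>I. closed_ideal I A \<and> I \<noteq> {\<zero>\<^bsub>A\<^esub>} \<longrightarrow> finite_dimensional (cstar_quot A I))"

definition AF_algebra :: "('a, 'b) cstar_scheme \<Rightarrow> bool" where
  "AF_algebra A \<longleftrightarrow> (\<exists>F :: nat \<Rightarrow> 'a set.
     (\<forall>n. sub_cstar (F n) A \<and> finite_dimensional (A\<lparr>carrier := F n\<rparr>)) \<and>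
     (\<forall>n. F n \<subseteq> F (Suc n)) \<and>
     norm_closure A (\<Union>n. F n) = carrier A)"


section \<open>Matrix algebras and finite direct sums\<close>

definition vec_l2norm :: "complex vec \<Rightarrow> real" where
  "vec_l2norm v = sqrt (\<Sum>i<dim_vec v. (cmod (v $ i))\<^sup>2)"

definition mat_opnorm :: "complex mat \<Rightarrow> real" where
  "mat_opnorm M = (SUP v\<in>{v \<in> carrier_vec (dim_col M). vec_l2norm v \<le> 1}. vec_l2norm (M *\<^sub>v v))"

definition mat_cstar :: "nat \<Rightarrow> complex mat cstar" where
  "mat_cstar d =
    \<lparr>carrier = carrier_mat d d, mult = (*), one = 1\<^sub>m d, zero = 0\<^sub>m d d, add = (+),
     smult = (\<cdot>\<^sub>m), star = mat_adjoint, cnorm = mat_opnorm\<rparr>"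

text \<open>Elements of \<open>As ! 0 \<oplus> \<dots> \<oplus> As ! (m - 1)\<close> are lists of length \<open>m\<close>. Inserting \<open>0\<close> in the
  maximum only matters for the empty sum.\<close>

definition direct_sum :: "'a cstar list \<Rightarrow> 'a list cstar" where
  "direct_sum As =
    \<lparr>carrier = {xs. length xs = length As \<and> (\<forall>i<length As. xs ! i \<in> carrier (As ! i))},
     mult = (\<lambda>xs ys. map (\<lambda>i. xs ! i \<otimes>\<^bsub>As ! i\<^esub> ys ! i) [0..<length As]),
     one = map (\<lambda>i. \<one>\<^bsub>As ! i\<^esub>) [0..<length As],
     zero = map (\<lambda>i. \<zero>\<^bsub>As ! i\<^esub>) [0..<length As],
     add = (\<lambda>xs ys. map (\<lambda>i. xs ! i \<oplus>\<^bsub>As ! i\<^esub> ys ! i) [0..<length As]),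
     smult = (\<lambda>c xs. map (\<lambda>i. c \<odot>\<^bsub>As ! i\<^esub> (xs ! i)) [0..<length As]),
     star = (\<lambda>xs. map (\<lambda>i. star (As ! i) (xs ! i)) [0..<length As]),
     cnorm = (\<lambda>xs. Max (insert 0 ((\<lambda>i. cnorm (As ! i) (xs ! i)) ` {..<length As})))\<rparr>"

text \<open>A finite dimensional representation is a *-homomorphism into the operators on a finite
  dimensional Hilbert space, that is, on \<open>\<complex>\<^sup>d\<close> for some \<open>d\<close>.\<close>

definition residually_finite_dimensional :: "('a, 'b) cstar_scheme \<Rightarrow> bool" where
  "residually_finite_dimensional A \<longleftrightarrow> (\<exists>R :: (nat \<times> ('a \<Rightarrow> complex mat)) set.
     (\<forall>(d, \<pi>)\<in>R. \<pi> \<in> star_hom A (mat_cstar d)) \<and>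
     (\<forall>x\<in>carrier A. x \<noteq> \<zero>\<^bsub>A\<^esub> \<longrightarrow> (\<exists>(d, \<pi>)\<in>R. \<pi> x \<noteq> 0\<^sub>m d d)))"


section \<open>Inductive limits\<close>

text \<open>The inductive limit of \<open>A 0 \<rightarrow> A 1 \<rightarrow> A 2 \<rightarrow> \<dots>\<close> (connecting maps \<open>\<phi> n\<close> from \<open>A n\<close> to
  \<open>A (Suc n)\<close>) is constructed in the usual way: \<open>a \<in> A m\<close> is sent to the class of the sequence
  \<open>(0, \<dots>, 0, a, \<phi> m a, \<phi> (m + 1) (\<phi> m a), \<dots>)\<close> in the quotient of the algebra of bounded sequences
  by the ideal of null sequences, and the limit is the closure of the union of the images. This
  is the completion of the algebraic direct limit (divided by the elements of seminorm zero) in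
  the seminorm \<open>lim\<^sub>n \<parallel>\<phi>\<^sub>n\<^sub>m a\<parallel>\<close>.\<close>

definition bounded_prod :: "(nat \<Rightarrow> 'a cstar) \<Rightarrow> (nat \<Rightarrow> 'a) cstar" where
  "bounded_prod A =
    \<lparr>carrier = {x. (\<forall>n. x n \<in> carrier (A n)) \<and> bdd_above (range (\<lambda>n. cnorm (A n) (x n)))},
     mult = (\<lambda>x y n. x n \<otimes>\<^bsub>A n\<^esub> y n),
     one = (\<lambda>n. \<one>\<^bsub>A n\<^esub>),
     zero = (\<lambda>n. \<zero>\<^bsub>A n\<^esub>),
     add = (\<lambda>x y n. x n \<oplus>\<^bsub>A n\<^esub> y n),
     smult = (\<lambda>c x n. c \<odot>\<^bsub>A n\<^esub> x n),
     star = (\<lambda>x n. star (A n) (x n)),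
     cnorm = (\<lambda>x. SUP n. cnorm (A n) (x n))\<rparr>"

definition null_seqs :: "(nat \<Rightarrow> 'a cstar) \<Rightarrow> (nat \<Rightarrow> 'a) set" where
  "null_seqs A = {x \<in> carrier (bounded_prod A). (\<lambda>n. cnorm (A n) (x n)) \<longlonglongrightarrow> 0}"

text \<open>\<open>connect \<phi> m d = \<phi> (m + d - 1) \<circ> \<dots> \<circ> \<phi> m\<close>, a map from \<open>A m\<close> to \<open>A (m + d)\<close>.\<close>

primrec connect :: "(nat \<Rightarrow> 'a \<Rightarrow> 'a) \<Rightarrow> nat \<Rightarrow> nat \<Rightarrow> 'a \<Rightarrow> 'a" where
  "connect \<phi> m 0 a = a"
| "connect \<phi> m (Suc d) a = \<phi> (m + d) (connect \<phi> m d a)"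

definition limit_map ::
    "(nat \<Rightarrow> 'a cstar) \<Rightarrow> (nat \<Rightarrow> 'a \<Rightarrow> 'a) \<Rightarrow> nat \<Rightarrow> 'a \<Rightarrow> (nat \<Rightarrow> 'a) set" where
  "limit_map A \<phi> m a = null_seqs A +>\<^bsub>bounded_prod A\<^esub>
     (\<lambda>n. if n < m then \<zero>\<^bsub>A n\<^esub> else connect \<phi> m (n - m) a)"

definition inductive_limit ::
    "(nat \<Rightarrow> 'a cstar) \<Rightarrow> (nat \<Rightarrow> 'a \<Rightarrow> 'a) \<Rightarrow> (nat \<Rightarrow> 'a) set cstar" where
  "inductive_limit A \<phi> =
    (let Q = cstar_quot (bounded_prod A) (null_seqs A)
     in Q\<lparr>carrier := norm_closure Q (\<Union>m. limit_map A \<phi> m ` carrier (A m))\<rparr>)"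


section \<open>The example\<close>

definition k_seq :: "nat \<Rightarrow> nat" where
  "k_seq j = (if j = 1 then 1 else 2 ^ (j - 2))"

definition A_seq :: "nat \<Rightarrow> complex mat list cstar" where
  "A_seq n = direct_sum (map (\<lambda>j. mat_cstar (k_seq j)) [1..<Suc n])"

definition \<phi>_seq :: "nat \<Rightarrow> complex mat list \<Rightarrow> complex mat list" where
  "\<phi>_seq n xs = xs @ [diag_block_mat xs]"

text \<open>The sequence starts with \<open>A_seq 1\<close>, whereas \<open>inductive_limit\<close> starts at index \<open>0\<close>.\<close>

definition A_lim :: "(nat \<Rightarrow> complex mat list) set cstar" where
  "A_lim = inductive_limit (\<lambda>n. A_seq (Suc n)) (\<lambda>n. \<phi>_seq (Suc n))"

end

theory Submission
  imports Defs "HOL-Analysis.L2_Norm" "HOL-Library.Nat_Bijection"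
begin

hide_const (open) Multiset.mult Polynomial.smult Modules.module_hom Modules.module

text \<open>The limit algebra is isometrically isomorphic to the algebra of all sequences \<open>x\<close> of matrices,
  with \<open>x i\<close> of size \<open>k(i + 1)\<close>, that are uniform limits of sequences satisfying
  \<open>x i = diag(x 0, \<dots>, x (i - 1))\<close> for all large \<open>i\<close>. The coordinates of these sequences are a
  separating family of finite dimensional representations.

  Given a nonzero closed ideal, approximate a nonzero element of it by an eventually block diagonal
  sequence. A nonzero entry of one coordinate reappears in all later coordinates, so multiplying by
  matrix units on both sides gives an element of the ideal at distance less than one from a
  diagonal matrix unit \<open>g\<close> of some block, and thus \<open>g\<close> itself is in the ideal. The coordinates of
  \<open>g\<close> in all later blocks are nonzero. As full matrix algebras are simple, the ideal contains every
  element that vanishes in the first blocks, and the quotient is an image of a finite direct sum of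
  matrix algebras.\<close>

section \<open>Linear maps and C*-algebras\<close>

text \<open>Coordinates make sense on the limit because \<open>\<phi>_seq\<close> only appends: an
  entry never changes once it is in the list. Hence the norm of a coset, a limit superior, becomes a
  supremum over coordinates, and the C*-axioms of \<open>A_lim\<close> are checked coordinate by
  coordinate. Quotient norms are never shown to be C*-norms; the quotients by ideals of
  \<open>A_lim\<close> enter only as vector spaces. The analytic input is that a block diagonal
  matrix has at most the norm of its largest block. So extending from a stage is contractive, and
  the distance of a sequence to stage n is, up to a factor 2, its distance to the extension of its
  own first n + 1 entries. The obstacle in the ideal part is that elements of a closed ideal are
  only approximately block diagonal, so cutting with matrix units yields an element near g and not g
  itself. As g is idempotent, products of differences g - w force g into the ideal, which takes the
  place of functional calculus. One such g serves infinitely many blocks, since every later block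
  contains a copy of it.\<close>

lemma vectorspace_image:
  fixes V :: "(complex, 'a, 'b) module_scheme" and W :: "(complex, 'c, 'd) module_scheme"
  assumes "vectorspace class_ring V"
    and im: "f ` carrier V = carrier W"
    and zero: "f \<zero>\<^bsub>V\<^esub> = \<zero>\<^bsub>W\<^esub>"
    and add: "\<And>x y. \<lbrakk>x \<in> carrier V; y \<in> carrier V\<rbrakk> \<Longrightarrow> f (x \<oplus>\<^bsub>V\<^esub> y) = f x \<oplus>\<^bsub>W\<^esub> f y"
    and smult: "\<And>c x. x \<in> carrier V \<Longrightarrow> f (c \<odot>\<^bsub>V\<^esub> x) = c \<odot>\<^bsub>W\<^esub> f x"
  shows "vectorspace class_ring W"
proof -
  interpret V: vectorspace class_ring V by fact
  have neg: "\<exists>w\<in>f ` carrier V. v \<oplus>\<^bsub>W\<^esub> w = \<zero>\<^bsub>W\<^esub>" if "v \<in> f ` carrier V" for v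
  proof -
    from that obtain x where x: "x \<in> carrier V" "v = f x" by auto
    then have "f x \<oplus>\<^bsub>W\<^esub> f (\<ominus>\<^bsub>V\<^esub> x) = \<zero>\<^bsub>W\<^esub>"
      by (metis V.M.a_inv_closed V.M.r_neg add zero)
    then show ?thesis using x by blast
  qed
  note [simp] = V.smult_closed[simplified] zero[symmetric] add[symmetric] smult[symmetric]
  show ?thesis
  proof (rule vs_criteria, unfold im[symmetric])
    show "field (class_ring :: complex ring)" by (rule class_field)
    show "\<forall>v\<in>f ` carrier V. \<exists>w\<in>f ` carrier V. v \<oplus>\<^bsub>W\<^esub> w = \<zero>\<^bsub>W\<^esub>"
      using neg by blast
  qed (auto simp: V.M.a_ac V.smult_l_distr[simplified] V.smult_r_distr[simplified]
      V.smult_assoc1[simplified] V.smult_one[simplified])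
qed

text \<open>Rank-nullity. Every finite dimensionality proof below exhibits the space as a linear
  image of some C^d, directly or through \<open>A_seq\<close>.\<close>

lemma fin_dim_image:
  assumes "vectorspace class_ring V" "vectorspace class_ring W"
    and "f \<in> module_hom class_ring V W" "f ` carrier V = carrier W"
    and "vectorspace.fin_dim class_ring V"
  shows "vectorspace.fin_dim class_ring W"
proof -
  interpret linear_map class_ring V W f
    using assms by (simp add: linear_map_def mod_hom_def mod_hom_axioms_def vectorspace_def)
  show ?thesis
    using rank_nullity_main(2) assms by auto
qed

text \<open>Subtraction is defined through the inverse in the additive monoid, which depends on the
  carrier and has no coordinate formula. Addition and scalar multiplication do have one in every
  construction below, so differences are always computed through this rewriting.\<close>

lemma minus_eq_add_smult:
  fixes V :: "(complex, 'a, 'b) module_scheme"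
  assumes "vectorspace class_ring V" "y \<in> carrier V"
  shows "x \<ominus>\<^bsub>V\<^esub> y = x \<oplus>\<^bsub>V\<^esub> (-1) \<odot>\<^bsub>V\<^esub> y"
proof -
  interpret V: vectorspace class_ring V by fact
  show ?thesis
    using V.smult_minus_1[OF assms(2)] by (simp add: a_minus_def class_ring_simps)
qed

context cstar_algebra
begin

lemma vectorspace: "vectorspace class_ring A" ..

lemma smult_in_carrier: "x \<in> carrier A \<Longrightarrow> c \<odot> x \<in> carrier A"
  by simp

lemma norm_zero: "cnorm A \<zero> = 0"
  by (simp add: norm_eq_zero)

lemma minus_minus_distrib:
  assumes "x \<in> carrier A" "y \<in> carrier A" "z \<in> carrier A"
  shows "x \<ominus> z = (x \<ominus> y) \<oplus> (y \<ominus> z)"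
  using assms by (simp add: a_minus_def M.a_ac M.r_neg M.l_neg M.r_neg1 M.r_neg2)

lemma norm_minus_commute:
  assumes "x \<in> carrier A" "y \<in> carrier A"
  shows "cnorm A (x \<ominus> y) = cnorm A (y \<ominus> x)"
proof -
  have "(-1) \<odot> (x \<ominus> y) = \<ominus> (x \<ominus> y)"
    using smult_minus_1[of "x \<ominus> y"] assms by (simp add: class_ring_simps)
  also have "\<dots> = y \<ominus> x"
    using assms by (metis M.a_comm M.a_inv_closed M.minus_add M.minus_minus a_minus_def)
  finally have "y \<ominus> x = (-1) \<odot> (x \<ominus> y)" ..
  then show ?thesis
    using norm_smult[of "x \<ominus> y" "-1"] assms by simp
qed

lemma norm_diff_triangle:
  assumes "x \<in> carrier A" "y \<in> carrier A" "z \<in> carrier A"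
  shows "cnorm A (x \<ominus> z) \<le> cnorm A (x \<ominus> y) + cnorm A (y \<ominus> z)"
  unfolding minus_minus_distrib[OF assms] using assms by (intro norm_triangle) auto

lemma norm_le_diff:
  assumes "x \<in> carrier A" "y \<in> carrier A"
  shows "cnorm A x \<le> cnorm A (x \<ominus> y) + cnorm A y"
proof -
  have "(x \<ominus> y) \<oplus> y = x"
    using assms by (metis M.a_assoc M.a_inv_closed M.l_neg M.r_zero a_minus_def)
  then show ?thesis using norm_triangle[of "x \<ominus> y" y] assms by simp
qed

lemma minus_zero_iff:
  assumes "x \<in> carrier A" "y \<in> carrier A"
  shows "x \<ominus> y = \<zero> \<longleftrightarrow> x = y"
  using assms by (simp add: a_minus_def M.add.inv_solve_right' )

lemma mult_minus_left:
  assumes "x \<in> carrier A" "y \<in> carrier A" "z \<in> carrier A"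
  shows "(x \<ominus> y) \<otimes> z = x \<otimes> z \<ominus> y \<otimes> z"
  using assms
  by (simp add: minus_eq_add_smult[OF vectorspace] mult_add_left smult_mult_left
      smult_in_carrier mult_closed)

lemma mult_minus_right:
  assumes "x \<in> carrier A" "y \<in> carrier A" "z \<in> carrier A"
  shows "z \<otimes> (x \<ominus> y) = z \<otimes> x \<ominus> z \<otimes> y"
  using assms
  by (simp add: minus_eq_add_smult[OF vectorspace] mult_add_right smult_mult_right
      smult_in_carrier mult_closed)

lemma star_minus:
  assumes "x \<in> carrier A" "y \<in> carrier A"
  shows "star A (x \<ominus> y) = star A x \<ominus> star A y"
  using assms
  by (simp add: minus_eq_add_smult[OF vectorspace] star_add star_smult smult_in_carrier
      star_closed)

text \<open>Cancel the norm of y in |y|^2 = |y* y| \<le> |y*| |y|, and apply the result to x and to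
  its adjoint.\<close>

lemma norm_star:
  assumes x: "x \<in> carrier A"
  shows "cnorm A (star A x) = cnorm A x"
proof -
  have le: "cnorm A y \<le> cnorm A (star A y)" if y: "y \<in> carrier A" for y
  proof (cases "cnorm A y = 0")
    case False
    then have "0 < cnorm A y" using norm_nonneg[OF y] by simp
    moreover have "cnorm A y * cnorm A y \<le> cnorm A (star A y) * cnorm A y"
      using cstar_identity[OF y] norm_mult_le[OF star_closed[OF y] y]
      by (simp add: power2_eq_square)
    ultimately show ?thesis by simp
  qed (use norm_nonneg[OF star_closed[OF y]] in simp)
  from le[OF x] le[OF star_closed[OF x]] show ?thesis
    by (simp add: star_star x)
qed

end

text \<open>Completeness of each \<open>A i\<close> gives pointwise limits. Letting m tend to
  infinity in the triangle inequality makes the convergence uniform in i, at the price of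
  \<open>\<le>\<close> in place of \<open><\<close>.\<close>

lemma uniformly_Cauchy_converges:
  fixes s :: "nat \<Rightarrow> 'i \<Rightarrow> 'a" and A :: "'i \<Rightarrow> ('a, 'b) cstar_scheme"
  assumes A: "\<And>i. i \<in> I \<Longrightarrow> cstar_algebra (A i)"
    and s: "\<And>n i. i \<in> I \<Longrightarrow> s n i \<in> carrier (A i)"
    and Cauchy: "\<And>e. 0 < e \<Longrightarrow> \<exists>N. \<forall>m\<ge>N. \<forall>n\<ge>N. \<forall>i\<in>I. cnorm (A i) (s m i \<ominus>\<^bsub>A i\<^esub> s n i) < e"
  obtains y where "\<And>i. i \<in> I \<Longrightarrow> y i \<in> carrier (A i)"
    and "\<And>e. 0 < e \<Longrightarrow> \<exists>N. \<forall>n\<ge>N. \<forall>i\<in>I. cnorm (A i) (s n i \<ominus>\<^bsub>A i\<^esub> y i) \<le> e"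
proof -
  have "\<exists>y\<in>carrier (A i). norm_converges (A i) (\<lambda>n. s n i) y" if "i \<in> I" for i
  proof (rule cstar_algebra.complete[OF A[OF that]])
    show "norm_Cauchy (A i) (\<lambda>n. s n i)"
      unfolding norm_Cauchy_def using Cauchy that by (meson)
  qed (use s that in auto)
  then obtain y where y: "\<And>i. i \<in> I \<Longrightarrow> y i \<in> carrier (A i)"
      "\<And>i. i \<in> I \<Longrightarrow> norm_converges (A i) (\<lambda>n. s n i) (y i)"
    by metis
  have "\<exists>N. \<forall>n\<ge>N. \<forall>i\<in>I. cnorm (A i) (s n i \<ominus>\<^bsub>A i\<^esub> y i) \<le> e" if "0 < e" for e
  proof -
    from Cauchy[OF that] obtain N
      where N: "\<And>m n i. \<lbrakk>m \<ge> N; n \<ge> N; i \<in> I\<rbrakk> \<Longrightarrow> cnorm (A i) (s m i \<ominus>\<^bsub>A i\<^esub> s n i) < e"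
      by metis
    have "cnorm (A i) (s n i \<ominus>\<^bsub>A i\<^esub> y i) \<le> e" if "n \<ge> N" "i \<in> I" for n i
    proof (rule LIMSEQ_le_const)
      show "(\<lambda>m. e + cnorm (A i) (s m i \<ominus>\<^bsub>A i\<^esub> y i)) \<longlonglongrightarrow> e"
        using y(2)[OF \<open>i \<in> I\<close>] tendsto_add[OF tendsto_const, of _ 0 sequentially e]
        by (auto simp: norm_converges_def)
      have "cnorm (A i) (s n i \<ominus>\<^bsub>A i\<^esub> y i) \<le> e + cnorm (A i) (s m i \<ominus>\<^bsub>A i\<^esub> y i)"
        if "m \<ge> N" for m
        using cstar_algebra.norm_diff_triangle[OF A[OF \<open>i \<in> I\<close>] s[OF \<open>i \<in> I\<close>] s[OF \<open>i \<in> I\<close>]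
            y(1)[OF \<open>i \<in> I\<close>], of n m] N[OF \<open>n \<ge> N\<close> that \<open>i \<in> I\<close>] by linarith
      then show "\<exists>N. \<forall>m\<ge>N. cnorm (A i) (s n i \<ominus>\<^bsub>A i\<^esub> y i)
          \<le> e + cnorm (A i) (s m i \<ominus>\<^bsub>A i\<^esub> y i)"
        by blast
    qed
    then show ?thesis by blast
  qed
  with y(1) show thesis by (rule that)
qed

text \<open>\<open>norm\<close> says that the norm of \<open>C\<close> is the supremum of the
  coordinate norms, so identities and norm axioms are inherited from the \<open>A i\<close>;
  \<open>complete\<close> asks that the coordinate families be closed under uniform limits. Direct
  sums, bounded products and the limit algebra all arise in this way.\<close>

lemma cstar_algebra_subdirectI:
  fixes C :: "('c, 'd) cstar_scheme" and A :: "'i \<Rightarrow> ('a, 'b) cstar_scheme"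
    and p :: "'i \<Rightarrow> 'c \<Rightarrow> 'a"
  assumes A: "\<And>i. i \<in> I \<Longrightarrow> cstar_algebra (A i)"
    and p: "\<And>i x. \<lbrakk>i \<in> I; x \<in> carrier C\<rbrakk> \<Longrightarrow> p i x \<in> carrier (A i)"
    and inj: "\<And>x y. \<lbrakk>x \<in> carrier C; y \<in> carrier C; \<And>i. i \<in> I \<Longrightarrow> p i x = p i y\<rbrakk> \<Longrightarrow> x = y"
    and zero: "\<zero>\<^bsub>C\<^esub> \<in> carrier C" "\<And>i. i \<in> I \<Longrightarrow> p i \<zero>\<^bsub>C\<^esub> = \<zero>\<^bsub>A i\<^esub>"
    and add: "\<And>x y. \<lbrakk>x \<in> carrier C; y \<in> carrier C\<rbrakk> \<Longrightarrow> x \<oplus>\<^bsub>C\<^esub> y \<in> carrier C"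
      "\<And>i x y. \<lbrakk>i \<in> I; x \<in> carrier C; y \<in> carrier C\<rbrakk> \<Longrightarrow> p i (x \<oplus>\<^bsub>C\<^esub> y) = p i x \<oplus>\<^bsub>A i\<^esub> p i y"
    and mult: "\<And>x y. \<lbrakk>x \<in> carrier C; y \<in> carrier C\<rbrakk> \<Longrightarrow> x \<otimes>\<^bsub>C\<^esub> y \<in> carrier C"
      "\<And>i x y. \<lbrakk>i \<in> I; x \<in> carrier C; y \<in> carrier C\<rbrakk> \<Longrightarrow> p i (x \<otimes>\<^bsub>C\<^esub> y) = p i x \<otimes>\<^bsub>A i\<^esub> p i y"
    and smult: "\<And>c x. x \<in> carrier C \<Longrightarrow> c \<odot>\<^bsub>C\<^esub> x \<in> carrier C"
      "\<And>i c x. \<lbrakk>i \<in> I; x \<in> carrier C\<rbrakk> \<Longrightarrow> p i (c \<odot>\<^bsub>C\<^esub> x) = c \<odot>\<^bsub>A i\<^esub> p i x"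
    and star: "\<And>x. x \<in> carrier C \<Longrightarrow> star C x \<in> carrier C"
      "\<And>i x. \<lbrakk>i \<in> I; x \<in> carrier C\<rbrakk> \<Longrightarrow> p i (star C x) = star (A i) (p i x)"
    and norm: "\<And>x. x \<in> carrier C \<Longrightarrow> 0 \<le> cnorm C x"
      "\<And>x r. \<lbrakk>x \<in> carrier C; 0 \<le> r\<rbrakk> \<Longrightarrow> cnorm C x \<le> r \<longleftrightarrow> (\<forall>i\<in>I. cnorm (A i) (p i x) \<le> r)"
    and complete: "\<And>(s :: nat \<Rightarrow> 'c) y. \<lbrakk>\<And>n. s n \<in> carrier C; \<And>i. i \<in> I \<Longrightarrow> y i \<in> carrier (A i);
        \<And>e. 0 < e \<Longrightarrow> \<exists>N. \<forall>n\<ge>N. \<forall>i\<in>I. cnorm (A i) (p i (s n) \<ominus>\<^bsub>A i\<^esub> y i) \<le> e\<rbrakk>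
        \<Longrightarrow> \<exists>x\<in>carrier C. \<forall>i\<in>I. p i x = y i"
  shows "cstar_algebra C"
proof -
  note [simp] = zero add mult smult star p
  note alg = cstar_algebra.mult_closed[OF A] cstar_algebra.mult_assoc[OF A]
    cstar_algebra.mult_add_left[OF A] cstar_algebra.mult_add_right[OF A]
    cstar_algebra.smult_mult_left[OF A] cstar_algebra.smult_mult_right[OF A]
    cstar_algebra.star_closed[OF A] cstar_algebra.star_star[OF A]
    cstar_algebra.star_add[OF A] cstar_algebra.star_smult[OF A] cstar_algebra.star_mult[OF A]
  have vsA: "vectorspace class_ring (A i)" if "i \<in> I" for i
    using A[OF that] by (simp add: cstar_algebra_def)
  have mod: "Module.module class_ring (A i)" and ab: "abelian_group (A i)" if "i \<in> I" for i
    using vsA[OF that] by (auto simp: vectorspace_def Module.module_def)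
  note monoid = abelian_group.axioms(1)[OF ab]
  note lin = abelian_monoid.a_assoc[OF monoid] abelian_monoid.a_comm[OF monoid]
    abelian_monoid.r_zero[OF monoid] abelian_monoid.l_zero[OF monoid]
    abelian_group.r_neg[OF ab]
    module.smult_l_distr[OF mod, simplified] module.smult_r_distr[OF mod, simplified]
    module.smult_assoc1[OF mod, simplified] module.smult_one[OF mod, simplified]
    module.smult_closed[OF mod, simplified]
  have vs: "vectorspace class_ring C"
  proof (rule vs_criteria)
    show "field (class_ring :: complex ring)" by (rule class_field)
    show "\<forall>v\<in>carrier C. \<exists>w\<in>carrier C. v \<oplus>\<^bsub>C\<^esub> w = \<zero>\<^bsub>C\<^esub>"
    proof
      fix v assume v: "v \<in> carrier C"
      have "p i v \<oplus>\<^bsub>A i\<^esub> (-1) \<odot>\<^bsub>A i\<^esub> p i v = \<zero>\<^bsub>A i\<^esub>" if "i \<in> I" for i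
        using minus_eq_add_smult[OF vsA[OF that], of "p i v" "p i v"]
          abelian_group.r_neg[OF ab[OF that]] that v by (simp add: a_minus_def)
      then have "v \<oplus>\<^bsub>C\<^esub> (-1) \<odot>\<^bsub>C\<^esub> v = \<zero>\<^bsub>C\<^esub>" using v by (intro inj) simp_all
      then show "\<exists>w\<in>carrier C. v \<oplus>\<^bsub>C\<^esub> w = \<zero>\<^bsub>C\<^esub>" using v by (metis smult(1))
    qed
  qed (auto intro!: inj simp: lin)
  have pminus: "p i (x \<ominus>\<^bsub>C\<^esub> y) = p i x \<ominus>\<^bsub>A i\<^esub> p i y"
    if "i \<in> I" "x \<in> carrier C" "y \<in> carrier C" for i x y
    using that by (simp add: minus_eq_add_smult[OF vs] minus_eq_add_smult[OF vsA])
  have pn: "cnorm (A i) (p i x) \<le> cnorm C x" if "i \<in> I" "x \<in> carrier C" for i x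
    using norm that by blast
  have Cminus: "x \<ominus>\<^bsub>C\<^esub> y \<in> carrier C" if "x \<in> carrier C" "y \<in> carrier C" for x y
    using that by (simp add: minus_eq_add_smult[OF vs])
  show ?thesis
  proof (rule cstar_algebra.intro[OF vs], unfold_locales)
    fix x y z c assume x: "x \<in> carrier C" and y: "y \<in> carrier C" and z: "z \<in> carrier C"
    show "x \<otimes>\<^bsub>C\<^esub> y \<in> carrier C" "star C x \<in> carrier C" "0 \<le> cnorm C x"
      using x y norm by auto
    show "x \<otimes>\<^bsub>C\<^esub> y \<otimes>\<^bsub>C\<^esub> z = x \<otimes>\<^bsub>C\<^esub> (y \<otimes>\<^bsub>C\<^esub> z)"
      "(x \<oplus>\<^bsub>C\<^esub> y) \<otimes>\<^bsub>C\<^esub> z = x \<otimes>\<^bsub>C\<^esub> z \<oplus>\<^bsub>C\<^esub> y \<otimes>\<^bsub>C\<^esub> z"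
      "z \<otimes>\<^bsub>C\<^esub> (x \<oplus>\<^bsub>C\<^esub> y) = z \<otimes>\<^bsub>C\<^esub> x \<oplus>\<^bsub>C\<^esub> z \<otimes>\<^bsub>C\<^esub> y"
      "(c \<odot>\<^bsub>C\<^esub> x) \<otimes>\<^bsub>C\<^esub> y = c \<odot>\<^bsub>C\<^esub> (x \<otimes>\<^bsub>C\<^esub> y)"
      "x \<otimes>\<^bsub>C\<^esub> (c \<odot>\<^bsub>C\<^esub> y) = c \<odot>\<^bsub>C\<^esub> (x \<otimes>\<^bsub>C\<^esub> y)"
      "star C (star C x) = x"
      "star C (x \<oplus>\<^bsub>C\<^esub> y) = star C x \<oplus>\<^bsub>C\<^esub> star C y"
      "star C (c \<odot>\<^bsub>C\<^esub> x) = cnj c \<odot>\<^bsub>C\<^esub> star C x"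
      "star C (x \<otimes>\<^bsub>C\<^esub> y) = star C y \<otimes>\<^bsub>C\<^esub> star C x"
      using x y z by (auto intro!: inj simp: alg)
    show "cnorm C x = 0 \<longleftrightarrow> x = \<zero>\<^bsub>C\<^esub>"
    proof
      assume "cnorm C x = 0"
      then have "cnorm (A i) (p i x) = 0" if "i \<in> I" for i
        using pn[OF that x] cstar_algebra.norm_nonneg[OF A[OF that] p[OF that x]] by simp
      then show "x = \<zero>\<^bsub>C\<^esub>"
        using x by (intro inj) (auto simp: cstar_algebra.norm_eq_zero[OF A])
    next
      assume "x = \<zero>\<^bsub>C\<^esub>"
      then have "cnorm C x \<le> 0"
        by (subst norm(2)) (auto simp: cstar_algebra.norm_zero[OF A])
      then show "cnorm C x = 0" using norm(1)[OF x] by simp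
    qed
    show "cnorm C (x \<oplus>\<^bsub>C\<^esub> y) \<le> cnorm C x + cnorm C y"
      using x y pn by (subst norm(2))
        (auto intro!: norm(1) add_nonneg_nonneg order_trans[OF cstar_algebra.norm_triangle[OF A]] add_mono)
    show "cnorm C (x \<otimes>\<^bsub>C\<^esub> y) \<le> cnorm C x * cnorm C y"
      using x y pn by (subst norm(2))
        (auto intro!: norm(1) mult_nonneg_nonneg order_trans[OF cstar_algebra.norm_mult_le[OF A]] mult_mono
          cstar_algebra.norm_nonneg[OF A])
    have sm: "cnorm C (d \<odot>\<^bsub>C\<^esub> w) \<le> cmod d * cnorm C w" if "w \<in> carrier C" for d w
      using that pn by (subst norm(2))
        (auto intro!: norm(1) mult_nonneg_nonneg mult_left_mono simp: cstar_algebra.norm_smult[OF A])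
    show "cnorm C (c \<odot>\<^bsub>C\<^esub> x) = cmod c * cnorm C x"
    proof (cases "c = 0")
      case True
      then show ?thesis using sm[OF x, of c] norm(1)[of "c \<odot>\<^bsub>C\<^esub> x"] x by simp
    next
      case False
      \<comment> \<open>The coordinates give only the inequality \<open>sm\<close>; its converse is
        \<open>sm\<close> for the inverse scalar, applied to the multiple of x by c.\<close>
      have "inverse c \<odot>\<^bsub>C\<^esub> (c \<odot>\<^bsub>C\<^esub> x) = x"
        using False x by (intro inj) (auto simp: lin(8)[symmetric] lin)
      then have "cnorm C x \<le> inverse (cmod c) * cnorm C (c \<odot>\<^bsub>C\<^esub> x)"
        using sm[of "c \<odot>\<^bsub>C\<^esub> x" "inverse c"] x by (simp add: norm_inverse)
      then have "cmod c * cnorm C x \<le> cnorm C (c \<odot>\<^bsub>C\<^esub> x)"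
        using False by (simp add: field_simps)
      then show ?thesis using sm[OF x, of c] by simp
    qed
    show "cnorm C (star C x \<otimes>\<^bsub>C\<^esub> x) = (cnorm C x)\<^sup>2"
    proof (rule antisym)
      show "cnorm C (star C x \<otimes>\<^bsub>C\<^esub> x) \<le> (cnorm C x)\<^sup>2"
        using x pn by (subst norm(2)) (auto intro!: power_mono
            simp: cstar_algebra.cstar_identity[OF A] cstar_algebra.norm_nonneg[OF A])
      \<comment> \<open>\<open>norm(2)\<close> only tests upper bounds of the norm of x itself, so
        the square is moved to the other side as a root before passing to coordinates.\<close>
      have "cnorm C x \<le> sqrt (cnorm C (star C x \<otimes>\<^bsub>C\<^esub> x))"
      proof (subst norm(2)[OF x]; (intro ballI real_le_rsqrt)?)
        fix i assume i: "i \<in> I"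
        show "(cnorm (A i) (p i x))\<^sup>2 \<le> cnorm C (star C x \<otimes>\<^bsub>C\<^esub> x)"
          using pn[OF i, of "star C x \<otimes>\<^bsub>C\<^esub> x"] x i
          by (simp add: cstar_algebra.cstar_identity[OF A])
      qed (use norm x in auto)
      then show "(cnorm C x)\<^sup>2 \<le> cnorm C (star C x \<otimes>\<^bsub>C\<^esub> x)"
        using norm(1) x by (metis real_sqrt_le_iff real_sqrt_abs abs_of_nonneg)
    qed
  next
    fix s assume s: "\<forall>n. s n \<in> carrier C" and "norm_Cauchy C s"
    then have Cauchy: "\<exists>N. \<forall>m\<ge>N. \<forall>n\<ge>N. cnorm C (s m \<ominus>\<^bsub>C\<^esub> s n) < e" if "0 < e" for e
      using that by (auto simp: norm_Cauchy_def)
    have "\<exists>N. \<forall>m\<ge>N. \<forall>n\<ge>N. \<forall>i\<in>I. cnorm (A i) (p i (s m) \<ominus>\<^bsub>A i\<^esub> p i (s n)) < e"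
      if e: "0 < e" for e
    proof -
      obtain N where N: "\<forall>m\<ge>N. \<forall>n\<ge>N. cnorm C (s m \<ominus>\<^bsub>C\<^esub> s n) < e" using Cauchy[OF e] by blast
      have "cnorm (A i) (p i (s m) \<ominus>\<^bsub>A i\<^esub> p i (s n)) < e" if "m \<ge> N" "n \<ge> N" "i \<in> I" for m n i
        using pn[OF that(3) Cminus, of "s m" "s n"] N that s pminus by force
      then show ?thesis by blast
    qed
    then obtain y where y: "\<And>i. i \<in> I \<Longrightarrow> y i \<in> carrier (A i)"
        "\<And>e. 0 < e \<Longrightarrow> \<exists>N. \<forall>n\<ge>N. \<forall>i\<in>I. cnorm (A i) (p i (s n) \<ominus>\<^bsub>A i\<^esub> y i) \<le> e"
      using uniformly_Cauchy_converges[of I A "\<lambda>n i. p i (s n)", OF A p[OF _ s[rule_format]]]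
      by metis
    then obtain x where x: "x \<in> carrier C" "\<forall>i\<in>I. p i x = y i"
      using complete[of s y] s by blast
    have "norm_converges C s x"
      unfolding norm_converges_def
    proof (rule LIMSEQ_I)
      fix r :: real assume r: "0 < r"
      then obtain N where N: "\<forall>n\<ge>N. \<forall>i\<in>I. cnorm (A i) (p i (s n) \<ominus>\<^bsub>A i\<^esub> y i) \<le> r / 2"
        using y(2)[of "r / 2"] by auto
      have "cnorm C (s n \<ominus>\<^bsub>C\<^esub> x) \<le> r / 2" if "n \<ge> N" for n
        using N that r s x by (subst norm(2)) (auto simp: pminus Cminus)
      then show "\<exists>N. \<forall>n\<ge>N. norm (cnorm C (s n \<ominus>\<^bsub>C\<^esub> x) - 0) < r"
        using r s x norm(1)[OF Cminus] by (intro exI[of _ N]) fastforce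
    qed
    with x show "\<exists>x\<in>carrier C. norm_converges C s x" by blast
  qed
qed


section \<open>Matrix algebras\<close>

lemma vec_l2norm_eq_L2_set: "vec_l2norm v = L2_set (\<lambda>i. cmod (v $ i)) {..<dim_vec v}"
  by (simp add: vec_l2norm_def L2_set_def)

lemma vec_l2norm_nonneg [simp]: "0 \<le> vec_l2norm v"
  by (simp add: vec_l2norm_eq_L2_set)

lemma vec_l2norm_zero [simp]: "vec_l2norm (0\<^sub>v n) = 0"
  by (simp add: vec_l2norm_def)

lemma vec_l2norm_smult: "vec_l2norm (c \<cdot>\<^sub>v v) = cmod c * vec_l2norm v"
  by (simp add: vec_l2norm_eq_L2_set L2_set_right_distrib norm_mult cong: L2_set_cong_simp)

lemma vec_l2norm_triangle:
  assumes "dim_vec v = dim_vec w"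
  shows "vec_l2norm (v + w) \<le> vec_l2norm v + vec_l2norm w"
proof -
  have "L2_set (\<lambda>i. cmod ((v + w) $ i)) {..<dim_vec w}
      \<le> L2_set (\<lambda>i. cmod (v $ i) + cmod (w $ i)) {..<dim_vec w}"
    using assms by (intro L2_set_mono) (auto simp: norm_triangle_ineq)
  also have "\<dots> \<le> L2_set (\<lambda>i. cmod (v $ i)) {..<dim_vec w} + L2_set (\<lambda>i. cmod (w $ i)) {..<dim_vec w}"
    by (rule L2_set_triangle_ineq)
  finally show ?thesis using assms by (simp add: vec_l2norm_eq_L2_set)
qed

lemma index_le_vec_l2norm: "i < dim_vec v \<Longrightarrow> cmod (v $ i) \<le> vec_l2norm v"
  unfolding vec_l2norm_eq_L2_set by (rule member_le_L2_set) auto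

lemma vec_l2norm_eq_zero:
  assumes "v \<in> carrier_vec n" "vec_l2norm v = 0"
  shows "v = 0\<^sub>v n"
  using assms index_le_vec_l2norm[of _ v] by (intro eq_vecI) fastforce+

text \<open>A crude bound, whose purpose is twofold: it makes the supremum in
  \<open>mat_opnorm\<close> finite, and it turns entrywise convergence into convergence in
  norm.\<close>

lemma vec_l2norm_mult_mat_vec_le_sum:
  assumes "v \<in> carrier_vec (dim_col M)"
  shows "vec_l2norm (M *\<^sub>v v) \<le> (\<Sum>i<dim_row M. \<Sum>j<dim_col M. cmod (M $$ (i, j))) * vec_l2norm v"
proof -
  have "vec_l2norm (M *\<^sub>v v) \<le> (\<Sum>i<dim_row M. cmod ((M *\<^sub>v v) $ i))"
    using L2_set_le_sum[of "{..<dim_row M}" "\<lambda>i. cmod ((M *\<^sub>v v) $ i)"]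
    by (simp add: vec_l2norm_eq_L2_set)
  also have "\<dots> \<le> (\<Sum>i<dim_row M. \<Sum>j<dim_col M. cmod (M $$ (i, j)) * vec_l2norm v)"
  proof (intro sum_mono)
    fix i assume "i \<in> {..<dim_row M}"
    then have "cmod ((M *\<^sub>v v) $ i) = cmod (\<Sum>j<dim_col M. M $$ (i, j) * v $ j)"
      using assms by (simp add: scalar_prod_def atLeast0LessThan)
    also have "\<dots> \<le> (\<Sum>j<dim_col M. cmod (M $$ (i, j)) * vec_l2norm v)"
      using assms by (intro sum_norm_le) (auto simp: norm_mult intro!: mult_left_mono index_le_vec_l2norm)
    finally show "cmod ((M *\<^sub>v v) $ i) \<le> (\<Sum>j<dim_col M. cmod (M $$ (i, j)) * vec_l2norm v)" .
  qed
  finally show ?thesis by (simp add: sum_distrib_right)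
qed

lemma mat_opnorm_bdd_above:
  "bdd_above ((\<lambda>v. vec_l2norm (M *\<^sub>v v)) ` {v \<in> carrier_vec (dim_col M). vec_l2norm v \<le> 1})"
proof (rule bdd_aboveI2)
  fix v :: "complex vec" assume v: "v \<in> {v \<in> carrier_vec (dim_col M). vec_l2norm v \<le> 1}"
  then have "vec_l2norm (M *\<^sub>v v)
      \<le> (\<Sum>i<dim_row M. \<Sum>j<dim_col M. cmod (M $$ (i, j))) * vec_l2norm v"
    by (intro vec_l2norm_mult_mat_vec_le_sum) auto
  also have "\<dots> \<le> (\<Sum>i<dim_row M. \<Sum>j<dim_col M. cmod (M $$ (i, j))) * 1"
    using v by (intro mult_left_mono) (auto intro!: sum_nonneg)
  finally show "vec_l2norm (M *\<^sub>v v) \<le> (\<Sum>i<dim_row M. \<Sum>j<dim_col M. cmod (M $$ (i, j)))"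
    by simp
qed

lemma mat_opnorm_nonneg [simp]: "0 \<le> mat_opnorm M"
proof -
  have "vec_l2norm (M *\<^sub>v 0\<^sub>v (dim_col M)) \<le> mat_opnorm M"
    unfolding mat_opnorm_def by (rule cSUP_upper[OF _ mat_opnorm_bdd_above]) simp
  then show ?thesis using vec_l2norm_nonneg order_trans by blast
qed

lemma vec_l2norm_mult_mat_vec_le:
  assumes "v \<in> carrier_vec (dim_col M)"
  shows "vec_l2norm (M *\<^sub>v v) \<le> mat_opnorm M * vec_l2norm v"
proof (cases "vec_l2norm v = 0")
  case True
  then have "v = 0\<^sub>v (dim_col M)" using assms vec_l2norm_eq_zero by blast
  moreover have "M *\<^sub>v 0\<^sub>v (dim_col M) = 0\<^sub>v (dim_row M)" by (intro eq_vecI) auto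
  ultimately show ?thesis by simp
next
  case False
  then have pos: "0 < vec_l2norm v" using vec_l2norm_nonneg[of v] by linarith
  let ?u = "complex_of_real (inverse (vec_l2norm v)) \<cdot>\<^sub>v v"
  have "vec_l2norm ?u = 1" using pos by (simp add: vec_l2norm_smult norm_inverse)
  then have "vec_l2norm (M *\<^sub>v ?u) \<le> mat_opnorm M"
    unfolding mat_opnorm_def using assms by (intro cSUP_upper[OF _ mat_opnorm_bdd_above]) simp
  moreover have "M *\<^sub>v ?u = complex_of_real (inverse (vec_l2norm v)) \<cdot>\<^sub>v (M *\<^sub>v v)"
    using assms by (intro mult_mat_vec) auto
  ultimately have "inverse (vec_l2norm v) * vec_l2norm (M *\<^sub>v v) \<le> mat_opnorm M"
    using pos by (simp add: vec_l2norm_smult norm_inverse)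
  then show ?thesis using pos by (simp add: field_simps)
qed

lemma mat_opnorm_leI:
  assumes "0 \<le> r" "\<And>v. v \<in> carrier_vec (dim_col M) \<Longrightarrow> vec_l2norm (M *\<^sub>v v) \<le> r * vec_l2norm v"
  shows "mat_opnorm M \<le> r"
  unfolding mat_opnorm_def
proof (rule cSUP_least)
  show "{v \<in> carrier_vec (dim_col M). vec_l2norm v \<le> 1} \<noteq> {}"
    by (auto intro!: exI[of _ "0\<^sub>v (dim_col M)"])
  fix v :: "complex vec" assume v: "v \<in> {v \<in> carrier_vec (dim_col M). vec_l2norm v \<le> 1}"
  then have "vec_l2norm (M *\<^sub>v v) \<le> r * vec_l2norm v" using assms by blast
  also have "\<dots> \<le> r" using v \<open>0 \<le> r\<close> mult_left_mono[of "vec_l2norm v" 1 r] by simp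
  finally show "vec_l2norm (M *\<^sub>v v) \<le> r" .
qed

lemma mat_opnorm_le_sum:
  "mat_opnorm M \<le> (\<Sum>i<dim_row M. \<Sum>j<dim_col M. cmod (M $$ (i, j)))"
  by (intro mat_opnorm_leI vec_l2norm_mult_mat_vec_le_sum sum_nonneg) auto

lemma index_le_mat_opnorm:
  assumes "i < dim_row M" "j < dim_col M"
  shows "cmod (M $$ (i, j)) \<le> mat_opnorm M"
proof -
  have "vec_l2norm (unit_vec (dim_col M) j) = 1"
  proof -
    have "(\<Sum>i<dim_col M. (cmod (unit_vec (dim_col M) j $ i))\<^sup>2) = (\<Sum>i<dim_col M. if i = j then 1 else 0)"
      by (intro sum.cong) (auto simp: unit_vec_def)
    then show ?thesis using assms by (simp add: vec_l2norm_def)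
  qed
  moreover have "M *\<^sub>v unit_vec (dim_col M) j = col M j" using assms by (intro eq_vecI) auto
  ultimately show ?thesis
    using vec_l2norm_mult_mat_vec_le[of "unit_vec (dim_col M) j" M] assms
      index_le_vec_l2norm[of i "col M j"] by simp
qed

lemma mat_adjoint_carrier [simp]: "A \<in> carrier_mat n m \<Longrightarrow> mat_adjoint A \<in> carrier_mat m n"
  by (auto simp: mat_adjoint_def)

lemma dim_mat_adjoint [simp]:
  "dim_row (mat_adjoint A) = dim_col A" "dim_col (mat_adjoint A) = dim_row A"
  by (auto simp: mat_adjoint_def)

lemma index_mat_adjoint [simp]:
  "i < dim_col A \<Longrightarrow> j < dim_row A \<Longrightarrow> mat_adjoint A $$ (i, j) = cnj (A $$ (j, i))"
  by (simp add: mat_adjoint_def mat_of_rows_def)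

text \<open>Cauchy-Schwarz: |Mv|^2 is the inner product of v with M* M v, hence at most |v| |M* M
  v|.\<close>

lemma mat_opnorm_sq_le: "(mat_opnorm M)\<^sup>2 \<le> mat_opnorm (mat_adjoint M * M)"
proof -
  let ?N = "mat_opnorm (mat_adjoint M * M)"
  have "mat_opnorm M \<le> sqrt ?N"
  proof (rule mat_opnorm_leI)
    fix v :: "complex vec" assume v: "v \<in> carrier_vec (dim_col M)"
    let ?w = "M *\<^sub>v v" and ?u = "mat_adjoint M *\<^sub>v (M *\<^sub>v v)"
    have "complex_of_real ((vec_l2norm ?w)\<^sup>2) = (\<Sum>i<dim_row M. ?w $ i * cnj (?w $ i))"
      by (simp add: vec_l2norm_def sum_nonneg complex_norm_square flip: of_real_power)
    also have "\<dots> = (\<Sum>i<dim_row M. \<Sum>j<dim_col M. M $$ (i, j) * v $ j * cnj (?w $ i))"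
      using v by (intro sum.cong) (auto simp: scalar_prod_def atLeast0LessThan sum_distrib_right)
    also have "\<dots> = (\<Sum>j<dim_col M. \<Sum>i<dim_row M. M $$ (i, j) * v $ j * cnj (?w $ i))"
      by (rule sum.swap)
    also have "\<dots> = (\<Sum>j<dim_col M. v $ j * cnj (?u $ j))"
      by (intro sum.cong) (auto simp: scalar_prod_def atLeast0LessThan sum_distrib_left
          mat_adjoint_def mat_of_rows_def mult_ac intro!: sum.cong)
    finally have "(vec_l2norm ?w)\<^sup>2 = cmod (\<Sum>j<dim_col M. v $ j * cnj (?u $ j))"
      by (metis abs_of_nonneg norm_of_real zero_le_power2)
    also have "\<dots> \<le> (\<Sum>j<dim_col M. \<bar>cmod (v $ j)\<bar> * \<bar>cmod (?u $ j)\<bar>)"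
      by (intro sum_norm_le) (simp add: norm_mult)
    also have "\<dots> \<le> vec_l2norm v * vec_l2norm ?u"
      using v L2_set_mult_ineq[of "\<lambda>j. cmod (v $ j)" "\<lambda>j. cmod (?u $ j)" "{..<dim_col M}"]
      by (simp add: vec_l2norm_eq_L2_set)
    also have "?u = (mat_adjoint M * M) *\<^sub>v v"
      using v by (intro assoc_mult_mat_vec[symmetric, of _ "dim_col M" "dim_row M" _ "dim_col M"]) auto
    also have "vec_l2norm v * vec_l2norm \<dots> \<le> vec_l2norm v * (?N * vec_l2norm v)"
      using v by (intro mult_left_mono vec_l2norm_mult_mat_vec_le) auto
    finally have "(vec_l2norm ?w)\<^sup>2 \<le> (sqrt ?N * vec_l2norm v)\<^sup>2"
      by (simp add: power2_eq_square mult_ac)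
    then show "vec_l2norm ?w \<le> sqrt ?N * vec_l2norm v"
      by (rule power2_le_imp_le) simp
  qed simp
  then show ?thesis using real_le_rsqrt real_sqrt_le_iff by (metis mat_opnorm_nonneg power_mono real_sqrt_pow2)
qed

lemma mat_opnorm_mult_le:
  assumes "A \<in> carrier_mat n m" "B \<in> carrier_mat m l"
  shows "mat_opnorm (A * B) \<le> mat_opnorm A * mat_opnorm B"
proof (rule mat_opnorm_leI)
  fix v :: "complex vec" assume "v \<in> carrier_vec (dim_col (A * B))"
  then have v: "v \<in> carrier_vec l" using assms by simp
  have "vec_l2norm (A * B *\<^sub>v v) = vec_l2norm (A *\<^sub>v (B *\<^sub>v v))"
    using assms v by simp
  also have "\<dots> \<le> mat_opnorm A * vec_l2norm (B *\<^sub>v v)"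
    using assms v by (intro vec_l2norm_mult_mat_vec_le) auto
  also have "\<dots> \<le> mat_opnorm A * (mat_opnorm B * vec_l2norm v)"
    using assms v by (intro mult_left_mono vec_l2norm_mult_mat_vec_le) auto
  finally show "vec_l2norm (A * B *\<^sub>v v) \<le> mat_opnorm A * mat_opnorm B * vec_l2norm v"
    by (simp add: mult_ac)
qed simp

lemma mat_opnorm_triangle:
  assumes "A \<in> carrier_mat n m" "B \<in> carrier_mat n m"
  shows "mat_opnorm (A + B) \<le> mat_opnorm A + mat_opnorm B"
proof (rule mat_opnorm_leI)
  fix v :: "complex vec" assume "v \<in> carrier_vec (dim_col (A + B))"
  then have v: "v \<in> carrier_vec m" using assms by simp
  have "vec_l2norm ((A + B) *\<^sub>v v) = vec_l2norm (A *\<^sub>v v + B *\<^sub>v v)"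
    using assms v by (simp add: add_mult_distrib_mat_vec[of _ n m])
  also have "\<dots> \<le> vec_l2norm (A *\<^sub>v v) + vec_l2norm (B *\<^sub>v v)"
    using assms by (intro vec_l2norm_triangle) auto
  also have "\<dots> \<le> mat_opnorm A * vec_l2norm v + mat_opnorm B * vec_l2norm v"
    using assms v by (intro add_mono vec_l2norm_mult_mat_vec_le) auto
  finally show "vec_l2norm ((A + B) *\<^sub>v v) \<le> (mat_opnorm A + mat_opnorm B) * vec_l2norm v"
    by (simp add: algebra_simps)
qed simp

lemma mat_opnorm_smult: "mat_opnorm (c \<cdot>\<^sub>m M) = cmod c * mat_opnorm M"
proof -
  have le: "mat_opnorm (c \<cdot>\<^sub>m M) \<le> cmod c * mat_opnorm M" for c and M :: "complex mat"
  proof (rule mat_opnorm_leI)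
    fix v :: "complex vec" assume "v \<in> carrier_vec (dim_col (c \<cdot>\<^sub>m M))"
    then have v: "v \<in> carrier_vec (dim_col M)" by simp
    have "(c \<cdot>\<^sub>m M) *\<^sub>v v = c \<cdot>\<^sub>v (M *\<^sub>v v)" using v by (intro eq_vecI) auto
    then show "vec_l2norm ((c \<cdot>\<^sub>m M) *\<^sub>v v) \<le> cmod c * mat_opnorm M * vec_l2norm v"
      using vec_l2norm_mult_mat_vec_le[OF v] by (simp add: vec_l2norm_smult mult_left_mono mult.assoc)
  qed simp
  show ?thesis
  proof (cases "c = 0")
    case True
    then show ?thesis using le[of 0 M] mat_opnorm_nonneg[of "0 \<cdot>\<^sub>m M"] by simp
  next
    case False
    have "inverse c \<cdot>\<^sub>m (c \<cdot>\<^sub>m M) = M" using False by (intro eq_matI) auto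
    then have "mat_opnorm M \<le> inverse (cmod c) * mat_opnorm (c \<cdot>\<^sub>m M)"
      using le[of "inverse c" "c \<cdot>\<^sub>m M"] by (simp add: norm_inverse)
    then show ?thesis using le[of c M] False by (simp add: field_simps)
  qed
qed

lemma mat_opnorm_zero [simp]: "mat_opnorm (0\<^sub>m n m) = 0"
  using mat_opnorm_le_sum[of "0\<^sub>m n m"] mat_opnorm_nonneg[of "0\<^sub>m n m"] by simp

lemma mat_opnorm_eq_zero:
  assumes "M \<in> carrier_mat n m" "mat_opnorm M = 0"
  shows "M = 0\<^sub>m n m"
  using assms index_le_mat_opnorm[of _ M] by (intro eq_matI) fastforce+

lemma mat_adjoint_mult:
  fixes A B :: "complex mat"
  assumes "A \<in> carrier_mat n m" "B \<in> carrier_mat m l"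
  shows "mat_adjoint (A * B) = mat_adjoint B * mat_adjoint A"
  using assms by (intro eq_matI) (auto simp: scalar_prod_def mult.commute intro!: sum.cong)

lemma mat_adjoint_adjoint [simp]: "mat_adjoint (mat_adjoint A) = (A :: complex mat)"
  by (intro eq_matI) auto

text \<open>The cancellation of \<open>norm_star\<close> is repeated here because this fact is
  itself used to establish the C*-identity of \<open>mat_cstar\<close>.\<close>

lemma mat_opnorm_adjoint: "mat_opnorm (mat_adjoint M) = mat_opnorm M"
proof -
  have le: "mat_opnorm M \<le> mat_opnorm (mat_adjoint M)" for M
  proof (cases "mat_opnorm M = 0")
    case False
    then have "0 < mat_opnorm M" using mat_opnorm_nonneg[of M] by linarith
    moreover have "mat_opnorm M * mat_opnorm M \<le> mat_opnorm (mat_adjoint M) * mat_opnorm M"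
      using mat_opnorm_sq_le[of M] mat_opnorm_mult_le[of "mat_adjoint M" _ _ M]
      by (fastforce simp: power2_eq_square)
    ultimately show ?thesis by simp
  qed simp
  from le[of M] le[of "mat_adjoint M"] show ?thesis by simp
qed

lemma mat_cstar_simps [simp]:
  "carrier (mat_cstar d) = carrier_mat d d" "mult (mat_cstar d) = (*)"
  "one (mat_cstar d) = 1\<^sub>m d" "zero (mat_cstar d) = 0\<^sub>m d d" "add (mat_cstar d) = (+)"
  "smult (mat_cstar d) = (\<cdot>\<^sub>m)" "star (mat_cstar d) = mat_adjoint"
  "cnorm (mat_cstar d) = mat_opnorm"
  by (simp_all add: mat_cstar_def)

lemma vectorspace_mat_cstar: "vectorspace class_ring (mat_cstar d)"
  by (rule vectorspace_image[OF matrix_vs[of d d], where f = "\<lambda>x. x"]) (auto simp: module_mat_simps)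

lemma mat_cstar_minus:
  assumes "y \<in> carrier_mat d d"
  shows "x \<ominus>\<^bsub>mat_cstar d\<^esub> y = x - y"
  using assms by (subst minus_eq_add_smult[OF vectorspace_mat_cstar]) (auto intro!: eq_matI)

theorem cstar_algebra_mat_cstar: "cstar_algebra (mat_cstar d)"
proof (rule cstar_algebra.intro[OF vectorspace_mat_cstar], unfold_locales; simp?)
  fix x y z :: "complex mat" and c
  assume x: "x \<in> carrier_mat d d"
  show "mat_opnorm (c \<cdot>\<^sub>m x) = cmod c * mat_opnorm x" by (rule mat_opnorm_smult)
  show "mat_adjoint (c \<cdot>\<^sub>m x) = cnj c \<cdot>\<^sub>m mat_adjoint x"
    using x by (intro eq_matI) auto
  show "mat_opnorm x = 0 \<longleftrightarrow> x = 0\<^sub>m d d"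
    using x mat_opnorm_eq_zero by auto
  show "mat_opnorm (mat_adjoint x * x) = (mat_opnorm x)\<^sup>2"
    using mat_opnorm_sq_le[of x] mat_opnorm_mult_le[of "mat_adjoint x" d d x] x
    by (simp add: mat_opnorm_adjoint power2_eq_square)
  assume y: "y \<in> carrier_mat d d"
  show "mat_opnorm (x + y) \<le> mat_opnorm x + mat_opnorm y"
    using x y by (rule mat_opnorm_triangle)
  show "mat_opnorm (x * y) \<le> mat_opnorm x * mat_opnorm y"
    using x y by (rule mat_opnorm_mult_le)
  show "mat_adjoint (x + y) = mat_adjoint x + mat_adjoint y"
    using x y by (intro eq_matI) auto
  show "mat_adjoint (x * y) = mat_adjoint y * mat_adjoint x"
    using x y by (rule mat_adjoint_mult)
  show "(c \<cdot>\<^sub>m x) * y = c \<cdot>\<^sub>m (x * y)" "x * (c \<cdot>\<^sub>m y) = c \<cdot>\<^sub>m (x * y)"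
    using x y by auto
  assume z: "z \<in> carrier_mat d d"
  show "(x + y) * z = x * z + y * z" "z * (x + y) = z * x + z * y"
    using x y z by (auto simp: add_mult_distrib_mat mult_add_distrib_mat)
next
  fix s :: "nat \<Rightarrow> complex mat"
  assume s: "\<forall>n. s n \<in> carrier_mat d d" and C: "norm_Cauchy (mat_cstar d) s"
  have sd: "dim_row (s n) = d" "dim_col (s n) = d" for n using s by auto
  \<comment> \<open>Entries are dominated by the operator norm, and the operator norm by the sum of
    all entry moduli; so the entrywise limit is also the limit in norm.\<close>
  have "Cauchy (\<lambda>n. s n $$ (i, j))" if ij: "i < d" "j < d" for i j
  proof (rule metric_CauchyI)
    fix e :: real assume "0 < e"
    with C obtain N where N: "\<forall>m\<ge>N. \<forall>n\<ge>N. mat_opnorm (s m - s n) < e"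
      using s by (auto simp: norm_Cauchy_def mat_cstar_minus)
    have "dist (s m $$ (i, j)) (s n $$ (i, j)) < e" if "m \<ge> N" "n \<ge> N" for m n
      using index_le_mat_opnorm[of i "s m - s n" j] N that ij sd
      by (force simp: dist_norm intro: order.strict_trans1)
    then show "\<exists>M. \<forall>m\<ge>M. \<forall>n\<ge>M. dist (s m $$ (i, j)) (s n $$ (i, j)) < e" by blast
  qed
  then have "\<exists>l. (\<lambda>n. s n $$ (i, j)) \<longlonglongrightarrow> l" if "i < d" "j < d" for i j
    using that Cauchy_convergent_iff convergent_def by blast
  then obtain l where l: "\<And>i j. \<lbrakk>i < d; j < d\<rbrakk> \<Longrightarrow> (\<lambda>n. s n $$ (i, j)) \<longlonglongrightarrow> l i j" by metis
  let ?L = "mat d d (\<lambda>(i, j). l i j)"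
  have "(\<lambda>n. \<Sum>i<d. \<Sum>j<d. cmod (s n $$ (i, j) - l i j)) \<longlonglongrightarrow> (\<Sum>i<d. \<Sum>j<d. 0)"
    using l by (intro tendsto_sum) (auto intro!: tendsto_norm_zero simp: LIM_zero_iff)
  moreover have "mat_opnorm (s n - ?L) \<le> (\<Sum>i<d. \<Sum>j<d. cmod (s n $$ (i, j) - l i j))" for n
    using mat_opnorm_le_sum[of "s n - ?L"] by simp
  ultimately have "(\<lambda>n. mat_opnorm (s n - ?L)) \<longlonglongrightarrow> 0"
    by (intro tendsto_sandwich[of "\<lambda>_. 0" "\<lambda>n. mat_opnorm (s n - ?L)"]) (auto intro: always_eventually)
  then show "\<exists>x\<in>carrier_mat d d. norm_converges (mat_cstar d) s x"
    by (intro bexI[of _ ?L]) (auto simp: norm_converges_def mat_cstar_minus)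
qed


section \<open>Direct sums, products and block diagonal matrices\<close>

lemma direct_sum_simps:
  "carrier (direct_sum As) = {xs. length xs = length As \<and> (\<forall>i<length As. xs ! i \<in> carrier (As ! i))}"
  "mult (direct_sum As) xs ys = map (\<lambda>i. xs ! i \<otimes>\<^bsub>As ! i\<^esub> ys ! i) [0..<length As]"
  "one (direct_sum As) = map (\<lambda>i. \<one>\<^bsub>As ! i\<^esub>) [0..<length As]"
  "zero (direct_sum As) = map (\<lambda>i. \<zero>\<^bsub>As ! i\<^esub>) [0..<length As]"
  "add (direct_sum As) xs ys = map (\<lambda>i. xs ! i \<oplus>\<^bsub>As ! i\<^esub> ys ! i) [0..<length As]"
  "smult (direct_sum As) c xs = map (\<lambda>i. c \<odot>\<^bsub>As ! i\<^esub> (xs ! i)) [0..<length As]"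
  "star (direct_sum As) xs = map (\<lambda>i. star (As ! i) (xs ! i)) [0..<length As]"
  "cnorm (direct_sum As) xs = Max (insert 0 ((\<lambda>i. cnorm (As ! i) (xs ! i)) ` {..<length As}))"
  by (simp_all add: direct_sum_def)

lemma cnorm_direct_sum_nonneg: "0 \<le> cnorm (direct_sum As) xs"
  by (simp add: direct_sum_simps)

lemma cnorm_direct_sum_le_iff:
  "0 \<le> r \<Longrightarrow> cnorm (direct_sum As) xs \<le> r \<longleftrightarrow> (\<forall>i<length As. cnorm (As ! i) (xs ! i) \<le> r)"
  by (auto simp: direct_sum_simps)

theorem cstar_algebra_direct_sum:
  assumes "\<And>A. A \<in> set As \<Longrightarrow> cstar_algebra A"
  shows "cstar_algebra (direct_sum As)"
proof (rule cstar_algebra_subdirectI[where I = "{..<length As}" and A = "nth As" and p = "\<lambda>i xs. xs ! i"])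
  have A: "cstar_algebra (As ! i)" if "i < length As" for i using assms that by simp
  then show "\<And>i. i \<in> {..<length As} \<Longrightarrow> cstar_algebra (As ! i)" by simp
  have vs: "vectorspace class_ring (As ! i)" if "i < length As" for i
    using A[OF that] by (simp add: cstar_algebra_def)
  then have mod: "Module.module class_ring (As ! i)" if "i < length As" for i
    using that by (auto simp: vectorspace_def)
  then have ab: "abelian_monoid (As ! i)" if "i < length As" for i
    using that by (auto simp: Module.module_def abelian_group_def)
  note closed = abelian_monoid.zero_closed[OF ab] abelian_monoid.a_closed[OF ab]
    module.smult_closed[OF mod, simplified] cstar_algebra.mult_closed[OF A]
    cstar_algebra.star_closed[OF A]
  show "\<zero>\<^bsub>direct_sum As\<^esub> \<in> carrier (direct_sum As)"
    by (auto simp: direct_sum_simps closed)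
  show "\<zero>\<^bsub>direct_sum As\<^esub> ! i = \<zero>\<^bsub>As ! i\<^esub>" if "i \<in> {..<length As}" for i
    using that by (simp add: direct_sum_simps)
  fix xs ys c assume xs: "xs \<in> carrier (direct_sum As)"
  {
    fix i assume i: "i \<in> {..<length As}"
    show "xs ! i \<in> carrier (As ! i)" using xs i by (simp add: direct_sum_simps)
    show "(c \<odot>\<^bsub>direct_sum As\<^esub> xs) ! i = c \<odot>\<^bsub>As ! i\<^esub> xs ! i"
      "star (direct_sum As) xs ! i = star (As ! i) (xs ! i)"
      using i by (simp_all add: direct_sum_simps)
    assume "ys \<in> carrier (direct_sum As)"
    show "(xs \<oplus>\<^bsub>direct_sum As\<^esub> ys) ! i = xs ! i \<oplus>\<^bsub>As ! i\<^esub> ys ! i"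
      "(xs \<otimes>\<^bsub>direct_sum As\<^esub> ys) ! i = xs ! i \<otimes>\<^bsub>As ! i\<^esub> ys ! i"
      using i by (simp_all add: direct_sum_simps)
  }
  show "c \<odot>\<^bsub>direct_sum As\<^esub> xs \<in> carrier (direct_sum As)"
    "star (direct_sum As) xs \<in> carrier (direct_sum As)"
    using xs by (auto simp: direct_sum_simps closed)
  show "0 \<le> cnorm (direct_sum As) xs" by (rule cnorm_direct_sum_nonneg)
  show "cnorm (direct_sum As) xs \<le> r \<longleftrightarrow> (\<forall>i\<in>{..<length As}. cnorm (As ! i) (xs ! i) \<le> r)"
    if "0 \<le> r" for r
    using that by (auto simp: cnorm_direct_sum_le_iff)
  assume ys: "ys \<in> carrier (direct_sum As)"
  show "xs \<oplus>\<^bsub>direct_sum As\<^esub> ys \<in> carrier (direct_sum As)"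
    "xs \<otimes>\<^bsub>direct_sum As\<^esub> ys \<in> carrier (direct_sum As)"
    using xs ys by (auto simp: direct_sum_simps closed)
  show "xs = ys" if "\<And>i. i \<in> {..<length As} \<Longrightarrow> xs ! i = ys ! i"
    using xs ys that by (auto simp: direct_sum_simps intro: nth_equalityI)
next
  fix s :: "nat \<Rightarrow> 'a list" and y
  assume "\<And>i. i \<in> {..<length As} \<Longrightarrow> y i \<in> carrier (As ! i)"
  then show "\<exists>x\<in>carrier (direct_sum As). \<forall>i\<in>{..<length As}. x ! i = y i"
    by (intro bexI[of _ "map y [0..<length As]"]) (auto simp: direct_sum_simps)
qed

lemma unital_direct_sum:
  assumes "\<And>A. A \<in> set As \<Longrightarrow> unital A"
  shows "unital (direct_sum As)"
  using assms by (auto simp: unital_def direct_sum_simps intro!: nth_equalityI)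

lemma bounded_prod_simps:
  "mult (bounded_prod A) x y = (\<lambda>n. x n \<otimes>\<^bsub>A n\<^esub> y n)"
  "one (bounded_prod A) = (\<lambda>n. \<one>\<^bsub>A n\<^esub>)"
  "zero (bounded_prod A) = (\<lambda>n. \<zero>\<^bsub>A n\<^esub>)"
  "add (bounded_prod A) x y = (\<lambda>n. x n \<oplus>\<^bsub>A n\<^esub> y n)"
  "smult (bounded_prod A) c x = (\<lambda>n. c \<odot>\<^bsub>A n\<^esub> x n)"
  "star (bounded_prod A) x = (\<lambda>n. star (A n) (x n))"
  "cnorm (bounded_prod A) x = (SUP n. cnorm (A n) (x n))"
  by (simp_all add: bounded_prod_def)

lemma bounded_prod_carrier_iff:
  "x \<in> carrier (bounded_prod A) \<longleftrightarrow>
    (\<forall>n. x n \<in> carrier (A n)) \<and> (\<exists>B. \<forall>n. cnorm (A n) (x n) \<le> B)"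
  by (auto simp: bounded_prod_def bdd_above_def)

lemma cnorm_bounded_prod_le_iff:
  assumes "x \<in> carrier (bounded_prod A)"
  shows "cnorm (bounded_prod A) x \<le> r \<longleftrightarrow> (\<forall>n. cnorm (A n) (x n) \<le> r)"
  using assms by (subst bounded_prod_simps, subst cSUP_le_iff) (auto simp: bounded_prod_def)

theorem cstar_algebra_bounded_prod:
  assumes A: "\<And>n. cstar_algebra (A n)"
  shows "cstar_algebra (bounded_prod A)"
proof (rule cstar_algebra_subdirectI[where I = UNIV and A = A and p = "\<lambda>n x. x n"])
  let ?P = "bounded_prod A"
  have vs: "vectorspace class_ring (A n)" for n
    using A[of n] by (simp add: cstar_algebra_def)
  then have mod: "Module.module class_ring (A n)" for n
    by (auto simp: vectorspace_def)
  then have ab: "abelian_monoid (A n)" for n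
    by (auto simp: Module.module_def abelian_group_def)
  note closed = abelian_monoid.zero_closed[OF ab] abelian_monoid.a_closed[OF ab]
    module.smult_closed[OF mod, simplified] cstar_algebra.mult_closed[OF A]
    cstar_algebra.star_closed[OF A]
  show "\<zero>\<^bsub>?P\<^esub> \<in> carrier ?P"
    by (auto simp: bounded_prod_carrier_iff bounded_prod_simps closed cstar_algebra.norm_zero[OF A])
  fix x y c assume x: "x \<in> carrier ?P"
  then obtain B where B: "\<And>n. cnorm (A n) (x n) \<le> B" and xn: "\<And>n. x n \<in> carrier (A n)"
    by (auto simp: bounded_prod_carrier_iff)
  have B0: "0 \<le> B"
    using B[of 0] cstar_algebra.norm_nonneg[OF A xn, of 0] by linarith
  show "c \<odot>\<^bsub>?P\<^esub> x \<in> carrier ?P"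
    using B xn by (auto simp: bounded_prod_carrier_iff bounded_prod_simps closed
        cstar_algebra.norm_smult[OF A] intro!: exI[of _ "cmod c * B"] mult_left_mono)
  show "star ?P x \<in> carrier ?P"
    using B xn by (auto simp: bounded_prod_carrier_iff bounded_prod_simps closed
        cstar_algebra.norm_star[OF A])
  show "0 \<le> cnorm ?P x"
    using cnorm_bounded_prod_le_iff[OF x, of "cnorm ?P x"] cstar_algebra.norm_nonneg[OF A xn]
    by (meson order.refl order_trans)
  show "cnorm ?P x \<le> r \<longleftrightarrow> (\<forall>n\<in>UNIV. cnorm (A n) (x n) \<le> r)" for r
    using cnorm_bounded_prod_le_iff[OF x] by simp
  assume y: "y \<in> carrier ?P"
  then obtain B' where B': "\<And>n. cnorm (A n) (y n) \<le> B'" and yn: "\<And>n. y n \<in> carrier (A n)"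
    by (auto simp: bounded_prod_carrier_iff)
  have "cnorm (A n) (x n \<oplus>\<^bsub>A n\<^esub> y n) \<le> B + B'" for n
    using cstar_algebra.norm_triangle[OF A xn yn, of n] B[of n] B'[of n] by linarith
  then show "x \<oplus>\<^bsub>?P\<^esub> y \<in> carrier ?P"
    using xn yn by (auto simp: bounded_prod_carrier_iff bounded_prod_simps closed)
  have "cnorm (A n) (x n \<otimes>\<^bsub>A n\<^esub> y n) \<le> B * B'" for n
    using cstar_algebra.norm_mult_le[OF A xn yn, of n] B[of n] B'[of n] B0
      cstar_algebra.norm_nonneg[OF A yn, of n] mult_mono[OF B[of n] B'[of n]] by linarith
  then show "x \<otimes>\<^bsub>?P\<^esub> y \<in> carrier ?P"
    using xn yn by (auto simp: bounded_prod_carrier_iff bounded_prod_simps closed)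
next
  fix s :: "nat \<Rightarrow> nat \<Rightarrow> 'a" and y
  assume s: "\<And>k. s k \<in> carrier (bounded_prod A)" and y: "\<And>n. n \<in> UNIV \<Longrightarrow> y n \<in> carrier (A n)"
    and lim: "\<And>e. 0 < e \<Longrightarrow> \<exists>N. \<forall>k\<ge>N. \<forall>n\<in>UNIV. cnorm (A n) (s k n \<ominus>\<^bsub>A n\<^esub> y n) \<le> e"
  \<comment> \<open>A single term at uniform distance 1 from y bounds y, which is all that
    membership in the bounded product requires.\<close>
  obtain N where N: "\<And>n. cnorm (A n) (s N n \<ominus>\<^bsub>A n\<^esub> y n) \<le> 1" using lim[of 1] by auto
  have sn: "s N n \<in> carrier (A n)" for n using s[of N] by (simp add: bounded_prod_carrier_iff)
  obtain B where B: "\<And>n. cnorm (A n) (s N n) \<le> B" using s[of N] by (auto simp: bounded_prod_carrier_iff)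
  have "cnorm (A n) (y n) \<le> 1 + B" for n
    using cstar_algebra.norm_le_diff[OF A y sn, of n] N[of n] B[of n]
      cstar_algebra.norm_minus_commute[OF A y sn, of n] by simp
  then show "\<exists>x\<in>carrier (bounded_prod A). \<forall>n\<in>UNIV. x n = y n"
    using y by (intro bexI[of _ y]) (auto simp: bounded_prod_carrier_iff)
qed (auto simp: bounded_prod_carrier_iff bounded_prod_simps A)

section \<open>Block diagonal matrices: compatibility with the operations, entries and norm\<close>

lemma diag_block_mat_carrier:
  assumes "\<And>j. j \<in> set js \<Longrightarrow> f j \<in> carrier_mat (k j) (k j)"
  shows "diag_block_mat (map f js) \<in> carrier_mat (sum_list (map k js)) (sum_list (map k js))"
  using assms by (induction js) (auto simp: Let_def)

lemma diag_block_mat_Cons: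
  assumes "A \<in> carrier_mat n n" "diag_block_mat As \<in> carrier_mat m m"
  shows "diag_block_mat (A # As) = four_block_mat A (0\<^sub>m n m) (0\<^sub>m m n) (diag_block_mat As)"
  using assms by (auto simp: Let_def)

lemma diag_block_mat_add:
  fixes f g :: "'i \<Rightarrow> 'a :: comm_monoid_add mat"
  assumes "\<And>j. j \<in> set js \<Longrightarrow> f j \<in> carrier_mat (k j) (k j)"
    and "\<And>j. j \<in> set js \<Longrightarrow> g j \<in> carrier_mat (k j) (k j)"
  shows "diag_block_mat (map (\<lambda>j. f j + g j) js) = diag_block_mat (map f js) + diag_block_mat (map g js)"
  using assms
proof (induction js)
  case (Cons j js)
  let ?m = "sum_list (map k js)"
  have f: "f j \<in> carrier_mat (k j) (k j)" "diag_block_mat (map f js) \<in> carrier_mat ?m ?m"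
    using Cons.prems by (auto intro: diag_block_mat_carrier)
  have g: "g j \<in> carrier_mat (k j) (k j)" "diag_block_mat (map g js) \<in> carrier_mat ?m ?m"
    using Cons.prems by (auto intro: diag_block_mat_carrier)
  have IH: "diag_block_mat (map (\<lambda>j. f j + g j) js) = diag_block_mat (map f js) + diag_block_mat (map g js)"
    using Cons by simp
  show ?case
    unfolding list.map diag_block_mat_Cons[OF f] diag_block_mat_Cons[OF g] 
      add_four_block_mat[OF f(1) zero_carrier_mat zero_carrier_mat f(2)
        g(1) zero_carrier_mat zero_carrier_mat g(2)]
    using f g IH by (subst diag_block_mat_Cons[of _ "k j" _ ?m]) auto
next
  case Nil
  show ?case by (rule eq_matI) simp_all
qed

lemma diag_block_mat_mult:
  fixes f g :: "'i \<Rightarrow> 'a :: semiring_0 mat"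
  assumes "\<And>j. j \<in> set js \<Longrightarrow> f j \<in> carrier_mat (k j) (k j)"
    and "\<And>j. j \<in> set js \<Longrightarrow> g j \<in> carrier_mat (k j) (k j)"
  shows "diag_block_mat (map (\<lambda>j. f j * g j) js) = diag_block_mat (map f js) * diag_block_mat (map g js)"
  using assms
proof (induction js)
  case (Cons j js)
  let ?m = "sum_list (map k js)"
  have f: "f j \<in> carrier_mat (k j) (k j)" "diag_block_mat (map f js) \<in> carrier_mat ?m ?m"
    using Cons.prems by (auto intro: diag_block_mat_carrier)
  have g: "g j \<in> carrier_mat (k j) (k j)" "diag_block_mat (map g js) \<in> carrier_mat ?m ?m"
    using Cons.prems by (auto intro: diag_block_mat_carrier)
  have IH: "diag_block_mat (map (\<lambda>j. f j * g j) js) = diag_block_mat (map f js) * diag_block_mat (map g js)"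
    using Cons by simp
  show ?case
    unfolding list.map diag_block_mat_Cons[OF f] diag_block_mat_Cons[OF g] 
      mult_four_block_mat[OF f(1) zero_carrier_mat zero_carrier_mat f(2)
        g(1) zero_carrier_mat zero_carrier_mat g(2)]
    using f g IH by (subst diag_block_mat_Cons[of _ "k j" _ ?m]) auto
next
  case Nil
  show ?case by (rule eq_matI) simp_all
qed

lemma diag_block_mat_smult:
  fixes f :: "'i \<Rightarrow> 'a :: semiring_0 mat"
  assumes "\<And>j. j \<in> set js \<Longrightarrow> f j \<in> carrier_mat (k j) (k j)"
  shows "diag_block_mat (map (\<lambda>j. c \<cdot>\<^sub>m f j) js) = c \<cdot>\<^sub>m diag_block_mat (map f js)"
  using assms
proof (induction js)
  case (Cons j js)
  let ?m = "sum_list (map k js)"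
  have f: "f j \<in> carrier_mat (k j) (k j)" "diag_block_mat (map f js) \<in> carrier_mat ?m ?m"
    using Cons.prems by (auto intro: diag_block_mat_carrier)
  have IH: "diag_block_mat (map (\<lambda>j. c \<cdot>\<^sub>m f j) js) = c \<cdot>\<^sub>m diag_block_mat (map f js)"
    using Cons by simp
  show ?case
    unfolding list.map diag_block_mat_Cons[OF f] 
      smult_four_block_mat[OF f(1) zero_carrier_mat zero_carrier_mat f(2)]
    using f IH by (subst diag_block_mat_Cons[of _ "k j" _ ?m]) auto
next
  case Nil
  show ?case by (rule eq_matI) simp_all
qed

lemma diag_block_mat_adjoint:
  "diag_block_mat (map (\<lambda>j. mat_adjoint (f j)) js) = mat_adjoint (diag_block_mat (map f js) :: complex mat)"
proof (induction js)
  case (Cons j js)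
  then show ?case
    by (intro eq_matI) (auto simp: Let_def)
qed (auto intro!: eq_matI)

lemma diag_block_mat_zero:
  "diag_block_mat (map (\<lambda>j. 0\<^sub>m (k j) (k j)) js) = 0\<^sub>m (sum_list (map k js)) (sum_list (map k js))"
  by (induction js) (simp_all add: Let_def)

lemma diag_block_mat_one:
  "diag_block_mat (map (\<lambda>j. 1\<^sub>m (k j)) js) = 1\<^sub>m (sum_list (map k js))"
  by (induction js) (auto simp: Let_def)

text \<open>Keeping only the set of entries avoids computing offsets of blocks. It suffices for the
  later use, where one has to know that some nonzero entry survives, but not its position.\<close>

lemma elements_mat_subset_diag_block_mat:
  "B \<in> set Bs \<Longrightarrow> elements_mat B \<subseteq> elements_mat (diag_block_mat Bs)"
proof (induction Bs)
  case (Cons A Bs)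
  let ?D = "diag_block_mat Bs"
  let ?F = "diag_block_mat (A # Bs)"
  have "A $$ (i, j) \<in> elements_mat ?F" if "i < dim_row A" "j < dim_col A" for i j
  proof -
    have "?F $$ (i, j) = A $$ (i, j)" using that by (simp add: Let_def)
    then show ?thesis using that by (metis elements_matI[of ?F _ _ i j] carrier_matI diag_block_mat.simps(2)
      index_mat_four_block(2,3) trans_less_add1)
  qed
  moreover have "?D $$ (i, j) \<in> elements_mat ?F" if "i < dim_row ?D" "j < dim_col ?D" for i j
  proof -
    have "?F $$ (dim_row A + i, dim_col A + j) = ?D $$ (i, j)" using that by (simp add: Let_def)
    then show ?thesis using that
      by (intro elements_matI[of ?F _ _ "dim_row A + i" "dim_col A + j"]) (auto simp: Let_def)
  qed
  ultimately have "elements_mat A \<union> elements_mat ?D \<subseteq> elements_mat ?F"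
    by (auto dest!: elements_matD)
  moreover have "B = A \<or> elements_mat B \<subseteq> elements_mat ?D" using Cons by auto
  ultimately show ?case by blast
qed simp

lemma vec_l2norm_append_sq: "(vec_l2norm (v @\<^sub>v w))\<^sup>2 = (vec_l2norm v)\<^sup>2 + (vec_l2norm w)\<^sup>2"
proof -
  let ?n = "dim_vec v" and ?m = "dim_vec w"
  let ?f = "\<lambda>i. (cmod ((v @\<^sub>v w) $ i))\<^sup>2"
  have "sum ?f {..<?n + m} = sum ?f {..<?n} + (\<Sum>i<m. ?f (?n + i))" for m
    by (induction m) auto
  from this[of ?m] show ?thesis by (simp add: vec_l2norm_def sum_nonneg)
qed

text \<open>The two blocks act on orthogonal parts of the vector, so the squares of the norms add up
  on both sides.\<close>

lemma mat_opnorm_four_block_diag_le: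
  assumes A: "A \<in> carrier_mat n n" and D: "D \<in> carrier_mat m m"
    and "mat_opnorm A \<le> r" "mat_opnorm D \<le> r"
  shows "mat_opnorm (four_block_mat A (0\<^sub>m n m) (0\<^sub>m m n) D) \<le> r"
proof (rule mat_opnorm_leI)
  show r: "0 \<le> r" using assms mat_opnorm_nonneg order_trans by blast
  fix v :: "complex vec" assume "v \<in> carrier_vec (dim_col (four_block_mat A (0\<^sub>m n m) (0\<^sub>m m n) D))"
  then have "v \<in> carrier_vec (n + m)" using A D by simp
  then obtain a d where v: "v = a @\<^sub>v d" and a: "a \<in> carrier_vec n" and d: "d \<in> carrier_vec m"
    by (metis vec_first_last_append vec_first_carrier vec_last_carrier)
  have "vec_l2norm (A *\<^sub>v a) \<le> r * vec_l2norm a"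
    using vec_l2norm_mult_mat_vec_le[of a A] A a assms(3)
    by (simp add: order_trans[OF _ mult_right_mono])
  moreover have "vec_l2norm (D *\<^sub>v d) \<le> r * vec_l2norm d"
    using vec_l2norm_mult_mat_vec_le[of d D] D d assms(4)
    by (simp add: order_trans[OF _ mult_right_mono])
  ultimately have "(vec_l2norm (A *\<^sub>v a))\<^sup>2 + (vec_l2norm (D *\<^sub>v d))\<^sup>2
      \<le> (r * vec_l2norm a)\<^sup>2 + (r * vec_l2norm d)\<^sup>2"
    by (intro add_mono power_mono) auto
  then have "(vec_l2norm (four_block_mat A (0\<^sub>m n m) (0\<^sub>m m n) D *\<^sub>v v))\<^sup>2 \<le> (r * vec_l2norm v)\<^sup>2"
    unfolding v mult_mat_vec_split[OF A D a d]
    by (simp add: vec_l2norm_append_sq power_mult_distrib distrib_left)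
  then show "vec_l2norm (four_block_mat A (0\<^sub>m n m) (0\<^sub>m m n) D *\<^sub>v v) \<le> r * vec_l2norm v"
    by (rule power2_le_imp_le) (use r in simp)
qed

lemma mat_opnorm_diag_block_mat_le:
  assumes "\<And>j. j \<in> set js \<Longrightarrow> f j \<in> carrier_mat (k j) (k j)"
    and "\<And>j. j \<in> set js \<Longrightarrow> mat_opnorm (f j) \<le> r" and "0 \<le> r"
  shows "mat_opnorm (diag_block_mat (map f js)) \<le> r"
  using assms
proof (induction js)
  case (Cons j js)
  have c: "f j \<in> carrier_mat (k j) (k j)"
    "diag_block_mat (map f js) \<in> carrier_mat (sum_list (map k js)) (sum_list (map k js))"
    using Cons.prems by (auto intro: diag_block_mat_carrier)
  show ?case
    unfolding list.map diag_block_mat_Cons[OF c]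
    using c by (rule mat_opnorm_four_block_diag_le) (auto simp: Cons)
qed simp


section \<open>Quotients\<close>

text \<open>Only the algebraic side of a quotient is covered. Invariance under the star is a
  separate premise of \<open>quot_star\<close>, which is applied to null sequences; of the quotients
  of \<open>A_lim\<close> only the vector space structure will be used.\<close>

locale cstar_ideal = cstar_algebra A for A :: "'a cstar" (structure) +
  fixes I
  assumes submodule: "submodule class_ring I A"
    and mult_left_mem: "\<lbrakk>a \<in> carrier A; x \<in> I\<rbrakk> \<Longrightarrow> a \<otimes> x \<in> I"
    and mult_right_mem: "\<lbrakk>a \<in> carrier A; x \<in> I\<rbrakk> \<Longrightarrow> x \<otimes> a \<in> I"
begin

lemma ideal_subset: "x \<in> I \<Longrightarrow> x \<in> carrier A"
  using submodule.subset[OF submodule] by blast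

lemma zero_mem: "\<zero> \<in> I"
  using submodule.zero_closed[OF submodule] .

lemma add_mem: "\<lbrakk>x \<in> I; y \<in> I\<rbrakk> \<Longrightarrow> x \<oplus> y \<in> I"
  using submodule.m_closed[OF submodule] .

lemma smult_mem: "x \<in> I \<Longrightarrow> c \<odot> x \<in> I"
  using submodule.smult_closed[OF submodule] by simp

lemma minus_mem: "\<lbrakk>x \<in> I; y \<in> I\<rbrakk> \<Longrightarrow> x \<ominus> y \<in> I"
  by (simp add: minus_eq_add_smult[OF vectorspace] ideal_subset add_mem smult_mem)

lemma abelian_subgroup: "abelian_subgroup I A"
proof (intro abelian_subgroupI3 additive_subgroupI)
  show "subgroup I (add_monoid A)"
  proof
    show "inv\<^bsub>add_monoid A\<^esub> x \<in> I" if "x \<in> I" for x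
      using minus_mem[OF zero_mem that] that
      by (simp add: a_minus_def ideal_subset flip: a_inv_def)
  qed (auto simp: ideal_subset zero_mem add_mem)
  show "abelian_group A" ..
qed

lemma mem_coset_iff: "x \<in> carrier A \<Longrightarrow> z \<in> I +> x \<longleftrightarrow> z \<in> carrier A \<and> z \<ominus> x \<in> I"
  using abelian_subgroup.a_rcos_module[OF abelian_subgroup, of x z]
    abelian_subgroup.a_elemrcos_carrier[OF abelian_subgroup, of x z]
  by (auto simp: a_minus_def M.abelian_group_axioms)

lemma coset_eq_iff:
  "\<lbrakk>x \<in> carrier A; y \<in> carrier A\<rbrakk> \<Longrightarrow> I +> x = I +> y \<longleftrightarrow> x \<ominus> y \<in> I"
  using abelian_subgroup.a_repr_independence'[OF abelian_subgroup, of x y]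
    abelian_subgroup.a_repr_independenceD[OF abelian_subgroup, of x y] mem_coset_iff[of y x]
    abelian_subgroup.a_repr_independence'[OF abelian_subgroup, of x y]
  by (metis abelian_subgroup abelian_subgroup.a_rcos_self abelian_subgroup.a_repr_independence')

lemma coset_self: "x \<in> carrier A \<Longrightarrow> x \<in> I +> x"
  by (rule abelian_subgroup.a_rcos_self[OF abelian_subgroup])

text \<open>Evaluates the operations of \<open>cstar_quot\<close>, which are unions over all
  representatives: if every representative gives the same coset, the union is that coset, because it
  ranges over a nonempty set.\<close>

lemma UN_coset:
  assumes "x \<in> carrier A" "\<And>z. \<lbrakk>z \<in> carrier A; z \<ominus> x \<in> I\<rbrakk> \<Longrightarrow> f z = c"
  shows "(\<Union>z\<in>I +> x. f z) = c"
  using assms coset_self[OF assms(1)] by (auto simp: mem_coset_iff)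

abbreviation "Q \<equiv> cstar_quot A I"

lemma quot_carrier: "carrier Q = (\<lambda>x. I +> x) ` carrier A"
  by (auto simp: cstar_quot_def A_RCOSETS_def')

lemma quot_zero: "\<zero>\<^bsub>Q\<^esub> = I +> \<zero>"
  using ideal_subset by (subst M.a_coset_add_zero) (auto simp: cstar_quot_def)

lemma quot_add:
  "\<lbrakk>x \<in> carrier A; y \<in> carrier A\<rbrakk> \<Longrightarrow> (I +> x) \<oplus>\<^bsub>Q\<^esub> (I +> y) = I +> (x \<oplus> y)"
  using abelian_subgroup.a_rcos_sum[OF abelian_subgroup] by (simp add: cstar_quot_def)

lemma quot_smult:
  assumes x: "x \<in> carrier A"
  shows "c \<odot>\<^bsub>Q\<^esub> (I +> x) = I +> (c \<odot> x)"
proof -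
  have "I +> (c \<odot> z) = I +> (c \<odot> x)" if "z \<in> carrier A" "z \<ominus> x \<in> I" for z
  proof -
    have "c \<odot> z \<ominus> c \<odot> x = c \<odot> (z \<ominus> x)"
      using that x by (simp add: a_minus_def smult_r_distr smult_r_minus)
    then show ?thesis using that x by (simp add: coset_eq_iff smult_mem smult_in_carrier)
  qed
  then show ?thesis using x by (simp add: cstar_quot_def UN_coset)
qed

lemma quot_mult:
  assumes x: "x \<in> carrier A" and y: "y \<in> carrier A"
  shows "(I +> x) \<otimes>\<^bsub>Q\<^esub> (I +> y) = I +> (x \<otimes> y)"
proof -
  have "I +> (z \<otimes> w) = I +> (x \<otimes> y)"
    if z: "z \<in> carrier A" "z \<ominus> x \<in> I" and w: "w \<in> carrier A" "w \<ominus> y \<in> I" for z w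
  proof -
    have "z \<otimes> w \<ominus> x \<otimes> y = (z \<otimes> w \<ominus> z \<otimes> y) \<oplus> (z \<otimes> y \<ominus> x \<otimes> y)"
      using x y z w by (intro minus_minus_distrib) (auto simp: mult_closed)
    also have "\<dots> = z \<otimes> (w \<ominus> y) \<oplus> (z \<ominus> x) \<otimes> y"
      using x y z w by (simp add: mult_minus_left mult_minus_right)
    also have "\<dots> \<in> I"
      using x y z w by (intro add_mem mult_left_mem mult_right_mem)
    finally show ?thesis using x y z w by (simp add: coset_eq_iff mult_closed)
  qed
  then show ?thesis
    using x y by (simp add: cstar_quot_def rcoset_mult_def UN_coset)
qed

lemma quot_star:
  assumes star: "\<And>x. x \<in> I \<Longrightarrow> star A x \<in> I" and x: "x \<in> carrier A"
  shows "star Q (I +> x) = I +> star A x"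
proof -
  have "I +> star A z = I +> star A x" if z: "z \<in> carrier A" "z \<ominus> x \<in> I" for z
    using star[OF z(2)] z x by (simp add: coset_eq_iff star_closed star_minus)
  then show ?thesis using x by (simp add: cstar_quot_def UN_coset)
qed

lemma vectorspace_quot: "vectorspace class_ring Q"
  by (rule vectorspace_image[OF vectorspace, where f = "\<lambda>x. I +> x"])
    (simp_all add: quot_carrier quot_zero quot_add quot_smult)

lemma quot_minus:
  assumes "x \<in> carrier A" "y \<in> carrier A"
  shows "(I +> x) \<ominus>\<^bsub>Q\<^esub> (I +> y) = I +> (x \<ominus> y)"
  using assms by (subst minus_eq_add_smult[OF vectorspace_quot])
    (auto simp: quot_carrier quot_smult quot_add smult_in_carrier minus_eq_add_smult[OF vectorspace])

end

lemma bounded_prod_minus: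
  assumes "\<And>n. cstar_algebra (A n)" "y \<in> carrier (bounded_prod A)"
  shows "x \<ominus>\<^bsub>bounded_prod A\<^esub> y = (\<lambda>n. x n \<ominus>\<^bsub>A n\<^esub> y n)"
proof -
  have "vectorspace class_ring (bounded_prod A)" "vectorspace class_ring (A n)" for n
    using cstar_algebra_bounded_prod[of A] assms by (auto simp: cstar_algebra_def)
  then show ?thesis
    using assms(2)
    by (auto simp: minus_eq_add_smult bounded_prod_simps bounded_prod_carrier_iff)
qed

lemma null_seqs_iff:
  "x \<in> null_seqs A \<longleftrightarrow> x \<in> carrier (bounded_prod A) \<and> (\<lambda>n. cnorm (A n) (x n)) \<longlonglongrightarrow> 0"
  by (simp add: null_seqs_def)

lemma cstar_ideal_null_seqs:
  assumes A: "\<And>n. cstar_algebra (A n)"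
  shows "cstar_ideal (bounded_prod A) (null_seqs A)"
proof -
  interpret P: cstar_algebra "bounded_prod A" by (rule cstar_algebra_bounded_prod[OF A])
  note nonneg = cstar_algebra.norm_nonneg[OF A]
  have c: "x n \<in> carrier (A n)" if "x \<in> carrier (bounded_prod A)" for x n
    using that by (simp add: bounded_prod_carrier_iff)
  have nullI: "x \<in> null_seqs A"
    if "x \<in> carrier (bounded_prod A)" "\<And>n. cnorm (A n) (x n) \<le> f n" "f \<longlonglongrightarrow> 0" for x f
    using that tendsto_sandwich[of "\<lambda>_. 0" "\<lambda>n. cnorm (A n) (x n)" sequentially f 0]
    by (simp add: null_seqs_iff nonneg c)
  have prod: "x \<otimes>\<^bsub>bounded_prod A\<^esub> y \<in> null_seqs A"
    if x: "x \<in> carrier (bounded_prod A)" and y: "y \<in> carrier (bounded_prod A)"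
      and n: "x \<in> null_seqs A \<or> y \<in> null_seqs A" for x y
  proof -
    from x y obtain B C where B: "\<And>n. cnorm (A n) (x n) \<le> B" and C: "\<And>n. cnorm (A n) (y n) \<le> C"
      by (auto simp: bounded_prod_carrier_iff)
    have le: "cnorm (A n) ((x \<otimes>\<^bsub>bounded_prod A\<^esub> y) n) \<le> cnorm (A n) (x n) * cnorm (A n) (y n)" for n
      using x y by (simp add: bounded_prod_simps cstar_algebra.norm_mult_le[OF A] c)
    from n show ?thesis
    proof
      assume "x \<in> null_seqs A"
      then have "(\<lambda>n. cnorm (A n) (x n) * C) \<longlonglongrightarrow> 0"
        by (auto simp: null_seqs_iff intro: tendsto_mult_left_zero)
      moreover have "cnorm (A n) ((x \<otimes>\<^bsub>bounded_prod A\<^esub> y) n) \<le> cnorm (A n) (x n) * C" for n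
        by (rule order_trans[OF le mult_left_mono[OF C nonneg[OF c[OF x]]]])
      ultimately show ?thesis using P.mult_closed[OF x y] by (intro nullI)
    next
      assume "y \<in> null_seqs A"
      then have "(\<lambda>n. B * cnorm (A n) (y n)) \<longlonglongrightarrow> 0"
        by (auto simp: null_seqs_iff intro: tendsto_mult_right_zero)
      moreover have "cnorm (A n) ((x \<otimes>\<^bsub>bounded_prod A\<^esub> y) n) \<le> B * cnorm (A n) (y n)" for n
        by (rule order_trans[OF le mult_right_mono[OF B nonneg[OF c[OF y]]]])
      ultimately show ?thesis using P.mult_closed[OF x y] by (intro nullI)
    qed
  qed
  show ?thesis
  proof (intro cstar_ideal.intro cstar_ideal_axioms.intro submodule.intro)
    show "cstar_algebra (bounded_prod A)" ..
    show "Module.module class_ring (bounded_prod A)" ..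
    show "null_seqs A \<subseteq> carrier (bounded_prod A)" by (auto simp: null_seqs_iff)
    show "\<zero>\<^bsub>bounded_prod A\<^esub> \<in> null_seqs A"
      using P.M.zero_closed
      by (simp only: null_seqs_iff bounded_prod_simps(3) cstar_algebra.norm_zero[OF A])
        (simp add: cstar_algebra.norm_zero[OF A])
    fix x y c assume x: "x \<in> null_seqs A"
    then have xP: "x \<in> carrier (bounded_prod A)" by (simp add: null_seqs_iff)
    show "c \<odot>\<^bsub>bounded_prod A\<^esub> x \<in> null_seqs A"
    proof (rule nullI)
      show "cnorm (A n) ((c \<odot>\<^bsub>bounded_prod A\<^esub> x) n) \<le> cmod c * cnorm (A n) (x n)" for n
        using xP by (simp add: bounded_prod_simps cstar_algebra.norm_smult[OF A] c)
      show "(\<lambda>n. cmod c * cnorm (A n) (x n)) \<longlonglongrightarrow> 0"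
        using x by (auto simp: null_seqs_iff intro: tendsto_mult_right_zero)
    qed (rule P.smult_in_carrier[OF xP])
    show "a \<otimes>\<^bsub>bounded_prod A\<^esub> x \<in> null_seqs A" "x \<otimes>\<^bsub>bounded_prod A\<^esub> a \<in> null_seqs A"
      if "a \<in> carrier (bounded_prod A)" for a
      using that x xP prod by auto
    assume y: "y \<in> null_seqs A"
    then have yP: "y \<in> carrier (bounded_prod A)" by (simp add: null_seqs_iff)
    show "x \<oplus>\<^bsub>bounded_prod A\<^esub> y \<in> null_seqs A"
    proof (rule nullI)
      show "cnorm (A n) ((x \<oplus>\<^bsub>bounded_prod A\<^esub> y) n) \<le> cnorm (A n) (x n) + cnorm (A n) (y n)" for n
        using xP yP by (simp add: bounded_prod_simps cstar_algebra.norm_triangle[OF A] c)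
      show "(\<lambda>n. cnorm (A n) (x n) + cnorm (A n) (y n)) \<longlonglongrightarrow> 0"
        using x y by (auto simp: null_seqs_iff intro: tendsto_add_zero)
    qed (rule P.M.a_closed[OF xP yP])
  qed
qed

lemma star_null_seqs:
  assumes A: "\<And>n. cstar_algebra (A n)" and x: "x \<in> null_seqs A"
  shows "star (bounded_prod A) x \<in> null_seqs A"
  using x by (auto simp: null_seqs_iff bounded_prod_simps(6) cstar_algebra.norm_star[OF A]
      cstar_algebra.star_closed[OF A] bounded_prod_carrier_iff)

text \<open>The quotient norm modulo null sequences is the limit superior of the norms; it is
  expressed without \<open>limsup\<close>.\<close>

lemma cnorm_quot_null_seqs_le_iff:
  fixes A :: "nat \<Rightarrow> 'a cstar"
  assumes A: "\<And>n. cstar_algebra (A n)" and x: "x \<in> carrier (bounded_prod A)" and r: "0 \<le> r"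
  shows "cnorm (cstar_quot (bounded_prod A) (null_seqs A)) (null_seqs A +>\<^bsub>bounded_prod A\<^esub> x) \<le> r \<longleftrightarrow>
    (\<forall>e>0. \<forall>\<^sub>F n in sequentially. cnorm (A n) (x n) \<le> r + e)"
    (is "?q \<le> r \<longleftrightarrow> ?ev")
proof -
  let ?P = "bounded_prod A" and ?N = "null_seqs A"
  interpret N: cstar_ideal ?P ?N by (rule cstar_ideal_null_seqs[OF A])
  have xn: "x n \<in> carrier (A n)" for n using x by (simp add: bounded_prod_carrier_iff)
  have q: "?q = (INF z\<in>?N +>\<^bsub>?P\<^esub> x. cnorm ?P z)" by (simp add: cstar_quot_def)
  have bdd: "bdd_below (cnorm ?P ` (?N +>\<^bsub>?P\<^esub> x))"
    using N.norm_nonneg x by (intro bdd_belowI2[of _ 0]) (auto simp: N.mem_coset_iff)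
  have ne: "?N +>\<^bsub>?P\<^esub> x \<noteq> {}" using N.coset_self[OF x] by blast
  show ?thesis
  proof
    assume le: "?q \<le> r"
    show ?ev
    proof (intro allI impI)
      fix e :: real assume e: "0 < e"
      \<comment> \<open>Half of e pays for choosing a representative z with almost minimal norm, the
        other half for the null sequence by which z differs from x.\<close>
      then have "?q < r + e / 2" using le by simp
      then obtain z where z: "z \<in> carrier ?P" "z \<ominus>\<^bsub>?P\<^esub> x \<in> ?N" "cnorm ?P z < r + e / 2"
        unfolding q cINF_less_iff[OF ne bdd] using x by (auto simp: N.mem_coset_iff)
      have zn: "z n \<in> carrier (A n)" for n using z by (simp add: bounded_prod_carrier_iff)
      have "(\<lambda>n. cnorm (A n) (z n \<ominus>\<^bsub>A n\<^esub> x n)) \<longlonglongrightarrow> 0"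
        using z(2) by (simp add: null_seqs_iff bounded_prod_minus[OF A x])
      then have "\<forall>\<^sub>F n in sequentially. cnorm (A n) (z n \<ominus>\<^bsub>A n\<^esub> x n) < e / 2"
        using e by (intro order_tendstoD) auto
      then show "\<forall>\<^sub>F n in sequentially. cnorm (A n) (x n) \<le> r + e"
      proof eventually_elim
        case (elim n)
        have "cnorm (A n) (z n) \<le> r + e / 2"
          using z(3) cnorm_bounded_prod_le_iff[OF z(1), of "r + e / 2"] by simp
        then show ?case
          using cstar_algebra.norm_le_diff[OF A xn zn, of n] elim
            cstar_algebra.norm_minus_commute[OF A xn zn, of n] by linarith
      qed
    qed
  next
    assume ev: ?ev
    show "?q \<le> r"
    proof (rule field_le_epsilon)
      fix e :: real assume e: "0 < e"
      then obtain N where N: "\<And>n. n \<ge> N \<Longrightarrow> cnorm (A n) (x n) \<le> r + e"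
        using ev by (auto simp: eventually_sequentially)
      \<comment> \<open>Deleting finitely many terms changes x by a null sequence only, and the
        remaining terms satisfy the desired bound everywhere.\<close>
      define z where "z n = (if n < N then \<zero>\<^bsub>A n\<^esub> else x n)" for n
      have "\<zero>\<^bsub>?P\<^esub> n \<in> carrier (A n)" for n
        using N.M.zero_closed by (simp only: bounded_prod_carrier_iff)
      then have 0: "\<zero>\<^bsub>A n\<^esub> \<in> carrier (A n)" for n by (simp add: bounded_prod_simps)
      have zle: "cnorm (A n) (z n) \<le> r + e" for n
        using N e r by (simp add: z_def cstar_algebra.norm_zero[OF A])
      have "z n \<in> carrier (A n)" for n by (simp add: z_def 0 xn)
      then have zP: "z \<in> carrier ?P" using zle by (auto simp: bounded_prod_carrier_iff)
      have xx: "x n \<ominus>\<^bsub>A n\<^esub> x n = \<zero>\<^bsub>A n\<^esub>" for n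
        using cstar_algebra.minus_zero_iff[OF A xn xn] by simp
      have "\<forall>\<^sub>F n in sequentially. 0 = cnorm (A n) ((z \<ominus>\<^bsub>?P\<^esub> x) n)"
        using eventually_ge_at_top[of N]
        by eventually_elim (simp add: bounded_prod_minus[OF A x] z_def xx cstar_algebra.norm_zero[OF A])
      then have "z \<ominus>\<^bsub>?P\<^esub> x \<in> ?N"
        using zP x by (auto simp: null_seqs_iff intro: Lim_transform_eventually[OF tendsto_const])
      then have "z \<in> ?N +>\<^bsub>?P\<^esub> x" using zP x by (simp add: N.mem_coset_iff)
      then have "?q \<le> cnorm ?P z" unfolding q by (intro cINF_lower[OF bdd])
      also have "\<dots> \<le> r + e" using zle by (simp add: cnorm_bounded_prod_le_iff[OF zP])
      finally show "?q \<le> r + e" .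
    qed
  qed
qed

lemma cnorm_quot_null_seqs_nonneg:
  fixes A :: "nat \<Rightarrow> 'a cstar"
  assumes A: "\<And>n. cstar_algebra (A n)" and x: "x \<in> carrier (bounded_prod A)"
  shows "0 \<le> cnorm (cstar_quot (bounded_prod A) (null_seqs A)) (null_seqs A +>\<^bsub>bounded_prod A\<^esub> x)"
proof -
  interpret N: cstar_ideal "bounded_prod A" "null_seqs A" by (rule cstar_ideal_null_seqs[OF A])
  show ?thesis
    using N.coset_self[OF x] x N.norm_nonneg
    by (auto simp: cstar_quot_def N.mem_coset_iff intro!: cINF_greatest)
qed


section \<open>Block diagonal extensions of sequences\<close>

text \<open>Coordinates are counted from 0, the summands of A_n from 1; so coordinate i consists of
  matrices of size k(i + 1).\<close>

abbreviation block_size :: "nat \<Rightarrow> nat" where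
  "block_size i \<equiv> k_seq (Suc i)"

lemma k_seq_pos [simp]: "0 < k_seq j"
  by (simp add: k_seq_def)

text \<open>The next summand equals the whole partial sum before it, so adding it doubles the sum,
  just as the powers of 2 do.\<close>

lemma k_seq_Suc_eq_sum:
  assumes "1 \<le> n"
  shows "k_seq (n + 1) = (\<Sum>j = 1..n. k_seq j)"
  using assms
proof (induction n rule: nat_induct_at_least)
  case (Suc n)
  then have "k_seq (Suc n + 1) = k_seq (n + 1) + k_seq (n + 1)"
    by (cases n) (auto simp: k_seq_def)
  then show ?case using Suc by simp
qed (simp add: k_seq_def)

text \<open>The index shift of \<open>k_seq_Suc_eq_sum\<close>. For n = 0 the sum is empty while
  \<open>block_size 0\<close> is 1, so a block can only be filled by earlier ones from coordinate 1
  on.\<close>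

lemma sum_list_block_size:
  assumes "0 < n"
  shows "sum_list (map block_size [0..<n]) = block_size n"
proof -
  have "sum_list (map block_size [0..<n]) = (\<Sum>i<n. block_size i)"
    by (simp add: sum_list_distinct_conv_sum_set atLeast0LessThan)
  also have "\<dots> = (\<Sum>j = 1..n. k_seq j)"
    by (rule sum.reindex_bij_witness[of _ "\<lambda>j. j - 1" Suc]) auto
  finally show ?thesis using k_seq_Suc_eq_sum[of n] assms by simp
qed

lemma A_seq_eq: "A_seq n = direct_sum (map (\<lambda>i. mat_cstar (block_size i)) [0..<n])"
proof -
  have "map (\<lambda>j. mat_cstar (k_seq j)) [1..<Suc n] = map (\<lambda>i. mat_cstar (block_size i)) [0..<n]"
    by (simp add: map_Suc_upt[symmetric] del: upt_Suc)
  then show ?thesis by (simp only: A_seq_def)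
qed

lemma A_seq_carrier_iff:
  "xs \<in> carrier (A_seq n) \<longleftrightarrow>
    length xs = n \<and> (\<forall>i<n. xs ! i \<in> carrier_mat (block_size i) (block_size i))"
  by (auto simp: A_seq_eq direct_sum_simps)

lemma A_seq_simps:
  "mult (A_seq n) xs ys = map (\<lambda>i. xs ! i * ys ! i) [0..<n]"
  "one (A_seq n) = map (\<lambda>i. 1\<^sub>m (block_size i)) [0..<n]"
  "zero (A_seq n) = map (\<lambda>i. 0\<^sub>m (block_size i) (block_size i)) [0..<n]"
  "add (A_seq n) xs ys = map (\<lambda>i. xs ! i + ys ! i) [0..<n]"
  "smult (A_seq n) c xs = map (\<lambda>i. c \<cdot>\<^sub>m xs ! i) [0..<n]"
  "star (A_seq n) xs = map (\<lambda>i. mat_adjoint (xs ! i)) [0..<n]"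
  by (auto simp: A_seq_eq direct_sum_simps)

lemma cnorm_A_seq_le_iff:
  "0 \<le> r \<Longrightarrow> cnorm (A_seq n) xs \<le> r \<longleftrightarrow> (\<forall>i<n. mat_opnorm (xs ! i) \<le> r)"
  by (auto simp: A_seq_eq cnorm_direct_sum_le_iff)

lemma cnorm_A_seq_nonneg: "0 \<le> cnorm (A_seq n) xs"
  by (simp add: A_seq_eq cnorm_direct_sum_nonneg)

lemma cstar_algebra_A_seq: "cstar_algebra (A_seq n)"
  unfolding A_seq_eq by (rule cstar_algebra_direct_sum) (auto simp: cstar_algebra_mat_cstar)

lemma unital_A_seq: "unital (A_seq n)"
  unfolding A_seq_eq by (rule unital_direct_sum) (auto simp: unital_def)

lemma A_seq_minus:
  assumes "ys \<in> carrier (A_seq n)"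
  shows "xs \<ominus>\<^bsub>A_seq n\<^esub> ys = map (\<lambda>i. xs ! i + (-1) \<cdot>\<^sub>m ys ! i) [0..<n]"
proof -
  have "vectorspace class_ring (A_seq n)" using cstar_algebra_A_seq by (simp add: cstar_algebra_def)
  then show ?thesis using assms by (subst minus_eq_add_smult) (auto simp: A_seq_simps)
qed

definition mat_seqs :: "(nat \<Rightarrow> complex mat) set" where
  "mat_seqs = {x. \<forall>i. x i \<in> carrier_mat (block_size i) (block_size i)}"

lemma mat_seqsD: "x \<in> mat_seqs \<Longrightarrow> x i \<in> carrier_mat (block_size i) (block_size i)"
  by (simp add: mat_seqs_def)

lemma diag_block_mat_mat_seqs:
  assumes "\<And>j. j < i \<Longrightarrow> f j \<in> carrier_mat (block_size j) (block_size j)" "0 < i"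
  shows "diag_block_mat (map f [0..<i]) \<in> carrier_mat (block_size i) (block_size i)"
  using diag_block_mat_carrier[of "[0..<i]" f block_size] assms by (simp add: sum_list_block_size)

text \<open>The element of \<open>M\<^bsub>k(1)\<^esub> \<oplus> \<dots> \<oplus> M\<^bsub>k(m+1)\<^esub>\<close> with entries \<open>x 0, \<dots>, x m\<close>, followed through all
  the connecting maps.\<close>

function diag_ext :: "nat \<Rightarrow> (nat \<Rightarrow> complex mat) \<Rightarrow> nat \<Rightarrow> complex mat" where
  "diag_ext m x i = (if i \<le> m then x i else diag_block_mat (map (diag_ext m x) [0..<i]))"
  by pat_completeness auto
termination
  by (relation "measure (\<lambda>(m, x, i). i)") auto

declare diag_ext.simps [simp del]

lemma diag_ext_le [simp]: "i \<le> m \<Longrightarrow> diag_ext m x i = x i"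
  by (simp add: diag_ext.simps)

lemma diag_ext_gt: "m < i \<Longrightarrow> diag_ext m x i = diag_block_mat (map (diag_ext m x) [0..<i])"
  by (subst diag_ext.simps) simp

lemma diag_ext_cong:
  assumes "\<And>i. i \<le> m \<Longrightarrow> x i = y i"
  shows "diag_ext m x = diag_ext m y"
proof
  show "diag_ext m x i = diag_ext m y i" for i
  proof (induction i rule: less_induct)
    case (less i)
    then show ?case
      using assms by (cases "i \<le> m") (auto simp: diag_ext_gt intro!: arg_cong[of _ _ diag_block_mat])
  qed
qed

lemma diag_ext_in_carrier:
  assumes "\<And>i. i \<le> m \<Longrightarrow> x i \<in> carrier_mat (block_size i) (block_size i)"
  shows "diag_ext m x i \<in> carrier_mat (block_size i) (block_size i)"
proof (induction i rule: less_induct)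
  case (less i)
  then show ?case
    using assms by (cases "i \<le> m") (auto simp: diag_ext_gt intro!: diag_block_mat_mat_seqs)
qed

lemma diag_ext_mat_seqs: "x \<in> mat_seqs \<Longrightarrow> diag_ext m x \<in> mat_seqs"
  using diag_ext_in_carrier[of m x] by (simp add: mat_seqs_def)

text \<open>An extension from m already obeys the block diagonal recursion beyond n. Consequently
  \<open>diag_ext n x = x\<close> expresses that x comes from stage n, and this property persists
  for larger n.\<close>

lemma diag_ext_diag_ext:
  assumes "m \<le> n"
  shows "diag_ext n (diag_ext m x) = diag_ext m x"
proof
  show "diag_ext n (diag_ext m x) i = diag_ext m x i" for i
  proof (induction i rule: less_induct)
    case (less i)
    have eq: "map (diag_ext n (diag_ext m x)) [0..<i] = map (diag_ext m x) [0..<i]"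
      using less by simp
    then show ?case
      using assms by (cases "i \<le> n") (simp_all add: diag_ext_gt eq)
  qed
qed

section \<open>Extension from a stage respects the *-algebra operations and is contractive\<close>

lemma diag_ext_add:
  assumes "x \<in> mat_seqs" "y \<in> mat_seqs"
  shows "diag_ext m (\<lambda>i. x i + y i) = (\<lambda>i. diag_ext m x i + diag_ext m y i)"
proof
  show "diag_ext m (\<lambda>i. x i + y i) i = diag_ext m x i + diag_ext m y i" for i
  proof (induction i rule: less_induct)
    case (less i)
    then have eq: "map (diag_ext m (\<lambda>i. x i + y i)) [0..<i]
        = map (\<lambda>j. diag_ext m x j + diag_ext m y j) [0..<i]"
      by simp
    then show ?case
      using assms diag_ext_mat_seqs[THEN mat_seqsD]
      by (cases "i \<le> m") (simp_all add: diag_ext_gt eq diag_block_mat_add[where k = block_size])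
  qed
qed

lemma diag_ext_mult:
  assumes "x \<in> mat_seqs" "y \<in> mat_seqs"
  shows "diag_ext m (\<lambda>i. x i * y i) = (\<lambda>i. diag_ext m x i * diag_ext m y i)"
proof
  show "diag_ext m (\<lambda>i. x i * y i) i = diag_ext m x i * diag_ext m y i" for i
  proof (induction i rule: less_induct)
    case (less i)
    then have eq: "map (diag_ext m (\<lambda>i. x i * y i)) [0..<i]
        = map (\<lambda>j. diag_ext m x j * diag_ext m y j) [0..<i]"
      by simp
    then show ?case
      using assms diag_ext_mat_seqs[THEN mat_seqsD]
      by (cases "i \<le> m") (simp_all add: diag_ext_gt eq diag_block_mat_mult[where k = block_size])
  qed
qed

lemma diag_ext_smult:
  assumes "x \<in> mat_seqs"
  shows "diag_ext m (\<lambda>i. c \<cdot>\<^sub>m x i) = (\<lambda>i. c \<cdot>\<^sub>m diag_ext m x i)"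
proof
  show "diag_ext m (\<lambda>i. c \<cdot>\<^sub>m x i) i = c \<cdot>\<^sub>m diag_ext m x i" for i
  proof (induction i rule: less_induct)
    case (less i)
    then have eq: "map (diag_ext m (\<lambda>i. c \<cdot>\<^sub>m x i)) [0..<i] = map (\<lambda>j. c \<cdot>\<^sub>m diag_ext m x j) [0..<i]"
      by simp
    then show ?case
      using assms diag_ext_mat_seqs[THEN mat_seqsD]
      by (cases "i \<le> m") (simp_all add: diag_ext_gt eq diag_block_mat_smult[where k = block_size])
  qed
qed

lemma diag_ext_adjoint:
  "diag_ext m (\<lambda>i. mat_adjoint (x i)) = (\<lambda>i. mat_adjoint (diag_ext m x i))"
proof
  show "diag_ext m (\<lambda>i. mat_adjoint (x i)) i = mat_adjoint (diag_ext m x i)" for i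
  proof (induction i rule: less_induct)
    case (less i)
    then have eq: "map (diag_ext m (\<lambda>i. mat_adjoint (x i))) [0..<i]
        = map (\<lambda>j. mat_adjoint (diag_ext m x j)) [0..<i]"
      by simp
    then show ?case
      by (cases "i \<le> m") (simp_all add: diag_ext_gt eq diag_block_mat_adjoint)
  qed
qed

lemma diag_ext_one: "diag_ext m (\<lambda>i. 1\<^sub>m (block_size i)) = (\<lambda>i. 1\<^sub>m (block_size i))"
proof
  show "diag_ext m (\<lambda>i. 1\<^sub>m (block_size i)) i = 1\<^sub>m (block_size i)" for i
  proof (induction i rule: less_induct)
    case (less i)
    then have eq: "map (diag_ext m (\<lambda>i. 1\<^sub>m (block_size i))) [0..<i] = map (\<lambda>j. 1\<^sub>m (block_size j)) [0..<i]"
      by simp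
    then show ?case
      by (cases "i \<le> m") (simp_all add: diag_ext_gt eq diag_block_mat_one sum_list_block_size)
  qed
qed

lemma diag_ext_zero:
  "diag_ext m (\<lambda>i. 0\<^sub>m (block_size i) (block_size i)) = (\<lambda>i. 0\<^sub>m (block_size i) (block_size i))"
proof
  show "diag_ext m (\<lambda>i. 0\<^sub>m (block_size i) (block_size i)) i = 0\<^sub>m (block_size i) (block_size i)" for i
  proof (induction i rule: less_induct)
    case (less i)
    then have eq: "map (diag_ext m (\<lambda>i. 0\<^sub>m (block_size i) (block_size i))) [0..<i]
        = map (\<lambda>j. 0\<^sub>m (block_size j) (block_size j)) [0..<i]"
      by simp
    then show ?case
      by (cases "i \<le> m") (simp_all add: diag_ext_gt eq diag_block_mat_zero sum_list_block_size)
  qed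
qed

text \<open>Every later coordinate is block diagonal in earlier ones, so its norm cannot exceed
  theirs. This contractivity drives all the approximation arguments on sequences below.\<close>

lemma mat_opnorm_diag_ext_le:
  assumes x: "x \<in> mat_seqs" and le: "\<And>i. i \<le> m \<Longrightarrow> mat_opnorm (x i) \<le> r"
  shows "mat_opnorm (diag_ext m x i) \<le> r"
proof (induction i rule: less_induct)
  case (less i)
  have "0 \<le> r" using order_trans[OF mat_opnorm_nonneg le[of 0]] by simp
  with less show ?case
    using le diag_ext_mat_seqs[OF x, THEN mat_seqsD]
    by (cases "i \<le> m") (auto simp: diag_ext_gt intro!: mat_opnorm_diag_block_mat_le[where k = block_size])
qed

lemma mat_minus_eq:
  fixes A B :: "complex mat"
  assumes "A \<in> carrier_mat n m" "B \<in> carrier_mat n m"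
  shows "A - B = A + (-1) \<cdot>\<^sub>m B"
  using assms by (intro eq_matI) auto

lemma diag_ext_minus:
  assumes "x \<in> mat_seqs" "y \<in> mat_seqs"
  shows "diag_ext m (\<lambda>i. x i - y i) = (\<lambda>i. diag_ext m x i - diag_ext m y i)"
proof -
  have "(\<lambda>i. (-1) \<cdot>\<^sub>m y i) \<in> mat_seqs" using assms by (simp add: mat_seqs_def)
  then show ?thesis
    using assms
    by (simp add: mat_minus_eq[OF mat_seqsD mat_seqsD] diag_ext_mat_seqs diag_ext_add diag_ext_smult)
qed

lemma mat_opnorm_diff_triangle:
  assumes "A \<in> carrier_mat d d" "B \<in> carrier_mat d d" "C \<in> carrier_mat d d"
  shows "mat_opnorm (A - C) \<le> mat_opnorm (A - B) + mat_opnorm (B - C)"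
  using cstar_algebra.norm_diff_triangle[OF cstar_algebra_mat_cstar, of A d B C] assms
  by (simp add: mat_cstar_minus)

lemma mat_opnorm_minus_commute:
  assumes "A \<in> carrier_mat d d" "B \<in> carrier_mat d d"
  shows "mat_opnorm (A - B) = mat_opnorm (B - A)"
  using cstar_algebra.norm_minus_commute[OF cstar_algebra_mat_cstar, of A d B] assms
  by (simp add: mat_cstar_minus)

lemma mat_opnorm_le_diff:
  assumes "A \<in> carrier_mat d d" "B \<in> carrier_mat d d"
  shows "mat_opnorm A \<le> mat_opnorm (A - B) + mat_opnorm B"
  using cstar_algebra.norm_le_diff[OF cstar_algebra_mat_cstar, of A d B] assms
  by (simp add: mat_cstar_minus)

text \<open>The uniform closure of the union of the stages, written with a canonical approximant: if
  y comes from stage n and is within e of x, then contractivity puts \<open>diag_ext n x\<close>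
  within e of y, hence within 2e of x. This spares a choice of approximants and makes the condition
  monotone enough to intersect eventualities.\<close>

definition limit_seqs :: "(nat \<Rightarrow> complex mat) set" where
  "limit_seqs = {x \<in> mat_seqs.
     \<forall>e>0. \<forall>\<^sub>F n in sequentially. \<forall>i. mat_opnorm (x i - diag_ext n x i) \<le> e}"

lemma limit_seqs_mat_seqs: "x \<in> limit_seqs \<Longrightarrow> x \<in> mat_seqs"
  by (simp add: limit_seqs_def)

lemmas limit_seqsD = limit_seqs_mat_seqs[THEN mat_seqsD]

lemma limit_seqs_eventually:
  "x \<in> limit_seqs \<Longrightarrow> 0 < e \<Longrightarrow> \<forall>\<^sub>F n in sequentially. \<forall>i. mat_opnorm (x i - diag_ext n x i) \<le> e"
  by (simp add: limit_seqs_def)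

lemma limit_seqsI:
  assumes "x \<in> mat_seqs"
    and "\<And>e. 0 < e \<Longrightarrow> \<forall>\<^sub>F n in sequentially. \<forall>i. mat_opnorm (x i - diag_ext n x i) \<le> e"
  shows "x \<in> limit_seqs"
  using assms by (simp add: limit_seqs_def)

lemma diag_ext_fixed_limit_seqs:
  assumes "x \<in> mat_seqs" "diag_ext m x = x"
  shows "x \<in> limit_seqs"
proof (rule limit_seqsI[OF assms(1)])
  fix e :: real assume e: "0 < e"
  show "\<forall>\<^sub>F n in sequentially. \<forall>i. mat_opnorm (x i - diag_ext n x i) \<le> e"
    using eventually_ge_at_top[of m]
  proof eventually_elim
    case (elim n)
    then have "diag_ext n x = x" using diag_ext_diag_ext[of m n x] assms by simp
    moreover have "x i - x i = 0\<^sub>m (block_size i) (block_size i)" for i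
      using mat_seqsD[OF assms(1), of i] by (intro eq_matI) auto
    ultimately show ?case using e by simp
  qed
qed

lemma diag_ext_limit_seqs: "x \<in> mat_seqs \<Longrightarrow> diag_ext m x \<in> limit_seqs"
  by (rule diag_ext_fixed_limit_seqs[of _ m]) (auto simp: diag_ext_mat_seqs diag_ext_diag_ext)

lemma one_limit_seqs: "(\<lambda>i. 1\<^sub>m (block_size i)) \<in> limit_seqs"
  by (rule diag_ext_fixed_limit_seqs[of _ 0]) (auto simp: mat_seqs_def diag_ext_one)

lemma zero_limit_seqs: "(\<lambda>i. 0\<^sub>m (block_size i) (block_size i)) \<in> limit_seqs"
  by (rule diag_ext_fixed_limit_seqs[of _ 0]) (auto simp: mat_seqs_def diag_ext_zero)

lemma limit_seqs_bounded:
  assumes x: "x \<in> limit_seqs"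
  obtains C where "0 \<le> C" "\<And>i. mat_opnorm (x i) \<le> C"
proof -
  from limit_seqs_eventually[OF x, of 1] obtain n
    where n: "\<And>i. mat_opnorm (x i - diag_ext n x i) \<le> 1" by (auto simp: eventually_sequentially)
  \<comment> \<open>The sum is just a convenient upper bound for the finitely many norms that
    determine the extension.\<close>
  let ?C = "\<Sum>i\<le>n. mat_opnorm (x i)"
  have "mat_opnorm (diag_ext n x i) \<le> ?C" for i
    by (rule mat_opnorm_diag_ext_le[OF limit_seqs_mat_seqs[OF x]]) (auto intro!: member_le_sum)
  then have "mat_opnorm (x i) \<le> 1 + ?C" for i
    using mat_opnorm_le_diff[OF limit_seqsD[OF x] mat_seqsD, of "diag_ext n x" i] n[of i]
      diag_ext_mat_seqs[OF limit_seqs_mat_seqs[OF x]] by (smt (verit))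
  moreover have "0 \<le> 1 + ?C" by (intro add_nonneg_nonneg sum_nonneg) auto
  ultimately show thesis by (intro that)
qed

lemma limit_seqs_add:
  assumes x: "x \<in> limit_seqs" and y: "y \<in> limit_seqs"
  shows "(\<lambda>i. x i + y i) \<in> limit_seqs"
proof (rule limit_seqsI)
  note c = limit_seqsD[OF x] limit_seqsD[OF y]
    diag_ext_mat_seqs[OF limit_seqs_mat_seqs[OF x], THEN mat_seqsD]
    diag_ext_mat_seqs[OF limit_seqs_mat_seqs[OF y], THEN mat_seqsD]
  show "(\<lambda>i. x i + y i) \<in> mat_seqs" using c by (simp add: mat_seqs_def)
  fix e :: real assume "0 < e"
  then have "\<forall>\<^sub>F n in sequentially. \<forall>i. mat_opnorm (x i - diag_ext n x i) \<le> e / 2"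
    "\<forall>\<^sub>F n in sequentially. \<forall>i. mat_opnorm (y i - diag_ext n y i) \<le> e / 2"
    using limit_seqs_eventually[OF x, of "e / 2"] limit_seqs_eventually[OF y, of "e / 2"] by auto
  then show "\<forall>\<^sub>F n in sequentially. \<forall>i. mat_opnorm (x i + y i - diag_ext n (\<lambda>i. x i + y i) i) \<le> e"
  proof eventually_elim
    case (elim n)
    have "x i + y i - diag_ext n (\<lambda>i. x i + y i) i = (x i - diag_ext n x i) + (y i - diag_ext n y i)" for i
      unfolding diag_ext_add[OF limit_seqs_mat_seqs[OF x] limit_seqs_mat_seqs[OF y]]
      using c(1)[of i] c(2)[of i] c(3)[of n i] c(4)[of n i] by (intro eq_matI) auto
    moreover have "mat_opnorm ((x i - diag_ext n x i) + (y i - diag_ext n y i)) \<le> e" for i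
      using mat_opnorm_triangle[of "x i - diag_ext n x i" "block_size i" "block_size i" "y i - diag_ext n y i"]
        minus_carrier_mat[OF c(3)] minus_carrier_mat[OF c(4)] elim by (smt (verit) field_sum_of_halves)
    ultimately show ?case by simp
  qed
qed

lemma limit_seqs_smult:
  assumes x: "x \<in> limit_seqs"
  shows "(\<lambda>i. c \<cdot>\<^sub>m x i) \<in> limit_seqs"
proof (rule limit_seqsI)
  note cx = limit_seqsD[OF x] diag_ext_mat_seqs[OF limit_seqs_mat_seqs[OF x], THEN mat_seqsD]
  show "(\<lambda>i. c \<cdot>\<^sub>m x i) \<in> mat_seqs" using cx by (simp add: mat_seqs_def)
  fix e :: real assume e: "0 < e"
  \<comment> \<open>Adding 1 keeps the denominator positive when c = 0.\<close>
  have "\<forall>\<^sub>F n in sequentially. \<forall>i. mat_opnorm (x i - diag_ext n x i) \<le> e / (cmod c + 1)"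
    using limit_seqs_eventually[OF x, of "e / (cmod c + 1)"] e by (simp add: add_nonneg_pos)
  then show "\<forall>\<^sub>F n in sequentially. \<forall>i. mat_opnorm (c \<cdot>\<^sub>m x i - diag_ext n (\<lambda>i. c \<cdot>\<^sub>m x i) i) \<le> e"
  proof eventually_elim
    case (elim n)
    have "c \<cdot>\<^sub>m x i - diag_ext n (\<lambda>i. c \<cdot>\<^sub>m x i) i = c \<cdot>\<^sub>m (x i - diag_ext n x i)" for i
      unfolding diag_ext_smult[OF limit_seqs_mat_seqs[OF x]]
      using cx(1)[of i] cx(2)[of n i] by (intro eq_matI) (auto simp: algebra_simps)
    moreover have "cmod c * mat_opnorm (x i - diag_ext n x i) \<le> e" for i
    proof -
      have "cmod c * mat_opnorm (x i - diag_ext n x i) \<le> (cmod c + 1) * (e / (cmod c + 1))"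
        using elim by (intro mult_mono) auto
      also have "\<dots> = e" using norm_ge_zero[of c] by (simp add: add_nonneg_eq_0_iff)
      finally show ?thesis .
    qed
    ultimately show ?case by (simp add: mat_opnorm_smult)
  qed
qed

lemma limit_seqs_minus:
  assumes "x \<in> limit_seqs" "y \<in> limit_seqs"
  shows "(\<lambda>i. x i - y i) \<in> limit_seqs"
  using limit_seqs_add[OF assms(1) limit_seqs_smult[OF assms(2), of "-1"]]
  by (simp add: mat_minus_eq[OF limit_seqsD[OF assms(1)] limit_seqsD[OF assms(2)]])

lemma limit_seqs_adjoint:
  assumes x: "x \<in> limit_seqs"
  shows "(\<lambda>i. mat_adjoint (x i)) \<in> limit_seqs"
proof (rule limit_seqsI)
  note cx = limit_seqsD[OF x] diag_ext_mat_seqs[OF limit_seqs_mat_seqs[OF x], THEN mat_seqsD]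
  show "(\<lambda>i. mat_adjoint (x i)) \<in> mat_seqs" using cx by (simp add: mat_seqs_def)
  have "mat_adjoint (x i) - diag_ext n (\<lambda>i. mat_adjoint (x i)) i = mat_adjoint (x i - diag_ext n x i)" for i n
    unfolding diag_ext_adjoint
    using cx(1)[of i] cx(2)[of n i] by (intro eq_matI) auto
  then show "\<forall>\<^sub>F n in sequentially. \<forall>i. mat_opnorm (mat_adjoint (x i) - diag_ext n (\<lambda>i. mat_adjoint (x i)) i) \<le> e"
    if "0 < e" for e
    using limit_seqs_eventually[OF x that] by (simp add: mat_opnorm_adjoint)
qed

lemma limit_seqs_mult:
  assumes x: "x \<in> limit_seqs" and y: "y \<in> limit_seqs"
  shows "(\<lambda>i. x i * y i) \<in> limit_seqs"
proof (rule limit_seqsI)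
  note c = limit_seqsD[OF x] limit_seqsD[OF y]
    diag_ext_mat_seqs[OF limit_seqs_mat_seqs[OF x], THEN mat_seqsD]
    diag_ext_mat_seqs[OF limit_seqs_mat_seqs[OF y], THEN mat_seqsD]
  show "(\<lambda>i. x i * y i) \<in> mat_seqs" using mult_carrier_mat[OF c(1,2)] by (simp add: mat_seqs_def)
  obtain C where C: "0 \<le> C" "\<And>i. mat_opnorm (x i) \<le> C" using limit_seqs_bounded[OF x] by blast
  obtain D where D: "0 \<le> D" "\<And>i. mat_opnorm (y i) \<le> D" using limit_seqs_bounded[OF y] by blast
  have D': "mat_opnorm (diag_ext n y i) \<le> D" for n i
    using D by (intro mat_opnorm_diag_ext_le limit_seqs_mat_seqs[OF y])
  fix e :: real assume e: "0 < e"
  \<comment> \<open>The difference of the products is split as x (y - y') + (x - x') y', which costs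
    (C + D) times this tolerance; the 1 keeps the denominator positive.\<close>
  let ?d = "e / (C + D + 1)"
  have d: "0 < ?d" using C D e by simp
  show "\<forall>\<^sub>F n in sequentially. \<forall>i. mat_opnorm (x i * y i - diag_ext n (\<lambda>i. x i * y i) i) \<le> e"
    using limit_seqs_eventually[OF x d] limit_seqs_eventually[OF y d]
  proof eventually_elim
    case (elim n)
    show ?case
    proof
      fix i
      let ?k = "block_size i" and ?x' = "diag_ext n x i" and ?y' = "diag_ext n y i"
      note ci = c(1)[of i] c(2)[of i] c(3)[of n i] c(4)[of n i]
      have 1: "x i * y i - x i * ?y' = x i * (y i - ?y')"
        using ci by (simp add: mult_minus_distrib_mat)
      have 2: "x i * ?y' - ?x' * ?y' = (x i - ?x') * ?y'"
        using ci by (simp add: minus_mult_distrib_mat)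
      have "mat_opnorm (x i * y i - ?x' * ?y')
          \<le> mat_opnorm (x i * (y i - ?y')) + mat_opnorm ((x i - ?x') * ?y')"
        using mat_opnorm_diff_triangle[of "x i * y i" ?k "x i * ?y'" "?x' * ?y'"] ci
        by (simp add: 1 2 mult_carrier_mat[of _ ?k ?k])
      also have "mat_opnorm (x i * (y i - ?y')) \<le> mat_opnorm (x i) * mat_opnorm (y i - ?y')"
        using ci by (intro mat_opnorm_mult_le) auto
      also have "mat_opnorm (x i) * mat_opnorm (y i - ?y') \<le> C * ?d"
        using C elim by (intro mult_mono) auto
      also have "mat_opnorm ((x i - ?x') * ?y') \<le> mat_opnorm (x i - ?x') * mat_opnorm ?y'"
        using ci by (intro mat_opnorm_mult_le) auto
      also have "mat_opnorm (x i - ?x') * mat_opnorm ?y' \<le> ?d * D"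
        using D' elim d by (intro mult_mono) auto
      also have "C * ?d + ?d * D = (C + D) * ?d"
        by (simp only: distrib_right mult.commute[of ?d D])
      also have "\<dots> \<le> (C + D + 1) * ?d"
        using d by (intro mult_right_mono) auto
      also have "\<dots> = e" using C D by simp
      finally show "mat_opnorm (x i * y i - diag_ext n (\<lambda>i. x i * y i) i) \<le> e"
        by (simp add: diag_ext_mult limit_seqs_mat_seqs x y)
    qed
  qed
qed

text \<open>Three steps of size e/3: from x to y, from y to its extension, and from there to the
  extension of x, the last one by contractivity. This is the completeness of \<open>A_lim\<close> in
  coordinates.\<close>

lemma limit_seqs_closed:
  assumes x: "x \<in> mat_seqs"
    and approx: "\<And>e. 0 < e \<Longrightarrow> \<exists>y\<in>limit_seqs. \<forall>i. mat_opnorm (y i - x i) \<le> e"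
  shows "x \<in> limit_seqs"
proof (rule limit_seqsI[OF x])
  fix e :: real assume e: "0 < e"
  then obtain y where y: "y \<in> limit_seqs" and yx: "\<And>i. mat_opnorm (y i - x i) \<le> e / 3"
    using approx[of "e / 3"] by auto
  have "\<forall>\<^sub>F n in sequentially. \<forall>i. mat_opnorm (y i - diag_ext n y i) \<le> e / 3"
    using limit_seqs_eventually[OF y, of "e / 3"] e by simp
  then show "\<forall>\<^sub>F n in sequentially. \<forall>i. mat_opnorm (x i - diag_ext n x i) \<le> e"
  proof eventually_elim
    case (elim n)
    show ?case
    proof
      fix i
      note c = mat_seqsD[OF x, of i] limit_seqsD[OF y, of i] diag_ext_mat_seqs[OF x, THEN mat_seqsD, of n i]
        diag_ext_mat_seqs[OF limit_seqs_mat_seqs[OF y], THEN mat_seqsD, of n i]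
      have m: "(\<lambda>i. y i - x i) \<in> mat_seqs"
        using minus_carrier_mat[OF mat_seqsD[OF x]] by (simp add: mat_seqs_def)
      have "mat_opnorm (diag_ext n (\<lambda>i. y i - x i) i) \<le> e / 3"
        using yx by (intro mat_opnorm_diag_ext_le m)
      then have "mat_opnorm (diag_ext n y i - diag_ext n x i) \<le> e / 3"
        by (simp add: diag_ext_minus limit_seqs_mat_seqs[OF y] x)
      then show "mat_opnorm (x i - diag_ext n x i) \<le> e"
        using mat_opnorm_diff_triangle[OF c(1) c(2) c(3)] mat_opnorm_diff_triangle[OF c(2) c(4) c(3)]
          mat_opnorm_minus_commute[OF c(1,2)] yx[of i] elim[rule_format, of i] by linarith
    qed
  qed
qed


section \<open>The limit algebra as an algebra of sequences\<close>

lemma \<phi>_seq_in_carrier: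
  assumes "xs \<in> carrier (A_seq n)" "0 < n"
  shows "\<phi>_seq n xs \<in> carrier (A_seq (n + 1))"
proof -
  have "diag_block_mat (map ((!) xs) [0..<n]) \<in> carrier_mat (block_size n) (block_size n)"
    using assms by (intro diag_block_mat_mat_seqs) (auto simp: A_seq_carrier_iff)
  moreover have "map ((!) xs) [0..<n] = xs"
    using assms map_nth[of xs] by (simp add: A_seq_carrier_iff)
  ultimately show ?thesis
    using assms by (auto simp: A_seq_carrier_iff \<phi>_seq_def nth_append less_Suc_eq)
qed

lemma map_block_append:
  assumes "length xs = n" "f n = d" "\<And>i. i < n \<Longrightarrow> f i = xs ! i"
  shows "map f [0..<Suc n] = xs @ [d]"
  using assms by (intro nth_equalityI) (auto simp: nth_append less_Suc_eq simp del: upt_Suc)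

lemma \<phi>_seq_star_hom:
  assumes n: "0 < n"
  shows "\<phi>_seq n \<in> star_hom (A_seq n) (A_seq (n + 1))"
proof -
  have nth: "map ((!) xs) [0..<n] = xs" if "xs \<in> carrier (A_seq n)" for xs :: "complex mat list"
    using that map_nth[of xs] by (simp add: A_seq_carrier_iff)
  have c: "j \<in> set [0..<n] \<Longrightarrow> xs ! j \<in> carrier_mat (block_size j) (block_size j)"
    if "xs \<in> carrier (A_seq n)" for xs j
    using that by (simp add: A_seq_carrier_iff)
  have len: "length xs = n" if "xs \<in> carrier (A_seq n)" for xs
    using that by (simp add: A_seq_carrier_iff)
  have add: "\<phi>_seq n (xs \<oplus>\<^bsub>A_seq n\<^esub> ys) = \<phi>_seq n xs \<oplus>\<^bsub>A_seq (n + 1)\<^esub> \<phi>_seq n ys"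
    and mult: "\<phi>_seq n (xs \<otimes>\<^bsub>A_seq n\<^esub> ys) = \<phi>_seq n xs \<otimes>\<^bsub>A_seq (n + 1)\<^esub> \<phi>_seq n ys"
    if "xs \<in> carrier (A_seq n)" "ys \<in> carrier (A_seq n)" for xs ys
    using that diag_block_mat_add[of "[0..<n]" "(!) xs" block_size "(!) ys", OF c c]
      diag_block_mat_mult[of "[0..<n]" "(!) xs" block_size "(!) ys", OF c c]
    by (auto simp: A_seq_simps \<phi>_seq_def nth len nth_append intro!: map_block_append[symmetric])
  have smult: "\<phi>_seq n (a \<odot>\<^bsub>A_seq n\<^esub> xs) = a \<odot>\<^bsub>A_seq (n + 1)\<^esub> \<phi>_seq n xs"
    and star: "\<phi>_seq n (star (A_seq n) xs) = star (A_seq (n + 1)) (\<phi>_seq n xs)"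
    if "xs \<in> carrier (A_seq n)" for xs a
    using that diag_block_mat_smult[of "[0..<n]" "(!) xs" block_size a, OF c]
      diag_block_mat_adjoint[of "(!) xs" "[0..<n]"]
    by (auto simp: A_seq_simps \<phi>_seq_def nth len nth_append intro!: map_block_append[symmetric])
  show ?thesis
    using add mult smult star \<phi>_seq_in_carrier[OF _ n]
    by (auto simp: star_hom_def LinearCombinations.module_hom_def)
qed

lemma \<phi>_seq_one:
  assumes n: "0 < n"
  shows "\<phi>_seq n \<one>\<^bsub>A_seq n\<^esub> = \<one>\<^bsub>A_seq (n + 1)\<^esub>"
  using n by (simp add: A_seq_simps \<phi>_seq_def diag_block_mat_one sum_list_block_size)

lemma inj_on_\<phi>_seq: "inj_on (\<phi>_seq n) S"
  by (auto simp: inj_on_def \<phi>_seq_def)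

text \<open>Appending the block diagonal matrix of the current list is exactly the recursion of
  \<open>diag_ext\<close>. The values \<open>a ! i\<close> beyond the length of the list are
  unspecified but never read, as \<open>diag_ext m\<close> looks only at indices up to m.\<close>

lemma connect_\<phi>_seq:
  assumes a: "a \<in> carrier (A_seq (Suc m))"
  shows "connect (\<lambda>n. \<phi>_seq (Suc n)) m d a = map (diag_ext m ((!) a)) [0..<Suc (m + d)]"
proof (induction d)
  case 0
  have eq: "map (diag_ext m ((!) a)) [0..<Suc m] = map ((!) a) [0..<Suc m]"
    by (auto simp del: upt_Suc)
  show ?case
    unfolding connect.simps add_0_right eq
    using a map_nth[of a] by (simp add: A_seq_carrier_iff del: upt_Suc)
next
  case (Suc d)
  have "diag_ext m ((!) a) (Suc (m + d)) = diag_block_mat (map (diag_ext m ((!) a)) [0..<Suc (m + d)])"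
    by (rule diag_ext_gt) simp
  then show ?case
    using Suc by (simp add: \<phi>_seq_def)
qed

abbreviation A_shift :: "nat \<Rightarrow> complex mat list cstar" where
  "A_shift n \<equiv> A_seq (Suc n)"

abbreviation A_prod :: "(nat \<Rightarrow> complex mat list) cstar" where
  "A_prod \<equiv> bounded_prod A_shift"

abbreviation A_null :: "(nat \<Rightarrow> complex mat list) set" where
  "A_null \<equiv> null_seqs A_shift"

interpretation A_prod: cstar_algebra A_prod
  by (rule cstar_algebra_bounded_prod) (rule cstar_algebra_A_seq)

interpretation A_null: cstar_ideal A_prod A_null
  by (rule cstar_ideal_null_seqs) (rule cstar_algebra_A_seq)

text \<open>Truncation at n gives an element of \<open>A_shift n\<close>, so a sequence of matrices
  becomes a sequence in the bounded product. If x comes from stage m, its truncations from m on are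
  successive images under the connecting maps.\<close>

definition prefixes :: "(nat \<Rightarrow> complex mat) \<Rightarrow> nat \<Rightarrow> complex mat list" where
  "prefixes x n = map x [0..<Suc n]"

lemma length_prefixes [simp]: "length (prefixes x n) = Suc n"
  by (simp add: prefixes_def)

lemma nth_prefixes [simp]: "i \<le> n \<Longrightarrow> prefixes x n ! i = x i"
  by (simp add: prefixes_def del: upt_Suc)

text \<open>The isomorphism announced in the overview: isometric by
  \<open>cnorm_to_lim_le_iff\<close>, injective by \<open>to_lim_inj\<close>, onto by
  \<open>A_lim_carrier\<close>.\<close>

definition to_lim :: "(nat \<Rightarrow> complex mat) \<Rightarrow> (nat \<Rightarrow> complex mat list) set" where
  "to_lim x = A_null +>\<^bsub>A_prod\<^esub> prefixes x"

lemma prefixes_in_A_seq: "x \<in> mat_seqs \<Longrightarrow> prefixes x n \<in> carrier (A_seq (Suc n))"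
  by (auto simp: A_seq_carrier_iff mat_seqsD)

lemma cnorm_prefixes_le_iff:
  assumes "0 \<le> r"
  shows "cnorm (A_seq (Suc n)) (prefixes x n) \<le> r \<longleftrightarrow> (\<forall>i\<le>n. mat_opnorm (x i) \<le> r)"
  using assms by (auto simp: cnorm_A_seq_le_iff less_Suc_eq_le)

lemma prefixes_in_A_prod:
  assumes x: "x \<in> limit_seqs"
  shows "prefixes x \<in> carrier A_prod"
proof -
  obtain C where "0 \<le> C" "\<And>i. mat_opnorm (x i) \<le> C" using limit_seqs_bounded[OF x] by blast
  then show ?thesis
    using prefixes_in_A_seq[OF limit_seqs_mat_seqs[OF x]] cnorm_prefixes_le_iff[of C]
    by (auto simp: bounded_prod_carrier_iff intro!: exI[of _ C])
qed

lemma prefixes_ops: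
  "prefixes x \<oplus>\<^bsub>A_prod\<^esub> prefixes y = prefixes (\<lambda>i. x i + y i)"
  "prefixes x \<otimes>\<^bsub>A_prod\<^esub> prefixes y = prefixes (\<lambda>i. x i * y i)"
  "c \<odot>\<^bsub>A_prod\<^esub> prefixes x = prefixes (\<lambda>i. c \<cdot>\<^sub>m x i)"
  "star A_prod (prefixes x) = prefixes (\<lambda>i. mat_adjoint (x i))"
  "\<zero>\<^bsub>A_prod\<^esub> = prefixes (\<lambda>i. 0\<^sub>m (block_size i) (block_size i))"
  "\<one>\<^bsub>A_prod\<^esub> = prefixes (\<lambda>i. 1\<^sub>m (block_size i))"
  by (auto simp: fun_eq_iff bounded_prod_simps A_seq_simps prefixes_def nth_append
      simp del: upt_Suc intro!: nth_equalityI)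

lemma A_lim_simps:
  "add A_lim = add A_null.Q" "mult A_lim = mult A_null.Q" "smult A_lim = smult A_null.Q"
  "star A_lim = star A_null.Q" "zero A_lim = zero A_null.Q" "one A_lim = one A_null.Q"
  "cnorm A_lim = cnorm A_null.Q"
  by (simp_all add: A_lim_def inductive_limit_def Let_def)

lemma to_lim_add:
  "\<lbrakk>x \<in> limit_seqs; y \<in> limit_seqs\<rbrakk> \<Longrightarrow> to_lim x \<oplus>\<^bsub>A_lim\<^esub> to_lim y = to_lim (\<lambda>i. x i + y i)"
  by (simp add: to_lim_def A_lim_simps A_null.quot_add prefixes_in_A_prod prefixes_ops)

lemma to_lim_mult:
  "\<lbrakk>x \<in> limit_seqs; y \<in> limit_seqs\<rbrakk> \<Longrightarrow> to_lim x \<otimes>\<^bsub>A_lim\<^esub> to_lim y = to_lim (\<lambda>i. x i * y i)"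
  by (simp add: to_lim_def A_lim_simps A_null.quot_mult prefixes_in_A_prod prefixes_ops)

lemma to_lim_smult:
  "x \<in> limit_seqs \<Longrightarrow> c \<odot>\<^bsub>A_lim\<^esub> to_lim x = to_lim (\<lambda>i. c \<cdot>\<^sub>m x i)"
  by (simp add: to_lim_def A_lim_simps A_null.quot_smult prefixes_in_A_prod prefixes_ops)

lemma to_lim_star:
  "x \<in> limit_seqs \<Longrightarrow> star A_lim (to_lim x) = to_lim (\<lambda>i. mat_adjoint (x i))"
  by (simp add: to_lim_def A_lim_simps A_null.quot_star star_null_seqs cstar_algebra_A_seq
      prefixes_in_A_prod prefixes_ops)

lemma to_lim_zero: "\<zero>\<^bsub>A_lim\<^esub> = to_lim (\<lambda>i. 0\<^sub>m (block_size i) (block_size i))"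
  by (simp add: to_lim_def A_lim_simps A_null.quot_zero prefixes_ops)

lemma to_lim_one: "\<one>\<^bsub>A_lim\<^esub> = to_lim (\<lambda>i. 1\<^sub>m (block_size i))"
  by (simp add: to_lim_def A_lim_simps prefixes_ops(6)[symmetric]) (simp add: cstar_quot_def)

text \<open>The norm of a truncation is the maximum over the coordinates up to n and grows with n.
  Each fixed coordinate occurs in all late truncations, so the limit superior of the quotient norm
  is the supremum over coordinates.\<close>

lemma cnorm_to_lim_le_iff:
  assumes x: "x \<in> limit_seqs" and r: "0 \<le> r"
  shows "cnorm A_lim (to_lim x) \<le> r \<longleftrightarrow> (\<forall>i. mat_opnorm (x i) \<le> r)"
proof -
  have "cnorm A_lim (to_lim x) \<le> r \<longleftrightarrow>
      (\<forall>e>0. \<forall>\<^sub>F n in sequentially. cnorm (A_seq (Suc n)) (prefixes x n) \<le> r + e)"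
    unfolding to_lim_def A_lim_simps
    by (rule cnorm_quot_null_seqs_le_iff[OF cstar_algebra_A_seq prefixes_in_A_prod[OF x] r])
  also have "\<dots> \<longleftrightarrow> (\<forall>e>0. \<forall>\<^sub>F n in sequentially. \<forall>i\<le>n. mat_opnorm (x i) \<le> r + e)"
    using r by (simp add: cnorm_prefixes_le_iff)
  also have "\<dots> \<longleftrightarrow> (\<forall>i. mat_opnorm (x i) \<le> r)"
  proof
    assume ev: "\<forall>e>0. \<forall>\<^sub>F n in sequentially. \<forall>i\<le>n. mat_opnorm (x i) \<le> r + e"
    show "\<forall>i. mat_opnorm (x i) \<le> r"
    proof (rule allI, rule field_le_epsilon)
      fix i and e :: real assume "0 < e"
      then obtain N where "\<And>n. n \<ge> N \<Longrightarrow> \<forall>i\<le>n. mat_opnorm (x i) \<le> r + e"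
        using ev by (auto simp: eventually_sequentially)
      from this[of "max N i"] show "mat_opnorm (x i) \<le> r + e" by simp
    qed
  next
    assume "\<forall>i. mat_opnorm (x i) \<le> r"
    then have "mat_opnorm (x i) \<le> r + e" if "0 < e" for i e
      using that by (simp add: add_increasing2)
    then show "\<forall>e>0. \<forall>\<^sub>F n in sequentially. \<forall>i\<le>n. mat_opnorm (x i) \<le> r + e"
      by simp
  qed
  finally show ?thesis .
qed

lemma cnorm_to_lim_nonneg: "x \<in> limit_seqs \<Longrightarrow> 0 \<le> cnorm A_lim (to_lim x)"
  unfolding to_lim_def A_lim_simps
  by (rule cnorm_quot_null_seqs_nonneg[OF cstar_algebra_A_seq prefixes_in_A_prod])

text \<open>By the isometry, the difference of two sequences with the same coset has norm 0 in every
  coordinate. This makes the coordinates of an element of the limit well defined.\<close>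

lemma to_lim_inj:
  assumes x: "x \<in> limit_seqs" and y: "y \<in> limit_seqs" and eq: "to_lim x = to_lim y"
  shows "x = y"
proof -
  have "to_lim (\<lambda>i. x i - y i) = to_lim x \<oplus>\<^bsub>A_lim\<^esub> (-1) \<odot>\<^bsub>A_lim\<^esub> to_lim y"
    using x y by (simp add: to_lim_add to_lim_smult limit_seqs_smult mat_minus_eq[OF limit_seqsD limit_seqsD])
  also have "\<dots> = to_lim (\<lambda>i. x i + (-1) \<cdot>\<^sub>m x i)"
    unfolding eq[symmetric] using x by (simp add: to_lim_add to_lim_smult limit_seqs_smult)
  also
  have "x i + (-1) \<cdot>\<^sub>m x i = 0\<^sub>m (block_size i) (block_size i)" for i
    using limit_seqsD[OF x, of i] by (intro eq_matI) auto
  then have "(\<lambda>i. x i + (-1) \<cdot>\<^sub>m x i) = (\<lambda>i. 0\<^sub>m (block_size i) (block_size i))" by blast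
  finally have "cnorm A_lim (to_lim (\<lambda>i. x i - y i)) \<le> 0"
    by (simp add: cnorm_to_lim_le_iff zero_limit_seqs)
  then have "mat_opnorm (x i - y i) \<le> 0" for i
    by (subst (asm) cnorm_to_lim_le_iff) (auto simp: limit_seqs_minus x y)
  then have "mat_opnorm (x i - y i) = 0" for i by (simp add: antisym)
  then have "x i - y i = 0\<^sub>m (block_size i) (block_size i)" for i
    using minus_carrier_mat[OF limit_seqsD[OF y]] by (intro mat_opnorm_eq_zero) auto
  then have "x i = y i" for i
    using limit_seqsD[OF x, of i] limit_seqsD[OF y, of i]
    by (metis (no_types, lifting) cstar_algebra.minus_zero_iff cstar_algebra_mat_cstar mat_cstar_minus mat_cstar_simps(1,4))
  then show ?thesis by blast
qed

text \<open>The two representatives differ only in the terms below m, where one is zero and the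
  other a truncation; finitely many terms form a null sequence.\<close>

lemma limit_map_eq_to_lim:
  assumes a: "a \<in> carrier (A_seq (Suc m))"
  shows "limit_map A_shift (\<lambda>n. \<phi>_seq (Suc n)) m a = to_lim (diag_ext m ((!) a))"
proof -
  define x where "x = diag_ext m ((!) a)"
  define u where "u n = (if n < m then \<zero>\<^bsub>A_seq (Suc n)\<^esub>
      else connect (\<lambda>n. \<phi>_seq (Suc n)) m (n - m) a)" for n
  have u: "u n = (if n < m then \<zero>\<^bsub>A_seq (Suc n)\<^esub> else prefixes x n)" for n
    using a by (simp add: u_def connect_\<phi>_seq x_def prefixes_def)
  have "x \<in> mat_seqs"
    using a by (auto simp: mat_seqs_def x_def A_seq_carrier_iff intro!: diag_ext_in_carrier)
  moreover have "diag_ext m x = x" unfolding x_def by (rule diag_ext_diag_ext) simp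
  ultimately have x: "x \<in> limit_seqs" by (rule diag_ext_fixed_limit_seqs)
  note px = prefixes_in_A_prod[OF x]
  obtain C where C: "0 \<le> C" "\<And>n. cnorm (A_seq (Suc n)) (prefixes x n) \<le> C"
    using px limit_seqs_bounded[OF x] cnorm_prefixes_le_iff by metis
  have z: "\<zero>\<^bsub>A_seq n\<^esub> \<in> carrier (A_seq n)" for n by (auto simp: A_seq_carrier_iff A_seq_simps)
  have "cnorm (A_seq (Suc n)) (u n) \<le> C" for n
    using C by (simp add: u cstar_algebra.norm_zero[OF cstar_algebra_A_seq])
  moreover have "u n \<in> carrier (A_seq (Suc n))" for n
    using z px by (simp add: u bounded_prod_carrier_iff)
  ultimately have uP: "u \<in> carrier A_prod" by (auto simp: bounded_prod_carrier_iff)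
  have "\<forall>\<^sub>F n in sequentially. 0 = cnorm (A_seq (Suc n)) ((u \<ominus>\<^bsub>A_prod\<^esub> prefixes x) n)"
    using eventually_ge_at_top[of m]
  proof eventually_elim
    case (elim n)
    have "prefixes x n \<ominus>\<^bsub>A_seq (Suc n)\<^esub> prefixes x n = \<zero>\<^bsub>A_seq (Suc n)\<^esub>"
      using px by (subst cstar_algebra.minus_zero_iff[OF cstar_algebra_A_seq]) (auto simp: bounded_prod_carrier_iff)
    then show ?case
      using elim px by (simp add: bounded_prod_minus cstar_algebra_A_seq u cstar_algebra.norm_zero[OF cstar_algebra_A_seq])
  qed
  then have "u \<ominus>\<^bsub>A_prod\<^esub> prefixes x \<in> A_null"
    using uP px by (auto simp: null_seqs_iff intro: Lim_transform_eventually[OF tendsto_const])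
  then have "A_null +>\<^bsub>A_prod\<^esub> u = A_null +>\<^bsub>A_prod\<^esub> prefixes x"
    using uP px by (simp add: A_null.coset_eq_iff)
  then show ?thesis by (simp add: limit_map_def to_lim_def x_def u_def[abs_def])
qed

lemma UN_limit_map:
  "(\<Union>m. limit_map A_shift (\<lambda>n. \<phi>_seq (Suc n)) m ` carrier (A_shift m))
    = {to_lim x |x. x \<in> mat_seqs \<and> (\<exists>m. diag_ext m x = x)}"
proof (intro equalityI subsetI)
  fix X assume "X \<in> (\<Union>m. limit_map A_shift (\<lambda>n. \<phi>_seq (Suc n)) m ` carrier (A_shift m))"
  then obtain m a where a: "a \<in> carrier (A_seq (Suc m))" and X: "X = to_lim (diag_ext m ((!) a))"
    by (auto simp: limit_map_eq_to_lim)
  have "diag_ext m ((!) a) \<in> mat_seqs"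
    using a by (auto simp: mat_seqs_def A_seq_carrier_iff intro!: diag_ext_in_carrier)
  then show "X \<in> {to_lim x |x. x \<in> mat_seqs \<and> (\<exists>m. diag_ext m x = x)}"
    using X diag_ext_diag_ext[of m m] by blast
next
  fix X assume "X \<in> {to_lim x |x. x \<in> mat_seqs \<and> (\<exists>m. diag_ext m x = x)}"
  then obtain x m where x: "x \<in> mat_seqs" "diag_ext m x = x" "X = to_lim x" by blast
  have "diag_ext m ((!) (prefixes x m)) = diag_ext m x" by (rule diag_ext_cong) simp
  then have "X = limit_map A_shift (\<lambda>n. \<phi>_seq (Suc n)) m (prefixes x m)"
    using x prefixes_in_A_seq by (simp add: limit_map_eq_to_lim)
  then show "X \<in> (\<Union>m. limit_map A_shift (\<lambda>n. \<phi>_seq (Suc n)) m ` carrier (A_shift m))"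
    using x prefixes_in_A_seq by blast
qed

text \<open>Differences are first needed in the ambient quotient, where the closure defining the
  limit is taken and where the vector space structure is already available. The version in
  \<open>A_lim\<close> has to wait for \<open>cstar_algebra_A_lim\<close>.\<close>

lemma to_lim_minus_Q:
  "\<lbrakk>x \<in> limit_seqs; y \<in> limit_seqs\<rbrakk> \<Longrightarrow> to_lim x \<ominus>\<^bsub>A_null.Q\<^esub> to_lim y = to_lim (\<lambda>i. x i - y i)"
  by (subst minus_eq_add_smult[OF A_null.vectorspace_quot])
    (auto simp: to_lim_def A_null.quot_carrier prefixes_in_A_prod A_null.quot_smult A_null.quot_add
      A_prod.smult_in_carrier prefixes_ops limit_seqs_smult mat_minus_eq[OF limit_seqsD limit_seqsD])

lemma A_prod_minus_prefixes:
  assumes z: "z \<in> carrier A_prod" and x: "x \<in> limit_seqs" and i: "i \<le> n"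
  shows "(z \<ominus>\<^bsub>A_prod\<^esub> prefixes x) n ! i = z n ! i - x i"
proof -
  have zc: "z n ! i \<in> carrier_mat (block_size i) (block_size i)"
    using z i by (auto simp: bounded_prod_carrier_iff A_seq_carrier_iff less_Suc_eq_le)
  have "(z \<ominus>\<^bsub>A_prod\<^esub> prefixes x) n = map (\<lambda>j. z n ! j + (-1) \<cdot>\<^sub>m prefixes x n ! j) [0..<Suc n]"
    using bounded_prod_minus[of A_shift "prefixes x" z] cstar_algebra_A_seq prefixes_in_A_prod[OF x]
      A_seq_minus[OF prefixes_in_A_seq[OF limit_seqs_mat_seqs[OF x]], where xs = "z n"] by (simp del: upt_Suc)
  then show ?thesis
    using i mat_minus_eq[OF zc limit_seqsD[OF x]] by (simp del: upt_Suc)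
qed

lemma to_lim_in_norm_closure:
  assumes x: "x \<in> limit_seqs"
  shows "to_lim x \<in> norm_closure A_null.Q {to_lim x |x. x \<in> mat_seqs \<and> (\<exists>m. diag_ext m x = x)}"
proof -
  have "\<exists>Y\<in>{to_lim y |y. y \<in> mat_seqs \<and> (\<exists>m. diag_ext m y = y)}. cnorm A_null.Q (to_lim x \<ominus>\<^bsub>A_null.Q\<^esub> Y) < e"
    if e: "0 < e" for e
  proof -
    obtain n where n: "\<And>i. mat_opnorm (x i - diag_ext n x i) \<le> e / 2"
      using limit_seqs_eventually[OF x, of "e / 2"] e by (auto simp: eventually_sequentially)
    let ?y = "diag_ext n x"
    have y: "?y \<in> limit_seqs" by (rule diag_ext_limit_seqs[OF limit_seqs_mat_seqs[OF x]])
    have "cnorm A_lim (to_lim (\<lambda>i. x i - ?y i)) \<le> e / 2"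
      using n e by (subst cnorm_to_lim_le_iff) (auto simp: limit_seqs_minus x y)
    then have "cnorm A_null.Q (to_lim x \<ominus>\<^bsub>A_null.Q\<^esub> to_lim ?y) < e"
      using x y e by (simp add: to_lim_minus_Q A_lim_simps)
    then show ?thesis
      using limit_seqs_mat_seqs[OF y] diag_ext_diag_ext[of n n x] by blast
  qed
  then show ?thesis
    using x by (auto simp: norm_closure_def A_null.quot_carrier to_lim_def prefixes_in_A_prod)
qed

text \<open>The quotient norm controls a representative z only for large n, so closeness to y holds
  eventually; the list \<open>z n\<close> has coordinates 0 to n, whence the range of i.\<close>

lemma norm_closure_approx:
  assumes z: "z \<in> carrier A_prod"
    and X: "A_null +>\<^bsub>A_prod\<^esub> z \<in> norm_closure A_null.Q {to_lim x |x. x \<in> mat_seqs \<and> (\<exists>m. diag_ext m x = x)}"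
    and e: "0 < e"
  shows "\<exists>y\<in>limit_seqs. \<forall>\<^sub>F n in sequentially. \<forall>i\<le>n. mat_opnorm (z n ! i - y i) \<le> e"
proof -
  have "0 < e / 2" using e by simp
  then have "\<exists>Y\<in>{to_lim x |x. x \<in> mat_seqs \<and> (\<exists>m. diag_ext m x = x)}.
      cnorm A_null.Q ((A_null +>\<^bsub>A_prod\<^esub> z) \<ominus>\<^bsub>A_null.Q\<^esub> Y) < e / 2"
    using X unfolding norm_closure_def by blast
  then obtain y m where y: "y \<in> mat_seqs" "diag_ext m y = y"
    and Xy: "cnorm A_null.Q ((A_null +>\<^bsub>A_prod\<^esub> z) \<ominus>\<^bsub>A_null.Q\<^esub> to_lim y) < e / 2"
    by blast
  have yl: "y \<in> limit_seqs" by (rule diag_ext_fixed_limit_seqs[OF y])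
  note py = prefixes_in_A_prod[OF yl]
  have zy: "z \<ominus>\<^bsub>A_prod\<^esub> prefixes y \<in> carrier A_prod" using z py by simp
  have "(A_null +>\<^bsub>A_prod\<^esub> z) \<ominus>\<^bsub>A_null.Q\<^esub> to_lim y = A_null +>\<^bsub>A_prod\<^esub> (z \<ominus>\<^bsub>A_prod\<^esub> prefixes y)"
    unfolding to_lim_def by (rule A_null.quot_minus[OF z py])
  then have "cnorm A_null.Q (A_null +>\<^bsub>A_prod\<^esub> (z \<ominus>\<^bsub>A_prod\<^esub> prefixes y)) \<le> e / 2" using Xy by simp
  \<comment> \<open>One half bounds the quotient norm, the other is the slack incurred when passing
    from the quotient norm to the terms of a representative.\<close>
  then have "\<forall>\<^sub>F n in sequentially. cnorm (A_seq (Suc n)) ((z \<ominus>\<^bsub>A_prod\<^esub> prefixes y) n) \<le> e / 2 + e / 2"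
    using cnorm_quot_null_seqs_le_iff[OF cstar_algebra_A_seq zy, of "e / 2"] e half_gt_zero[OF e]
    by (meson less_imp_le)
  then have "\<forall>\<^sub>F n in sequentially. \<forall>i\<le>n. mat_opnorm (z n ! i - y i) \<le> e"
  proof eventually_elim
    case (elim n)
    from A_prod_minus_prefixes[OF z yl] show ?case
      using elim e cnorm_A_seq_le_iff[of e "Suc n"] by (simp add: less_Suc_eq_le)
  qed
  then show ?thesis using yl by blast
qed

text \<open>This is the surjectivity of \<open>to_lim\<close>. Approximants with error 1/(k + 1) are
  uniformly Cauchy; their limit x lies in \<open>limit_seqs\<close>, and z differs from the
  truncations of x by a null sequence.\<close>

lemma to_lim_of_approx:
  assumes z: "z \<in> carrier A_prod"
    and approx: "\<And>e. 0 < e \<Longrightarrow>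
      \<exists>y\<in>limit_seqs. \<forall>\<^sub>F n in sequentially. \<forall>i\<le>n. mat_opnorm (z n ! i - y i) \<le> e"
  shows "A_null +>\<^bsub>A_prod\<^esub> z \<in> to_lim ` limit_seqs"
proof -
  have zc: "i \<le> n \<Longrightarrow> z n ! i \<in> carrier_mat (block_size i) (block_size i)" for n i
    using z by (auto simp: bounded_prod_carrier_iff A_seq_carrier_iff less_Suc_eq_le)
  have "\<forall>k. \<exists>y. y \<in> limit_seqs \<and>
      (\<forall>\<^sub>F n in sequentially. \<forall>i\<le>n. mat_opnorm (z n ! i - y i) \<le> inverse (real (Suc k)))"
  proof
    fix k
    have "0 < inverse (real (Suc k))" by simp
    from approx[OF this] show "\<exists>y. y \<in> limit_seqs \<and>
        (\<forall>\<^sub>F n in sequentially. \<forall>i\<le>n. mat_opnorm (z n ! i - y i) \<le> inverse (real (Suc k)))"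
      by blast
  qed
  from choice[OF this] obtain y where y: "\<And>k. y k \<in> limit_seqs"
    and zy: "\<And>k. \<forall>\<^sub>F n in sequentially. \<forall>i\<le>n. mat_opnorm (z n ! i - y k i) \<le> inverse (real (Suc k))"
    by blast
  \<comment> \<open>Both approximants are compared with coordinate i of \<open>z n\<close> for one
    large n at least i. The resulting bound mentions neither n nor z and is uniform in i.\<close>
  have yy: "mat_opnorm (y k i - y l i) \<le> inverse (real (Suc k)) + inverse (real (Suc l))" for k l i
  proof -
    have "\<forall>\<^sub>F n in sequentially. mat_opnorm (y k i - y l i) \<le> inverse (real (Suc k)) + inverse (real (Suc l))"
      using zy[of k] zy[of l] eventually_ge_at_top[of i]
    proof eventually_elim
      case (elim n)
      then show ?case
        using mat_opnorm_diff_triangle[OF limit_seqsD[OF y, of k i] zc[OF elim(3)] limit_seqsD[OF y, of l i]]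
          mat_opnorm_minus_commute[OF limit_seqsD[OF y, of k i] zc[OF elim(3)]] by force
    qed
    then show ?thesis by simp
  qed
  obtain x where x: "\<And>i. x i \<in> carrier_mat (block_size i) (block_size i)"
    and yx: "\<And>e. 0 < e \<Longrightarrow> \<exists>N. \<forall>k\<ge>N. \<forall>i. mat_opnorm (y k i - x i) \<le> e"
  proof (rule uniformly_Cauchy_converges[of UNIV "\<lambda>i. mat_cstar (block_size i)" y])
    fix e :: real assume "0 < e"
    then obtain N where N: "inverse (real (Suc N)) < e / 2" using reals_Archimedean[of "e / 2"] by auto
    have "mat_opnorm (y k i - y l i) < e" if "k \<ge> N" "l \<ge> N" for k l i
    proof -
      have "inverse (real (Suc k)) \<le> inverse (real (Suc N))" "inverse (real (Suc l)) \<le> inverse (real (Suc N))"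
        using that by (auto intro!: le_imp_inverse_le)
      then show ?thesis using yy[of k i l] N by linarith
    qed
    then show "\<exists>N. \<forall>m\<ge>N. \<forall>n\<ge>N. \<forall>i\<in>UNIV.
        cnorm (mat_cstar (block_size i)) (y m i \<ominus>\<^bsub>mat_cstar (block_size i)\<^esub> y n i) < e"
      using limit_seqsD[OF y] by (auto simp: mat_cstar_minus)
  next
    fix x assume "\<And>i. i \<in> UNIV \<Longrightarrow> x i \<in> carrier (mat_cstar (block_size i))"
      "\<And>e. 0 < e \<Longrightarrow> \<exists>N. \<forall>n\<ge>N. \<forall>i\<in>UNIV. cnorm (mat_cstar (block_size i)) (y n i \<ominus>\<^bsub>mat_cstar (block_size i)\<^esub> x i) \<le> e"
    then show thesis by (intro that[of x]) (auto simp: mat_cstar_minus)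
  next
    show "cstar_algebra (mat_cstar (block_size i))" for i by (rule cstar_algebra_mat_cstar)
    show "y k i \<in> carrier (mat_cstar (block_size i))" for k i using limit_seqsD[OF y] by simp
  qed
  have xl: "x \<in> limit_seqs"
  proof (rule limit_seqs_closed)
    show "\<exists>y\<in>limit_seqs. \<forall>i. mat_opnorm (y i - x i) \<le> e" if "0 < e" for e
      using yx[OF that] y by blast
  qed (use x in \<open>simp add: mat_seqs_def\<close>)
  note px = prefixes_in_A_prod[OF xl]
  note zx = A_prod_minus_prefixes[OF z xl]
  have "(\<lambda>n. cnorm (A_seq (Suc n)) ((z \<ominus>\<^bsub>A_prod\<^esub> prefixes x) n)) \<longlonglongrightarrow> 0"
  proof (rule LIMSEQ_I)
    fix r :: real assume r: "0 < r"
    \<comment> \<open>One r/4 is spent between y k and x, another between z and y k; ending at r/2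
      leaves room for the strict inequality.\<close>
    obtain N where N: "\<And>k i. k \<ge> N \<Longrightarrow> mat_opnorm (y k i - x i) \<le> r / 4"
      using yx[of "r / 4"] r by auto
    obtain M where M: "inverse (real (Suc M)) < r / 4" using reals_Archimedean[of "r / 4"] r by auto
    let ?k = "max N M"
    have "inverse (real (Suc ?k)) \<le> inverse (real (Suc M))" by (intro le_imp_inverse_le) auto
    then have k: "inverse (real (Suc ?k)) \<le> r / 4" using M by linarith
    have "\<forall>\<^sub>F n in sequentially. cnorm (A_seq (Suc n)) ((z \<ominus>\<^bsub>A_prod\<^esub> prefixes x) n) \<le> r / 2"
      using zy[of ?k]
    proof eventually_elim
      case (elim n)
      have "mat_opnorm (z n ! i - x i) \<le> r / 2" if "i \<le> n" for i
        using mat_opnorm_diff_triangle[OF zc[OF that] limit_seqsD[OF y, of ?k i] x[of i]]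
          elim[rule_format, OF that] k N[of ?k i] by simp
      then show ?case
        using r cnorm_A_seq_le_iff[of "r / 2" "Suc n"] zx by (simp add: less_Suc_eq_le)
    qed
    then obtain n0 where "\<And>n. n \<ge> n0 \<Longrightarrow> cnorm (A_seq (Suc n)) ((z \<ominus>\<^bsub>A_prod\<^esub> prefixes x) n) \<le> r / 2"
      by (auto simp: eventually_sequentially)
    then show "\<exists>n0. \<forall>n\<ge>n0. norm (cnorm (A_seq (Suc n)) ((z \<ominus>\<^bsub>A_prod\<^esub> prefixes x) n) - 0) < r"
      using r cnorm_A_seq_nonneg by (intro exI[of _ n0]) fastforce
  qed
  then have "A_null +>\<^bsub>A_prod\<^esub> z = to_lim x"
    using z px by (simp add: to_lim_def A_null.coset_eq_iff null_seqs_iff)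
  then show ?thesis using xl by blast
qed

lemma A_lim_carrier: "carrier A_lim = to_lim ` limit_seqs"
proof -
  have "carrier A_lim = norm_closure A_null.Q {to_lim x |x. x \<in> mat_seqs \<and> (\<exists>m. diag_ext m x = x)}"
    unfolding UN_limit_map[symmetric] by (simp add: A_lim_def inductive_limit_def Let_def)
  also have "\<dots> = to_lim ` limit_seqs"
  proof (intro equalityI subsetI)
    fix X assume X: "X \<in> norm_closure A_null.Q {to_lim x |x. x \<in> mat_seqs \<and> (\<exists>m. diag_ext m x = x)}"
    then obtain z where z: "z \<in> carrier A_prod" and Xz: "X = A_null +>\<^bsub>A_prod\<^esub> z"
      by (auto simp: norm_closure_def A_null.quot_carrier)
    show "X \<in> to_lim ` limit_seqs"
      using to_lim_of_approx[OF z norm_closure_approx[OF z]] X Xz by simp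
  qed (auto intro: to_lim_in_norm_closure)
  finally show ?thesis .
qed


section \<open>Representations and finite dimensional subalgebras\<close>

definition from_lim :: "(nat \<Rightarrow> complex mat list) set \<Rightarrow> nat \<Rightarrow> complex mat" where
  "from_lim = inv_into limit_seqs to_lim"

lemma from_lim_to_lim [simp]: "x \<in> limit_seqs \<Longrightarrow> from_lim (to_lim x) = x"
  unfolding from_lim_def by (rule inv_into_f_f) (auto intro: inj_onI to_lim_inj)

text \<open>The axioms are read off the coordinates: the norm is their supremum by
  \<open>cnorm_to_lim_le_iff\<close>, and completeness is \<open>limit_seqs_closed\<close>.\<close>

theorem cstar_algebra_A_lim: "cstar_algebra A_lim"
proof (rule cstar_algebra_subdirectI[where I = UNIV and A = "\<lambda>i. mat_cstar (block_size i)"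
      and p = "\<lambda>i X. from_lim X i"])
  show "\<zero>\<^bsub>A_lim\<^esub> \<in> carrier A_lim"
    by (auto simp: to_lim_zero A_lim_carrier zero_limit_seqs)
  show "from_lim \<zero>\<^bsub>A_lim\<^esub> i = \<zero>\<^bsub>mat_cstar (block_size i)\<^esub>" for i
    by (simp add: to_lim_zero zero_limit_seqs)
  fix X Y c assume "X \<in> carrier A_lim"
  then obtain x where x: "x \<in> limit_seqs" and X: "X = to_lim x" by (auto simp: A_lim_carrier)
  show "from_lim X i \<in> carrier (mat_cstar (block_size i))" for i
    using limit_seqsD[OF x] by (simp add: X x)
  show "c \<odot>\<^bsub>A_lim\<^esub> X \<in> carrier A_lim" "star A_lim X \<in> carrier A_lim"
    using x by (auto simp: X to_lim_smult to_lim_star A_lim_carrier limit_seqs_smult limit_seqs_adjoint)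
  show "from_lim (c \<odot>\<^bsub>A_lim\<^esub> X) i = c \<odot>\<^bsub>mat_cstar (block_size i)\<^esub> from_lim X i"
    "from_lim (star A_lim X) i = star (mat_cstar (block_size i)) (from_lim X i)" for i
    using x by (auto simp: X to_lim_smult to_lim_star limit_seqs_smult limit_seqs_adjoint)
  show "0 \<le> cnorm A_lim X" using x by (simp add: X cnorm_to_lim_nonneg)
  show "cnorm A_lim X \<le> r \<longleftrightarrow> (\<forall>i\<in>UNIV. cnorm (mat_cstar (block_size i)) (from_lim X i) \<le> r)"
    if "0 \<le> r" for r
    using x that by (simp add: X cnorm_to_lim_le_iff)
  assume "Y \<in> carrier A_lim"
  then obtain y where y: "y \<in> limit_seqs" and Y: "Y = to_lim y" by (auto simp: A_lim_carrier)
  show "X \<oplus>\<^bsub>A_lim\<^esub> Y \<in> carrier A_lim" "X \<otimes>\<^bsub>A_lim\<^esub> Y \<in> carrier A_lim"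
    using x y by (auto simp: X Y to_lim_add to_lim_mult A_lim_carrier limit_seqs_add limit_seqs_mult)
  show "from_lim (X \<oplus>\<^bsub>A_lim\<^esub> Y) i = from_lim X i \<oplus>\<^bsub>mat_cstar (block_size i)\<^esub> from_lim Y i"
    "from_lim (X \<otimes>\<^bsub>A_lim\<^esub> Y) i = from_lim X i \<otimes>\<^bsub>mat_cstar (block_size i)\<^esub> from_lim Y i" for i
    using x y by (auto simp: X Y to_lim_add to_lim_mult limit_seqs_add limit_seqs_mult)
  show "X = Y" if "\<And>i. i \<in> UNIV \<Longrightarrow> from_lim X i = from_lim Y i"
  proof -
    have "from_lim X = from_lim Y" using that by (simp add: fun_eq_iff)
    then show ?thesis using x y by (simp add: X Y)
  qed
next
  fix s :: "nat \<Rightarrow> (nat \<Rightarrow> complex mat list) set" and y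
  assume s: "\<And>n. s n \<in> carrier A_lim"
    and y: "\<And>i. i \<in> UNIV \<Longrightarrow> y i \<in> carrier (mat_cstar (block_size i))"
    and lim: "\<And>e. 0 < e \<Longrightarrow> \<exists>N. \<forall>n\<ge>N. \<forall>i\<in>UNIV.
      cnorm (mat_cstar (block_size i)) (from_lim (s n) i \<ominus>\<^bsub>mat_cstar (block_size i)\<^esub> y i) \<le> e"
  have "from_lim (s n) \<in> limit_seqs" for n using s[of n] by (auto simp: A_lim_carrier)
  moreover have "\<exists>N. \<forall>n\<ge>N. \<forall>i. mat_opnorm (from_lim (s n) i - y i) \<le> e" if "0 < e" for e
    using lim[OF that] y by (simp add: mat_cstar_minus)
  ultimately have "\<exists>z\<in>limit_seqs. \<forall>i. mat_opnorm (z i - y i) \<le> e" if "0 < e" for e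
    using that by (meson order.refl)
  then have "y \<in> limit_seqs"
    using y by (intro limit_seqs_closed) (simp_all add: mat_seqs_def)
  then show "\<exists>X\<in>carrier A_lim. \<forall>i\<in>UNIV. from_lim X i = y i"
    by (intro bexI[of _ "to_lim y"]) (auto simp: A_lim_carrier)
qed (rule cstar_algebra_mat_cstar)

interpretation A_lim: cstar_algebra A_lim by (rule cstar_algebra_A_lim)

lemma unital_A_lim: "unital A_lim"
proof -
  have "\<one>\<^bsub>A_lim\<^esub> \<otimes>\<^bsub>A_lim\<^esub> to_lim x = to_lim x" "to_lim x \<otimes>\<^bsub>A_lim\<^esub> \<one>\<^bsub>A_lim\<^esub> = to_lim x"
    if x: "x \<in> limit_seqs" for x
    using left_mult_one_mat[OF limit_seqsD[OF x]] right_mult_one_mat[OF limit_seqsD[OF x]]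
    by (simp_all add: to_lim_one to_lim_mult one_limit_seqs x)
  then show ?thesis
    by (auto simp: unital_def A_lim_carrier) (auto simp: to_lim_one one_limit_seqs)
qed

lemma to_lim_minus:
  "\<lbrakk>x \<in> limit_seqs; y \<in> limit_seqs\<rbrakk> \<Longrightarrow> to_lim x \<ominus>\<^bsub>A_lim\<^esub> to_lim y = to_lim (\<lambda>i. x i - y i)"
  by (subst minus_eq_add_smult[OF A_lim.vectorspace])
    (auto simp: A_lim_carrier to_lim_smult to_lim_add limit_seqs_smult mat_minus_eq[OF limit_seqsD limit_seqsD])

theorem residually_finite_dimensional_A_lim: "residually_finite_dimensional A_lim"
  unfolding residually_finite_dimensional_def
proof (intro exI[of _ "range (\<lambda>i. (block_size i, \<lambda>X. from_lim X i))"] conjI)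
  have "(\<lambda>X. from_lim X i) \<in> star_hom A_lim (mat_cstar (block_size i))" for i
    using limit_seqsD
    by (auto simp: star_hom_def LinearCombinations.module_hom_def A_lim_carrier to_lim_add to_lim_mult
        to_lim_smult to_lim_star limit_seqs_add limit_seqs_mult limit_seqs_smult limit_seqs_adjoint)
  then show "\<forall>(d, \<pi>)\<in>range (\<lambda>i. (block_size i, \<lambda>X. from_lim X i)). \<pi> \<in> star_hom A_lim (mat_cstar d)"
    by auto
  have "\<exists>i. x i \<noteq> 0\<^sub>m (block_size i) (block_size i)" if "to_lim x \<noteq> \<zero>\<^bsub>A_lim\<^esub>" for x
  proof (rule ccontr)
    assume "\<not> ?thesis"
    then have "x = (\<lambda>i. 0\<^sub>m (block_size i) (block_size i))" by blast
    then show False using that by (simp add: to_lim_zero)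
  qed
  then show "\<forall>X\<in>carrier A_lim. X \<noteq> \<zero>\<^bsub>A_lim\<^esub> \<longrightarrow>
      (\<exists>(d, \<pi>)\<in>range (\<lambda>i. (block_size i, \<lambda>X. from_lim X i)). \<pi> X \<noteq> 0\<^sub>m d d)"
    by (force simp: A_lim_carrier)
qed

text \<open>All matrix entries are numbered by a pairing function and read from a single vector. The
  length d is any bound on the codes, in general larger than the dimension; components that code no
  entry are ignored, so the map is onto but usually not injective.\<close>

lemma finite_dimensional_A_seq: "finite_dimensional (A_seq n)"
proof -
  define enc where "enc = (\<lambda>(i, p, q). prod_encode (i, prod_encode (p, q)))"
  let ?J = "SIGMA i:{..<n}. {..<block_size i} \<times> {..<block_size i}"
  obtain d where d: "\<And>t. t \<in> enc ` ?J \<Longrightarrow> t < d"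
    using finite_nat_set_iff_bounded[of "enc ` ?J"] by auto
  let ?f = "\<lambda>v :: complex vec. map (\<lambda>i. mat (block_size i) (block_size i) (\<lambda>(p, q). v $ enc (i, p, q))) [0..<n]"
  let ?V = "module_vec TYPE(complex) d"
  have mem: "enc (i, p, q) < d" if "i < n" "p < block_size i" "q < block_size i" for i p q
    using that by (intro d) auto
  have surj: "?f ` carrier ?V = carrier (A_seq n)"
  proof (intro equalityI subsetI)
    fix xs assume xs: "xs \<in> carrier (A_seq n)"
    let ?v = "vec d (\<lambda>t. let (i, u) = prod_decode t; (p, q) = prod_decode u in xs ! i $$ (p, q))"
    have "?f ?v = xs"
      using xs mem by (auto simp: A_seq_carrier_iff enc_def intro!: nth_equalityI eq_matI)
    then show "xs \<in> ?f ` carrier ?V" by (intro image_eqI[of _ _ ?v]) (auto simp: module_vec_simps)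
  qed (auto simp: A_seq_carrier_iff)
  have hom: "?f \<in> module_hom class_ring ?V (A_seq n)"
    using mem surj
    by (auto simp: LinearCombinations.module_hom_def module_vec_simps A_seq_simps intro!: eq_matI)
  have "vectorspace class_ring (A_seq n)"
    using cstar_algebra_A_seq by (rule cstar_algebra.vectorspace)
  then show ?thesis
    unfolding finite_dimensional_def
    by (rule fin_dim_image[OF vec_vs _ hom surj]) (rule vec_space.fin_dim)
qed

text \<open>Padding by zero makes the argument a member of \<open>mat_seqs\<close>, as the algebraic
  rules for \<open>diag_ext\<close> require, whereas \<open>a ! i\<close> is unspecified for i > m.
  The extension from m discards the padding again.\<close>

definition lift_seq :: "nat \<Rightarrow> complex mat list \<Rightarrow> nat \<Rightarrow> complex mat" where
  "lift_seq m a = diag_ext m (\<lambda>i. if i \<le> m then a ! i else 0\<^sub>m (block_size i) (block_size i))"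

lemma lift_seq_pad_mat_seqs:
  "a \<in> carrier (A_seq (Suc m)) \<Longrightarrow>
    (\<lambda>i. if i \<le> m then a ! i else 0\<^sub>m (block_size i) (block_size i)) \<in> mat_seqs"
  by (auto simp: mat_seqs_def A_seq_carrier_iff)

lemma lift_seq_in:
  assumes "a \<in> carrier (A_seq (Suc m))"
  shows "lift_seq m a \<in> limit_seqs" "lift_seq m a \<in> mat_seqs" "diag_ext m (lift_seq m a) = lift_seq m a"
  using diag_ext_limit_seqs[OF lift_seq_pad_mat_seqs[OF assms]]
  by (auto simp: lift_seq_def diag_ext_diag_ext limit_seqs_mat_seqs)

lemma lift_seq_prefixes: "lift_seq m (prefixes x m) = diag_ext m x"
  unfolding lift_seq_def by (rule diag_ext_cong) simp

lemma lift_seq_add: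
  assumes "a \<in> carrier (A_seq (Suc m))" "b \<in> carrier (A_seq (Suc m))"
  shows "lift_seq m (a \<oplus>\<^bsub>A_seq (Suc m)\<^esub> b) = (\<lambda>i. lift_seq m a i + lift_seq m b i)"
  unfolding lift_seq_def diag_ext_add[OF lift_seq_pad_mat_seqs[OF assms(1)] lift_seq_pad_mat_seqs[OF assms(2)], symmetric]
  by (rule diag_ext_cong) (simp add: A_seq_simps del: upt_Suc)

lemma lift_seq_smult:
  assumes "a \<in> carrier (A_seq (Suc m))"
  shows "lift_seq m (c \<odot>\<^bsub>A_seq (Suc m)\<^esub> a) = (\<lambda>i. c \<cdot>\<^sub>m lift_seq m a i)"
  unfolding lift_seq_def diag_ext_smult[OF lift_seq_pad_mat_seqs[OF assms], symmetric]
  by (rule diag_ext_cong) (simp add: A_seq_simps del: upt_Suc)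

lemma lift_seq_zero:
  "lift_seq m \<zero>\<^bsub>A_seq (Suc m)\<^esub> = (\<lambda>i. 0\<^sub>m (block_size i) (block_size i))"
proof -
  have "lift_seq m \<zero>\<^bsub>A_seq (Suc m)\<^esub> = diag_ext m (\<lambda>i. 0\<^sub>m (block_size i) (block_size i))"
    unfolding lift_seq_def by (rule diag_ext_cong) (simp add: A_seq_simps del: upt_Suc)
  then show ?thesis by (simp only: diag_ext_zero)
qed

text \<open>The image of A_(n+1) in the limit. Described by a fixed point condition, it is visibly
  increasing in n and closed under the operations.\<close>

definition stage :: "nat \<Rightarrow> (nat \<Rightarrow> complex mat list) set set" where
  "stage n = to_lim ` {x \<in> mat_seqs. diag_ext n x = x}"

lemma stage_eq: "stage n = (\<lambda>a. to_lim (lift_seq n a)) ` carrier (A_seq (Suc n))"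
proof (intro equalityI subsetI)
  fix X assume "X \<in> stage n"
  then obtain x where x: "x \<in> mat_seqs" "diag_ext n x = x" "X = to_lim x" by (auto simp: stage_def)
  then show "X \<in> (\<lambda>a. to_lim (lift_seq n a)) ` carrier (A_seq (Suc n))"
    using prefixes_in_A_seq[of x n] lift_seq_prefixes[of n x] by (intro image_eqI[of _ _ "prefixes x n"]) auto
qed (auto simp: stage_def lift_seq_in)

lemma finite_dimensional_stage: "finite_dimensional (A_lim\<lparr>carrier := stage n\<rparr>)"
proof -
  let ?f = "\<lambda>a. to_lim (lift_seq n a)" and ?W = "A_lim\<lparr>carrier := stage n\<rparr>"
  have vs: "vectorspace class_ring (A_seq (Suc n))"
    using cstar_algebra_A_seq by (simp add: cstar_algebra_def)
  have surj: "?f ` carrier (A_seq (Suc n)) = carrier ?W" by (simp add: stage_eq)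
  have lin: "?f (a \<oplus>\<^bsub>A_seq (Suc n)\<^esub> b) = ?f a \<oplus>\<^bsub>?W\<^esub> ?f b"
    "?f (c \<odot>\<^bsub>A_seq (Suc n)\<^esub> a) = c \<odot>\<^bsub>?W\<^esub> ?f a"
    if "a \<in> carrier (A_seq (Suc n))" "b \<in> carrier (A_seq (Suc n))" for a b c
    using that by (simp_all add: lift_seq_add lift_seq_smult to_lim_add to_lim_smult lift_seq_in)
  have "vectorspace class_ring ?W"
    by (rule vectorspace_image[OF vs surj]) (use lin in \<open>auto simp: lift_seq_zero to_lim_zero\<close>)
  moreover have "?f \<in> module_hom class_ring (A_seq (Suc n)) ?W"
    using lin surj by (auto simp: LinearCombinations.module_hom_def)
  ultimately show ?thesis
    using fin_dim_image[OF vs _ _ surj] finite_dimensional_A_seq by (auto simp: finite_dimensional_def)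
qed

lemma sub_cstar_stage: "sub_cstar (stage n) A_lim"
  unfolding sub_cstar_def
proof (intro conjI ballI submodule.intro)
  note ops = diag_ext_add diag_ext_mult diag_ext_smult diag_ext_adjoint
  have lim: "x \<in> limit_seqs" if "x \<in> mat_seqs" "diag_ext n x = x" for x
    using that by (rule diag_ext_fixed_limit_seqs)
  show "Module.module class_ring A_lim" ..
  show "stage n \<subseteq> carrier A_lim" using lim by (auto simp: stage_def A_lim_carrier)
  have "(\<lambda>i. 0\<^sub>m (block_size i) (block_size i)) \<in> mat_seqs" by (simp add: mat_seqs_def)
  then show "\<zero>\<^bsub>A_lim\<^esub> \<in> stage n" by (auto simp: stage_def to_lim_zero diag_ext_zero)
  fix X Y c assume "X \<in> stage n"
  then obtain x where x: "x \<in> mat_seqs" "diag_ext n x = x" and X: "X = to_lim x" by (auto simp: stage_def)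
  note xl = lim[OF x]
  show "c \<odot>\<^bsub>A_lim\<^esub> X \<in> stage n"
    using x xl by (auto simp: X stage_def to_lim_smult ops mat_seqs_def)
  have "(\<lambda>i. mat_adjoint (x i)) \<in> mat_seqs" using x by (auto simp: mat_seqs_def)
  then show "star A_lim X \<in> stage n"
    using x xl by (auto simp: X stage_def to_lim_star ops)
  assume "Y \<in> stage n"
  then obtain y where y: "y \<in> mat_seqs" "diag_ext n y = y" and Y: "Y = to_lim y" by (auto simp: stage_def)
  note yl = lim[OF y]
  show "X \<oplus>\<^bsub>A_lim\<^esub> Y \<in> stage n" "X \<otimes>\<^bsub>A_lim\<^esub> Y \<in> stage n"
    using x y limit_seqs_mat_seqs[OF limit_seqs_add[OF xl yl]] limit_seqs_mat_seqs[OF limit_seqs_mult[OF xl yl]]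
    by (auto simp: X Y stage_def to_lim_add to_lim_mult xl yl ops intro!: imageI)
next
  show "norm_closure A_lim (stage n) \<subseteq> stage n"
  proof
    fix X assume X: "X \<in> norm_closure A_lim (stage n)"
    then obtain x where x: "x \<in> limit_seqs" and Xx: "X = to_lim x"
      by (auto simp: norm_closure_def A_lim_carrier)
    \<comment> \<open>If y is in the stage and within e/2 of x, then the extension of x is within
      e/2 of y as well, since extension is contractive and fixes y. Hence x is at distance at most e
      from its own extension.\<close>
    have "mat_opnorm (x i - diag_ext n x i) \<le> 0" for i
    proof (rule field_le_epsilon)
      fix e :: real assume e: "0 < e"
      then have "\<exists>Y\<in>stage n. cnorm A_lim (X \<ominus>\<^bsub>A_lim\<^esub> Y) < e / 2"
        using X half_gt_zero[OF e] unfolding norm_closure_def by blast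
      then obtain y where y: "y \<in> mat_seqs" "diag_ext n y = y" "cnorm A_lim (X \<ominus>\<^bsub>A_lim\<^esub> to_lim y) < e / 2"
        by (auto simp: stage_def)
      have yl: "y \<in> limit_seqs" using y by (intro diag_ext_fixed_limit_seqs)
      have "cnorm A_lim (to_lim (\<lambda>i. x i - y i)) \<le> e / 2"
        using y(3) by (simp add: Xx to_lim_minus x yl)
      then have le: "mat_opnorm (x i - y i) \<le> e / 2" for i
        using cnorm_to_lim_le_iff[OF limit_seqs_minus[OF x yl], of "e / 2"] e by simp
      then have "mat_opnorm (diag_ext n (\<lambda>i. x i - y i) i) \<le> e / 2"
        by (intro mat_opnorm_diag_ext_le limit_seqs_mat_seqs[OF limit_seqs_minus[OF x yl]])
      then have le': "mat_opnorm (diag_ext n x i - y i) \<le> e / 2"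
        using y by (simp add: diag_ext_minus limit_seqs_mat_seqs x)
      note c = limit_seqsD[OF x, of i] mat_seqsD[OF y(1), of i]
        diag_ext_mat_seqs[OF limit_seqs_mat_seqs[OF x], THEN mat_seqsD, of n i]
      show "mat_opnorm (x i - diag_ext n x i) \<le> 0 + e"
        using mat_opnorm_diff_triangle[OF c] mat_opnorm_minus_commute[OF c(2,3)] le[of i] le'
        by linarith
    qed
    then have 0: "mat_opnorm (x i - diag_ext n x i) = 0" for i by (simp add: antisym)
    have "x i = diag_ext n x i" for i
    proof -
      note c = limit_seqsD[OF x, of i] diag_ext_mat_seqs[OF limit_seqs_mat_seqs[OF x], THEN mat_seqsD, of n i]
      have "x i - diag_ext n x i = 0\<^sub>m (block_size i) (block_size i)"
        using c 0 by (intro mat_opnorm_eq_zero) auto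
      then show ?thesis
        using c cstar_algebra.minus_zero_iff[OF cstar_algebra_mat_cstar, of "x i" "block_size i" "diag_ext n x i"]
        by (simp add: mat_cstar_minus)
    qed
    then have "diag_ext n x = x" by auto
    then show "X \<in> stage n" using limit_seqs_mat_seqs[OF x] by (auto simp: Xx stage_def)
  qed
qed

theorem AF_algebra_A_lim: "AF_algebra A_lim"
  unfolding AF_algebra_def
proof (intro exI[of _ stage] conjI allI)
  show "stage n \<subseteq> stage (Suc n)" for n
  proof -
    have "diag_ext (Suc n) x = x" if "diag_ext n x = x" for x
      using diag_ext_diag_ext[of n "Suc n" x] that by simp
    then show ?thesis by (auto simp: stage_def)
  qed
  have sub: "stage n \<subseteq> carrier A_lim" for n
    using diag_ext_fixed_limit_seqs by (auto simp: stage_def A_lim_carrier)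
  show "norm_closure A_lim (\<Union>n. stage n) = carrier A_lim"
  proof
    show "carrier A_lim \<subseteq> norm_closure A_lim (\<Union>n. stage n)"
    proof
      fix X assume XA: "X \<in> carrier A_lim"
      then obtain x where x: "x \<in> limit_seqs" and X: "X = to_lim x" by (auto simp: A_lim_carrier)
      have "\<exists>Y\<in>\<Union>n. stage n. cnorm A_lim (X \<ominus>\<^bsub>A_lim\<^esub> Y) < e" if e: "0 < e" for e
      proof -
        obtain n where n: "\<And>i. mat_opnorm (x i - diag_ext n x i) \<le> e / 2"
          using limit_seqs_eventually[OF x, of "e / 2"] e by (auto simp: eventually_sequentially)
        have y: "diag_ext n x \<in> limit_seqs" by (rule diag_ext_limit_seqs[OF limit_seqs_mat_seqs[OF x]])
        have "cnorm A_lim (X \<ominus>\<^bsub>A_lim\<^esub> to_lim (diag_ext n x)) \<le> e / 2"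
          unfolding X to_lim_minus[OF x y] using n e by (subst cnorm_to_lim_le_iff) (auto simp: limit_seqs_minus x y)
        moreover have "to_lim (diag_ext n x) \<in> stage n"
          using limit_seqs_mat_seqs[OF y] by (auto simp: stage_def diag_ext_diag_ext)
        ultimately show ?thesis using e by (intro bexI[of _ "to_lim (diag_ext n x)"]) auto
      qed
      then show "X \<in> norm_closure A_lim (\<Union>n. stage n)" using XA by (simp add: norm_closure_def)
    qed
  qed (auto simp: norm_closure_def)
qed (rule sub_cstar_stage finite_dimensional_stage)+

text \<open>The first d + 1 coordinates of a limit sequence can be prescribed freely, and every
  block is nonempty. Reading off their upper left entries maps \<open>A_lim\<close> onto a space of
  dimension d + 1, which rank-nullity forbids when d is the dimension of
  \<open>A_lim\<close>.\<close>

theorem not_finite_dimensional_A_lim: "\<not> finite_dimensional A_lim"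
proof
  assume fd: "finite_dimensional A_lim"
  define d where "d = A_lim.dim"
  let ?V = "module_vec TYPE(complex) (Suc d)"
  let ?f = "\<lambda>X. vec (Suc d) (\<lambda>i. from_lim X i $$ (0, 0))"
  have hom: "?f \<in> module_hom class_ring A_lim ?V"
  proof -
    have [simp]: "dim_row (x i) = block_size i" "dim_col (x i) = block_size i" if "x \<in> limit_seqs" for x i
      using limit_seqsD[OF that, of i] by auto
    show ?thesis
      by (auto simp: LinearCombinations.module_hom_def A_lim_carrier module_vec_simps to_lim_add to_lim_smult
        limit_seqs_add limit_seqs_smult intro!: eq_vecI)
  qed
  have surj: "?f ` carrier A_lim = carrier ?V"
  proof (intro equalityI subsetI)
    fix v assume "v \<in> carrier ?V"
    then have v: "v \<in> carrier_vec (Suc d)" by (simp add: module_vec_simps)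
    let ?x = "diag_ext d (\<lambda>i. mat (block_size i) (block_size i) (\<lambda>_. v $ i))"
    have x: "?x \<in> limit_seqs" by (rule diag_ext_limit_seqs) (simp add: mat_seqs_def)
    have "?f (to_lim ?x) = v" using v by (intro eq_vecI) (auto simp: x less_Suc_eq_le)
    then show "v \<in> ?f ` carrier A_lim" using x by (intro image_eqI[of _ _ "to_lim ?x"]) (auto simp: A_lim_carrier)
  qed (auto simp: module_vec_simps)
  have "vectorspace class_ring ?V" by (rule vec_vs)
  then interpret f: linear_map class_ring A_lim ?V ?f
    using hom A_lim.vectorspace
    by (simp add: linear_map_def mod_hom_def mod_hom_axioms_def vectorspace_def)
  have "vectorspace.dim class_ring (?V\<lparr>carrier := f.imT\<rparr>) \<le> d"
    using f.rank_nullity_main(1) fd by (simp add: finite_dimensional_def d_def)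
  moreover have "?V\<lparr>carrier := f.imT\<rparr> = ?V" using f.surj_imp_imT_carrier[OF surj] by simp
  ultimately show False using vec_space.dim_is_n[where ?'a = complex, of "Suc d"] by simp
qed


section \<open>Ideals of the limit algebra\<close>

definition mat_unit :: "nat \<Rightarrow> nat \<Rightarrow> nat \<Rightarrow> complex mat" where
  "mat_unit k p q = mat k k (\<lambda>(i, j). if i = p \<and> j = q then 1 else 0)"

lemma mat_unit_carrier [simp]: "mat_unit k p q \<in> carrier_mat k k"
  by (simp add: mat_unit_def)

lemma mat_unit_mult:
  assumes a: "a \<in> carrier_mat k k" and "q < k" "r < k"
  shows "mat_unit k p q * a * mat_unit k r s = (a $$ (q, r)) \<cdot>\<^sub>m mat_unit k p s"
proof (rule eq_matI)
  fix i j assume "i < dim_row (a $$ (q, r) \<cdot>\<^sub>m mat_unit k p s)" "j < dim_col (a $$ (q, r) \<cdot>\<^sub>m mat_unit k p s)"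
  then have ij: "i < k" "j < k" by (auto simp: mat_unit_def)
  have l: "(mat_unit k p q * a) $$ (i, t) = (if i = p then a $$ (q, t) else 0)" if "t < k" for t
  proof -
    have "(mat_unit k p q * a) $$ (i, t) = (\<Sum>u<k. mat_unit k p q $$ (i, u) * a $$ (u, t))"
      using a ij that by (simp add: scalar_prod_def atLeast0LessThan mat_unit_def)
    also have "\<dots> = (\<Sum>u<k. if u = q then (if i = p then a $$ (u, t) else 0) else 0)"
      using ij by (intro sum.cong) (auto simp: mat_unit_def)
    finally show ?thesis using assms by simp
  qed
  have "(mat_unit k p q * a * mat_unit k r s) $$ (i, j)
      = (\<Sum>t<k. (mat_unit k p q * a) $$ (i, t) * mat_unit k r s $$ (t, j))"
    using a ij by (simp add: scalar_prod_def atLeast0LessThan mat_unit_def)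
  also have "\<dots> = (\<Sum>t<k. if t = r then (if i = p \<and> j = s then a $$ (q, t) else 0) else 0)"
    using ij l by (intro sum.cong) (auto simp: mat_unit_def)
  also have "\<dots> = (a $$ (q, r) \<cdot>\<^sub>m mat_unit k p s) $$ (i, j)"
    using assms ij by (simp add: mat_unit_def)
  finally show "(mat_unit k p q * a * mat_unit k r s) $$ (i, j) = (a $$ (q, r) \<cdot>\<^sub>m mat_unit k p s) $$ (i, j)" .
qed (use a in \<open>auto simp: mat_unit_def\<close>)

lemma mat_unit_idem:
  assumes "p < k"
  shows "mat_unit k p p * mat_unit k p p = mat_unit k p p"
proof -
  have "mat_unit k p p * 1\<^sub>m k * mat_unit k p p = 1 \<cdot>\<^sub>m mat_unit k p p"
    using assms by (simp add: mat_unit_mult[OF one_carrier_mat])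
  moreover have "1 \<cdot>\<^sub>m mat_unit k p p = mat_unit k p p" by (intro eq_matI) auto
  ultimately show ?thesis by (simp add: right_mult_one_mat[OF mat_unit_carrier])
qed

lemma mat_opnorm_mat_unit_le: "mat_opnorm (mat_unit k p q) \<le> 1"
proof (cases "p < k \<and> q < k")
  case True
  have "(\<Sum>i<k. \<Sum>j<k. cmod (mat_unit k p q $$ (i, j))) = (\<Sum>i<k. if i = p then 1 else 0)"
  proof (intro sum.cong refl)
    fix i assume "i \<in> {..<k}"
    then have "(\<Sum>j<k. cmod (mat_unit k p q $$ (i, j))) = (\<Sum>j<k. if j = q then (if i = p then 1 else 0) else 0)"
      by (intro sum.cong) (auto simp: mat_unit_def)
    then show "(\<Sum>j<k. cmod (mat_unit k p q $$ (i, j))) = (if i = p then 1 else 0)" using True by simp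
  qed
  then show ?thesis
    using mat_opnorm_le_sum[of "mat_unit k p q"] True by (simp add: carrier_matD[OF mat_unit_carrier])
next
  case False
  then have "mat_unit k p q = 0\<^sub>m k k" by (intro eq_matI) (auto simp: mat_unit_def)
  then show ?thesis by simp
qed

text \<open>Matrix units move a nonzero entry of h to each diagonal position; after division by this
  entry the diagonal units lie in S, and their sum is the identity.\<close>

lemma mat_ideal_eq_carrier:
  fixes S :: "complex mat set"
  assumes sub: "S \<subseteq> carrier_mat k k" and zero: "0\<^sub>m k k \<in> S"
    and add: "\<And>a b. \<lbrakk>a \<in> S; b \<in> S\<rbrakk> \<Longrightarrow> a + b \<in> S"
    and left: "\<And>a b. \<lbrakk>a \<in> carrier_mat k k; b \<in> S\<rbrakk> \<Longrightarrow> a * b \<in> S"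
    and right: "\<And>a b. \<lbrakk>a \<in> S; b \<in> carrier_mat k k\<rbrakk> \<Longrightarrow> a * b \<in> S"
    and h: "h \<in> S" "h \<noteq> 0\<^sub>m k k"
  shows "S = carrier_mat k k"
proof -
  have hc: "h \<in> carrier_mat k k" using h sub by auto
  then obtain p q where pq: "p < k" "q < k" "h $$ (p, q) \<noteq> 0"
    using h(2) by (metis carrier_matD eq_matI index_zero_mat)
  have E: "mat_unit k t t \<in> S" if "t < k" for t
  proof -
    \<comment> \<open>The scalar is absorbed into the left factor, because S is only known to be
      closed under sums and under multiplication by matrices.\<close>
    let ?c = "1 / h $$ (p, q)"
    have "(?c \<cdot>\<^sub>m mat_unit k t p) * h * mat_unit k q t = ?c \<cdot>\<^sub>m (mat_unit k t p * h * mat_unit k q t)"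
      using mult_smult_assoc_mat[OF mat_unit_carrier hc]
        mult_smult_assoc_mat[OF mult_carrier_mat[OF mat_unit_carrier hc] mat_unit_carrier] by simp
    also have "\<dots> = ?c \<cdot>\<^sub>m (h $$ (p, q) \<cdot>\<^sub>m mat_unit k t t)"
      by (simp only: mat_unit_mult[OF hc pq(1,2)])
    also have "\<dots> = mat_unit k t t" using pq by (intro eq_matI) auto
    finally show ?thesis using left[OF _ h(1), of "?c \<cdot>\<^sub>m mat_unit k t p"] right by (metis mat_unit_carrier smult_carrier_mat)
  qed
  have "mat k k (\<lambda>(i, j). if i = j \<and> i < t then 1 else 0) \<in> S" if "t \<le> k" for t
    using that
  proof (induction t)
    case 0
    have eq: "mat k k (\<lambda>(i, j). if i = j \<and> i < 0 then 1 else 0 :: complex) = 0\<^sub>m k k" by (intro eq_matI) auto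
    show ?case unfolding eq by (rule zero)
  next
    case (Suc t)
    have "mat k k (\<lambda>(i, j). if i = j \<and> i < Suc t then 1 else 0)
        = mat k k (\<lambda>(i, j). if i = j \<and> i < t then 1 else 0) + mat_unit k t t"
      by (intro eq_matI) (auto simp: mat_unit_def)
    then show ?case using Suc E[of t] add by simp
  qed
  from this[of k] have "mat k k (\<lambda>(i, j). if i = j \<and> i < k then 1 else 0) \<in> S" by simp
  moreover have "mat k k (\<lambda>(i, j). if i = j \<and> i < k then 1 else 0) = (1\<^sub>m k :: complex mat)"
    by (intro eq_matI) auto
  ultimately have one: "1\<^sub>m k \<in> S" by simp
  have "b \<in> S" if b: "b \<in> carrier_mat k k" for b
    using right[OF one b] left_mult_one_mat[OF b] by simp
  then show ?thesis using sub by blast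
qed

lemma mat_neq_zero_iff_elements:
  assumes "a \<in> carrier_mat k k"
  shows "a \<noteq> 0\<^sub>m k k \<longleftrightarrow> (\<exists>c\<in>elements_mat a. c \<noteq> 0)"
proof
  assume "a \<noteq> 0\<^sub>m k k"
  then obtain i j where "i < k" "j < k" "a $$ (i, j) \<noteq> 0"
    using assms by (metis carrier_matD eq_matI index_zero_mat)
  then show "\<exists>c\<in>elements_mat a. c \<noteq> 0" using assms by blast
next
  assume "\<exists>c\<in>elements_mat a. c \<noteq> 0"
  then obtain i j where "i < dim_row a" "j < dim_col a" "a $$ (i, j) \<noteq> 0" by blast
  then show "a \<noteq> 0\<^sub>m k k" using assms by auto
qed

text \<open>This is where the shape of the connecting maps enters the ideal theory: beyond its
  stage, each coordinate contains all earlier ones as diagonal blocks, so no nonzero entry is ever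
  lost.\<close>

lemma elements_diag_ext_subset:
  assumes "diag_ext n x = x" "j \<le> n" "n < i"
  shows "elements_mat (x j) \<subseteq> elements_mat (x i)"
proof -
  have "x i = diag_block_mat (map x [0..<i])" using diag_ext_gt[OF assms(3), of x] assms(1) by simp
  then show ?thesis
    using elements_mat_subset_diag_block_mat[of "x j" "map x [0..<i]"] assms(2,3) by simp
qed

text \<open>The element of A_(m+1) supported in its last summand, carried into the limit. It
  vanishes before coordinate m, while its later coordinates contain copies of b.\<close>

definition last_block :: "nat \<Rightarrow> complex mat \<Rightarrow> nat \<Rightarrow> complex mat" where
  "last_block m b = diag_ext m (\<lambda>i. if i = m then b else 0\<^sub>m (block_size i) (block_size i))"

lemma last_block_pad_mat_seqs:
  "b \<in> carrier_mat (block_size m) (block_size m) \<Longrightarrow>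
    (\<lambda>i. if i = m then b else 0\<^sub>m (block_size i) (block_size i)) \<in> mat_seqs"
  by (simp add: mat_seqs_def)

lemma last_block_limit_seqs:
  "b \<in> carrier_mat (block_size m) (block_size m) \<Longrightarrow> last_block m b \<in> limit_seqs"
  unfolding last_block_def by (intro diag_ext_limit_seqs last_block_pad_mat_seqs)

lemma last_block_fixed: "diag_ext m (last_block m b) = last_block m b"
  by (simp add: last_block_def diag_ext_diag_ext)

lemma last_block_nth [simp]: "last_block m b m = b"
  by (simp add: last_block_def)

lemma last_block_less: "i < m \<Longrightarrow> last_block m b i = 0\<^sub>m (block_size i) (block_size i)"
  by (simp add: last_block_def)

text \<open>Reduces identities between sequences from stage m to the finitely many coordinates up to
  m; all computations with \<open>last_block\<close> go through it.\<close>

lemma diag_ext_eqI: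
  assumes "diag_ext m x = x" "diag_ext m y = y" "\<And>i. i \<le> m \<Longrightarrow> x i = y i"
  shows "x = y"
  using diag_ext_cong[of m x y] assms by simp

lemma mat_opnorm_last_block_le:
  assumes "b \<in> carrier_mat (block_size m) (block_size m)" "mat_opnorm b \<le> r"
  shows "mat_opnorm (last_block m b i) \<le> r"
  unfolding last_block_def
  using assms order_trans[OF mat_opnorm_nonneg assms(2)]
  by (intro mat_opnorm_diag_ext_le last_block_pad_mat_seqs) auto

lemma last_block_add:
  assumes "b \<in> carrier_mat (block_size m) (block_size m)" "c \<in> carrier_mat (block_size m) (block_size m)"
  shows "last_block m (b + c) = (\<lambda>i. last_block m b i + last_block m c i)"
proof (rule diag_ext_eqI[of m])
  show "diag_ext m (\<lambda>i. last_block m b i + last_block m c i) = (\<lambda>i. last_block m b i + last_block m c i)"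
    using assms by (simp add: diag_ext_add limit_seqs_mat_seqs last_block_limit_seqs last_block_fixed)
  show "last_block m (b + c) i = last_block m b i + last_block m c i" if "i \<le> m" for i
    using that by (cases "i = m") (auto simp: last_block_less)
qed (rule last_block_fixed)

text \<open>The last summand is an ideal of A_(m+1): in the coordinates below m the product
  vanishes, and in coordinate m only \<open>x m\<close> acts. As x comes from stage m, the later
  coordinates follow.\<close>

lemma last_block_mult:
  assumes b: "b \<in> carrier_mat (block_size m) (block_size m)"
    and x: "x \<in> mat_seqs" "diag_ext m x = x"
  shows "last_block m (b * x m) = (\<lambda>i. last_block m b i * x i)"
    and "last_block m (x m * b) = (\<lambda>i. x i * last_block m b i)"
proof -
  note l = limit_seqs_mat_seqs[OF last_block_limit_seqs[OF b]]
  show "last_block m (b * x m) = (\<lambda>i. last_block m b i * x i)"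
  proof (rule diag_ext_eqI[of m])
    show "diag_ext m (\<lambda>i. last_block m b i * x i) = (\<lambda>i. last_block m b i * x i)"
      using x by (simp add: diag_ext_mult l last_block_fixed)
    show "last_block m (b * x m) i = last_block m b i * x i" if "i \<le> m" for i
      using that mat_seqsD[OF x(1), of i] by (cases "i = m") (auto simp: last_block_less)
  qed (rule last_block_fixed)
  show "last_block m (x m * b) = (\<lambda>i. x i * last_block m b i)"
  proof (rule diag_ext_eqI[of m])
    show "diag_ext m (\<lambda>i. x i * last_block m b i) = (\<lambda>i. x i * last_block m b i)"
      using x by (simp add: diag_ext_mult l last_block_fixed)
    show "last_block m (x m * b) i = x i * last_block m b i" if "i \<le> m" for i
      using that mat_seqsD[OF x(1), of i] by (cases "i = m") (auto simp: last_block_less)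
  qed (rule last_block_fixed)
qed

section \<open>Closed ideals, carried over to sequences of matrices\<close>

locale limit_seqs_ideal =
  fixes I
  assumes subset: "x \<in> I \<Longrightarrow> x \<in> limit_seqs"
    and zero_mem: "(\<lambda>i. 0\<^sub>m (block_size i) (block_size i)) \<in> I"
    and add_mem: "\<lbrakk>x \<in> I; y \<in> I\<rbrakk> \<Longrightarrow> (\<lambda>i. x i + y i) \<in> I"
    and smult_mem: "x \<in> I \<Longrightarrow> (\<lambda>i. c \<cdot>\<^sub>m x i) \<in> I"
    and mult_left_mem: "\<lbrakk>x \<in> limit_seqs; y \<in> I\<rbrakk> \<Longrightarrow> (\<lambda>i. x i * y i) \<in> I"
    and mult_right_mem: "\<lbrakk>x \<in> I; y \<in> limit_seqs\<rbrakk> \<Longrightarrow> (\<lambda>i. x i * y i) \<in> I"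
    and closed: "\<lbrakk>x \<in> limit_seqs; \<And>e. 0 < e \<Longrightarrow> \<exists>y\<in>I. \<forall>i. mat_opnorm (x i - y i) \<le> e\<rbrakk> \<Longrightarrow> x \<in> I"
begin

text \<open>An idempotent at distance less than one from an ideal has distance zero from it: if \<open>w\<close> and
  \<open>w'\<close> are in the ideal, then \<open>g - (g - w') (g - w)\<close> is in the ideal as well.\<close>

lemma idempotent_mem:
  assumes g: "g \<in> limit_seqs" and idem: "\<And>i. g i * g i = g i"
    and w: "w \<in> I" and r: "r < 1" "\<And>i. mat_opnorm (g i - w i) \<le> r"
  shows "g \<in> I"
proof (rule closed[OF g])
  fix e :: real assume e: "0 < e"
  have r0: "0 \<le> r" using order_trans[OF mat_opnorm_nonneg r(2)] .
  have "\<exists>y\<in>I. \<forall>i. mat_opnorm (g i - y i) \<le> r ^ Suc n" for n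
  proof (induction n)
    case 0
    then show ?case using w r by auto
  next
    case (Suc n)
    then obtain y where y: "y \<in> I" "\<And>i. mat_opnorm (g i - y i) \<le> r ^ Suc n" by blast
    \<comment> \<open>By idempotence this equals g - (g - y) (g - w); in the expanded form each
      summand has a factor in the ideal, w in the first and y in the second. Each round thus
      multiplies the distance by r.\<close>
    let ?z = "\<lambda>i. g i * w i + y i * (g i - w i)"
    have z: "?z \<in> I"
      by (intro add_mem mult_left_mem mult_right_mem g w y limit_seqs_minus subset)
    have "mat_opnorm (g i - ?z i) \<le> r ^ Suc (Suc n)" for i
    proof -
      let ?k = "block_size i"
      note c = limit_seqsD[OF g, of i] limit_seqsD[OF subset[OF w], of i] limit_seqsD[OF subset[OF y(1)], of i]
      have d: "g i - w i \<in> carrier_mat ?k ?k" "g i - y i \<in> carrier_mat ?k ?k"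
        using c by (auto intro: minus_carrier_mat)
      have "(g i - y i) * (g i - w i) = g i * (g i - w i) - y i * (g i - w i)"
        using c d by (intro minus_mult_distrib_mat) auto
      also have "g i * (g i - w i) = g i - g i * w i"
        using c by (simp add: mult_minus_distrib_mat[of _ ?k ?k _ ?k] idem)
      also have "g i - g i * w i - y i * (g i - w i) = g i - ?z i"
        using mult_carrier_mat[OF c(1,2)] mult_carrier_mat[OF c(3) d(1)] c(1) by (intro eq_matI) auto
      finally have "mat_opnorm (g i - ?z i) \<le> mat_opnorm (g i - y i) * mat_opnorm (g i - w i)"
        using mat_opnorm_mult_le[OF d(2,1)] by simp
      also have "\<dots> \<le> r ^ Suc n * r"
        using y(2) r r0 by (intro mult_mono) auto
      finally show ?thesis by (simp add: mult.commute)
    qed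
    then show ?case using z by (intro bexI[of _ ?z]) auto
  qed
  moreover obtain n where "r ^ n < e" using real_arch_pow_inv[OF e r(1)] by blast
  moreover have "r ^ Suc n \<le> r ^ n" using r0 r(1) by (intro power_decreasing) auto
  ultimately show "\<exists>y\<in>I. \<forall>i. mat_opnorm (g i - y i) \<le> e"
    by (meson less_imp_le order_trans)
qed

lemma exists_mat_unit_mem:
  assumes x: "x \<in> I" and nz: "x \<noteq> (\<lambda>i. 0\<^sub>m (block_size i) (block_size i))"
  shows "\<exists>m p. p < block_size m \<and> last_block m (mat_unit (block_size m) p p) \<in> I"
proof -
  note xl = subset[OF x]
  from nz obtain j where "x j \<noteq> 0\<^sub>m (block_size j) (block_size j)" by blast
  then obtain c where c: "c \<in> elements_mat (x j)" "c \<noteq> 0"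
    using mat_neq_zero_iff_elements[OF limit_seqsD[OF xl]] by blast
  \<comment> \<open>The condition \<open>j \<le> n\<close> ensures that the approximant keeps
    coordinate j unchanged. The tolerance is chosen so that the later division by c leaves distance
    1/2, which is less than one.\<close>
  have "\<forall>\<^sub>F n in sequentially. j \<le> n \<and> (\<forall>i. mat_opnorm (x i - diag_ext n x i) \<le> cmod c / 2)"
    using limit_seqs_eventually[OF xl, of "cmod c / 2"] eventually_ge_at_top[of j] c(2)
    by (auto intro: eventually_conj)
  then obtain n where n: "j \<le> n" "\<And>i. mat_opnorm (x i - diag_ext n x i) \<le> cmod c / 2"
    by (auto simp: eventually_sequentially)
  define a where "a = diag_ext n x"
  \<comment> \<open>The entry c may sit in any coordinate up to n; coordinate n + 1 is the first one
    that is certain to contain it, and it can be cut out there as a last summand.\<close>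
  define m where "m = Suc n"
  let ?k = "block_size m"
  have a: "diag_ext n a = a" "diag_ext m a = a" "a \<in> mat_seqs"
    by (auto simp: a_def m_def diag_ext_diag_ext diag_ext_mat_seqs limit_seqs_mat_seqs xl)
  have al: "a \<in> limit_seqs" by (rule diag_ext_fixed_limit_seqs[OF a(3,1)])
  have "c \<in> elements_mat (a m)"
    using elements_diag_ext_subset[OF a(1) n(1), of m] c(1) n(1) by (auto simp: m_def a_def)
  then obtain p q where pq: "p < ?k" "q < ?k" "a m $$ (p, q) = c"
    using mat_seqsD[OF a(3), of m] by auto
  \<comment> \<open>With p, q the position of c, multiplying by the unit at (p, p) on the left and
    by the unit at (q, p) on the right turns \<open>a m\<close> into c times the unit at (p, p). The
    same product with x in place of a lies in the ideal.\<close>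
  let ?u = "last_block m (mat_unit ?k p p)" and ?v = "last_block m (mat_unit ?k q p)"
  have ul: "?u \<in> limit_seqs" "?v \<in> limit_seqs" by (auto intro: last_block_limit_seqs)
  let ?w = "\<lambda>i. (1 / c) \<cdot>\<^sub>m (?u i * x i * ?v i)"
  have w: "?w \<in> I" by (intro smult_mem mult_right_mem mult_left_mem x ul)
  have uav: "(1 / c) \<cdot>\<^sub>m (?u i * a i * ?v i) = ?u i" for i
  proof -
    have "(\<lambda>i. ?u i * a i * ?v i) = (\<lambda>i. c \<cdot>\<^sub>m ?u i)"
    proof (rule diag_ext_eqI[of m])
      show "diag_ext m (\<lambda>i. ?u i * a i * ?v i) = (\<lambda>i. ?u i * a i * ?v i)"
        using a ul limit_seqs_mult[OF ul(1) al]
        by (simp add: diag_ext_mult limit_seqs_mat_seqs last_block_fixed)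
      show "diag_ext m (\<lambda>i. c \<cdot>\<^sub>m ?u i) = (\<lambda>i. c \<cdot>\<^sub>m ?u i)"
        using ul by (simp add: diag_ext_smult limit_seqs_mat_seqs last_block_fixed)
      show "?u i * a i * ?v i = c \<cdot>\<^sub>m ?u i" if "i \<le> m" for i
      proof (cases "i = m")
        case True
        then show ?thesis using mat_unit_mult[OF mat_seqsD[OF a(3)] pq(1,2), of p p] pq(3) by simp
      next
        case False
        then show ?thesis
          using that mat_seqsD[OF a(3), of i] by (auto simp: last_block_less intro!: eq_matI)
      qed
    qed
    then have "?u i * a i * ?v i = c \<cdot>\<^sub>m ?u i" by meson
    then show ?thesis using c(2) by (auto intro!: eq_matI)
  qed
  have "mat_opnorm (?u i - ?w i) \<le> 1 / 2" for i
  proof -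
    let ?k = "block_size i"
    note ci = limit_seqsD[OF ul(1), of i] limit_seqsD[OF ul(2), of i] limit_seqsD[OF xl, of i] mat_seqsD[OF a(3), of i]
    have d: "a i - x i \<in> carrier_mat ?k ?k" using ci by (auto intro: minus_carrier_mat)
    have "?u i - ?w i = (1 / c) \<cdot>\<^sub>m (?u i * a i * ?v i) - ?w i" by (simp only: uav)
    also have "\<dots> = (1 / c) \<cdot>\<^sub>m (?u i * a i * ?v i - ?u i * x i * ?v i)"
      using ci by (intro eq_matI) (auto simp: algebra_simps diff_divide_distrib)
    also have "?u i * a i * ?v i - ?u i * x i * ?v i = ?u i * (a i - x i) * ?v i"
      using ci d mult_carrier_mat[OF ci(1,4)] mult_carrier_mat[OF ci(1,3)]
      by (simp add: mult_minus_distrib_mat[of _ ?k ?k] minus_mult_distrib_mat[of _ ?k ?k])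
    finally have "mat_opnorm (?u i - ?w i) = mat_opnorm (?u i * (a i - x i) * ?v i) / cmod c"
      by (simp add: mat_opnorm_smult norm_divide)
    also have "mat_opnorm (?u i * (a i - x i) * ?v i) \<le> mat_opnorm (?u i * (a i - x i)) * mat_opnorm (?v i)"
      using ci d by (intro mat_opnorm_mult_le) auto
    also have "\<dots> \<le> mat_opnorm (?u i * (a i - x i)) * 1"
      by (intro mult_left_mono mat_opnorm_last_block_le mat_opnorm_mat_unit_le) auto
    also have "\<dots> \<le> mat_opnorm (?u i) * mat_opnorm (a i - x i)"
      using mat_opnorm_mult_le[OF ci(1) d] by simp
    also have "\<dots> \<le> 1 * mat_opnorm (a i - x i)"
      by (intro mult_right_mono mat_opnorm_last_block_le mat_opnorm_mat_unit_le) auto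
    also have "\<dots> \<le> cmod c / 2"
      using n(2)[of i] mat_opnorm_minus_commute[OF ci(3,4)] by (simp add: a_def)
    finally show ?thesis using c(2) by (simp add: divide_right_mono field_simps)
  qed
  moreover have "?u i * ?u i = ?u i" for i
    using fun_cong[OF last_block_mult(1)[OF mat_unit_carrier limit_seqs_mat_seqs[OF ul(1)] last_block_fixed, of p p], of i]
    by (simp add: mat_unit_idem[OF pq(1)])
  ultimately have "?u \<in> I" using w ul by (intro idempotent_mem[of ?u ?w "1 / 2"]) auto
  then show ?thesis using pq by blast
qed

text \<open>The matrices b with \<open>last_block n b\<close> in the ideal form a two-sided ideal of
  a full matrix algebra, which is simple; it is nonzero because it contains
  \<open>g n\<close>.\<close>

lemma last_block_mem:
  assumes g: "g \<in> I" "diag_ext n g = g" and nz: "g n \<noteq> 0\<^sub>m (block_size n) (block_size n)"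
    and b: "b \<in> carrier_mat (block_size n) (block_size n)"
  shows "last_block n b \<in> I"
proof -
  let ?k = "block_size n"
  note gm = limit_seqs_mat_seqs[OF subset[OF g(1)]]
  let ?S = "{b \<in> carrier_mat ?k ?k. last_block n b \<in> I}"
  have mult: "last_block n (a * b) = (\<lambda>i. last_block n a i * last_block n b i)"
    if "a \<in> carrier_mat ?k ?k" "b \<in> carrier_mat ?k ?k" for a b
    using last_block_mult(1)[OF that(1) limit_seqs_mat_seqs[OF last_block_limit_seqs[OF that(2)]] last_block_fixed]
    by simp
  have "?S = carrier_mat ?k ?k"
  proof (rule mat_ideal_eq_carrier)
    have "last_block n (0\<^sub>m ?k ?k) = (\<lambda>i. 0\<^sub>m (block_size i) (block_size i))"
      by (rule diag_ext_eqI[of n]) (auto simp: last_block_fixed diag_ext_zero last_block_less le_less)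
    then show "0\<^sub>m ?k ?k \<in> ?S" using zero_mem by simp
    show "a + b \<in> ?S" if "a \<in> ?S" "b \<in> ?S" for a b
      using that by (simp add: last_block_add add_mem)
    show "a * b \<in> ?S" if "a \<in> carrier_mat ?k ?k" "b \<in> ?S" for a b
      using that by (auto simp: mult intro: mult_left_mem last_block_limit_seqs mult_carrier_mat)
    show "a * b \<in> ?S" if "a \<in> ?S" "b \<in> carrier_mat ?k ?k" for a b
      using that by (auto simp: mult intro: mult_right_mem last_block_limit_seqs mult_carrier_mat)
    \<comment> \<open>Multiplying g by the unit of the last summand cuts away the coordinates below
      n and keeps \<open>g n\<close>.\<close>
    have "last_block n (1\<^sub>m ?k * g n) \<in> I"
      unfolding last_block_mult(1)[OF one_carrier_mat gm g(2)]
      by (intro mult_left_mem g last_block_limit_seqs) simp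
    then show "g n \<in> ?S" using mat_seqsD[OF gm, of n] by simp
  qed (use nz in auto)
  then show ?thesis using b by blast
qed

lemma tail_subset:
  assumes "x \<in> I" "x \<noteq> (\<lambda>i. 0\<^sub>m (block_size i) (block_size i))"
  shows "\<exists>m. \<forall>y\<in>limit_seqs. (\<forall>i\<le>m. y i = 0\<^sub>m (block_size i) (block_size i)) \<longrightarrow> y \<in> I"
proof -
  from exists_mat_unit_mem[OF assms] obtain m p
    where p: "p < block_size m" and gI: "last_block m (mat_unit (block_size m) p p) \<in> I"
    by (elim exE conjE)
  define g where "g = last_block m (mat_unit (block_size m) p p)"
  have g_fixed: "diag_ext m g = g" unfolding g_def by (rule last_block_fixed)
  have fixed: "diag_ext n g = g" if "m \<le> n" for n
    using diag_ext_diag_ext[OF that, of g] by (simp only: g_fixed)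
  have gI: "g \<in> I" unfolding g_def by (rule gI)
  \<comment> \<open>The entry 1 of the matrix unit reappears in every coordinate n > m of g, and g
    also counts as an element of stage n; so the whole last summand at n lies in the ideal.\<close>
  have block: "last_block n b \<in> I"
    if n: "m < n" and b: "b \<in> carrier_mat (block_size n) (block_size n)" for n b
  proof (rule last_block_mem[of g])
    have gm: "g m = mat_unit (block_size m) p p" by (simp add: g_def)
    have "1 \<in> elements_mat (g m)"
      unfolding gm by (rule elements_matI[OF mat_unit_carrier p p]) (simp add: mat_unit_def p)
    then have "1 \<in> elements_mat (g n)"
      using elements_diag_ext_subset[OF fixed[OF order.refl] order.refl n] by blast
    then have "\<exists>c\<in>elements_mat (g n). c \<noteq> 0" by (intro bexI[of _ 1]) auto
    then show "g n \<noteq> 0\<^sub>m (block_size n) (block_size n)"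
      using mat_neq_zero_iff_elements[OF limit_seqsD[OF subset[OF gI]], of n] by blast
    show "diag_ext n g = g" using n by (intro fixed) simp
  qed (rule gI b)+
  \<comment> \<open>Induction on the stage: y and its extension from stage n agree up to coordinate
    n, so at stage n + 1 they differ by a single last block, which is in the ideal by
    \<open>block\<close>. At stage m the sequence is zero.\<close>
  have stage: "y \<in> I"
    if "m \<le> n" "y \<in> mat_seqs" "diag_ext n y = y" "\<And>i. i \<le> m \<Longrightarrow> y i = 0\<^sub>m (block_size i) (block_size i)" for n y
    using that
  proof (induction n arbitrary: y rule: dec_induct)
    case base
    then have "y = (\<lambda>i. 0\<^sub>m (block_size i) (block_size i))"
      by - (rule diag_ext_eqI[of m], auto simp: diag_ext_zero)
    then show ?case using zero_mem by simp
  next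
    case (step n)
    let ?y = "diag_ext n y"
    let ?b = "y (Suc n) - ?y (Suc n)"
    have ym: "?y \<in> mat_seqs" using step.prems by (simp add: diag_ext_mat_seqs)
    have b: "?b \<in> carrier_mat (block_size (Suc n)) (block_size (Suc n))"
      using mat_seqsD[OF ym] by (intro minus_carrier_mat)
    have yI: "?y \<in> I" using step by (intro step.IH) (auto simp: ym diag_ext_diag_ext)
    have lm: "last_block (Suc n) ?b \<in> mat_seqs" by (rule limit_seqs_mat_seqs[OF last_block_limit_seqs[OF b]])
    have "y = (\<lambda>i. ?y i + last_block (Suc n) ?b i)"
    proof (rule diag_ext_eqI[of "Suc n"])
      show "diag_ext (Suc n) (\<lambda>i. ?y i + last_block (Suc n) ?b i) = (\<lambda>i. ?y i + last_block (Suc n) ?b i)"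
        using ym lm by (simp add: diag_ext_add last_block_fixed diag_ext_diag_ext)
      show "y i = ?y i + last_block (Suc n) ?b i" if "i \<le> Suc n" for i
      proof (cases "i = Suc n")
        case True
        then show ?thesis
          using mat_seqsD[OF ym, of "Suc n"] mat_seqsD[OF step.prems(1), of "Suc n"] by (auto intro!: eq_matI)
      next
        case False
        then show ?thesis
          using that mat_seqsD[OF step.prems(1), of i] by (auto simp: last_block_less)
      qed
    qed (rule step.prems)
    moreover have "(\<lambda>i. ?y i + last_block (Suc n) ?b i) \<in> I"
      using step by (intro add_mem yI block b) auto
    ultimately show ?case by simp
  qed
  show ?thesis
  proof (intro exI[of _ m] ballI impI)
    fix y assume y: "y \<in> limit_seqs" and 0: "\<forall>i\<le>m. y i = 0\<^sub>m (block_size i) (block_size i)"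
    show "y \<in> I"
    proof (rule closed[OF y])
      fix e :: real assume e: "0 < e"
      \<comment> \<open>Taking \<open>m \<le> n\<close> keeps the vanishing coordinates in the
        approximant, so that \<open>stage\<close> applies to it; closedness then yields y.\<close>
      have "\<forall>\<^sub>F n in sequentially. m \<le> n \<and> (\<forall>i. mat_opnorm (y i - diag_ext n y i) \<le> e)"
        using limit_seqs_eventually[OF y e] eventually_ge_at_top[of m] by (auto intro: eventually_conj)
      then obtain n where n: "m \<le> n" "\<And>i. mat_opnorm (y i - diag_ext n y i) \<le> e"
        by (auto simp: eventually_sequentially)
      have "diag_ext n y \<in> I"
        using n 0 by (intro stage[of n]) (auto simp: diag_ext_mat_seqs limit_seqs_mat_seqs y diag_ext_diag_ext)
      then show "\<exists>z\<in>I. \<forall>i. mat_opnorm (y i - z i) \<le> e" using n by blast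
    qed
  qed
qed

end

lemma limit_seqs_ideal_of_closed_ideal:
  assumes J: "closed_ideal J A_lim"
  shows "limit_seqs_ideal {x \<in> limit_seqs. to_lim x \<in> J}"
proof -
  have sm: "submodule class_ring J A_lim" using J by (simp add: closed_ideal_def)
  note add = submodule.m_closed[OF sm] and smult = submodule.smult_closed[OF sm, simplified]
    and zero = submodule.zero_closed[OF sm]
  have mult: "X \<otimes>\<^bsub>A_lim\<^esub> Y \<in> J" "Y \<otimes>\<^bsub>A_lim\<^esub> X \<in> J" if "X \<in> carrier A_lim" "Y \<in> J" for X Y
    using J that by (auto simp: closed_ideal_def)
  show ?thesis
  proof
    show "(\<lambda>i. 0\<^sub>m (block_size i) (block_size i)) \<in> {x \<in> limit_seqs. to_lim x \<in> J}"
      using zero by (simp add: zero_limit_seqs flip: to_lim_zero)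
    show "x \<in> {x \<in> limit_seqs. to_lim x \<in> J}"
      if x: "x \<in> limit_seqs" and "\<And>e. 0 < e \<Longrightarrow> \<exists>y\<in>{x \<in> limit_seqs. to_lim x \<in> J}. \<forall>i. mat_opnorm (x i - y i) \<le> e"
      for x
    proof -
      have "\<exists>Y\<in>J. cnorm A_lim (to_lim x \<ominus>\<^bsub>A_lim\<^esub> Y) < e" if "0 < e" for e
      proof -
        obtain y where y: "y \<in> limit_seqs" "to_lim y \<in> J" "\<And>i. mat_opnorm (x i - y i) \<le> e / 2"
          using \<open>0 < e\<close> \<open>\<And>e. 0 < e \<Longrightarrow> \<exists>y\<in>_. _ y e\<close>[of "e / 2"] by auto
        have "cnorm A_lim (to_lim x \<ominus>\<^bsub>A_lim\<^esub> to_lim y) \<le> e / 2"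
          using x y \<open>0 < e\<close> cnorm_to_lim_le_iff[OF limit_seqs_minus[OF x y(1)], of "e / 2"]
          by (simp add: to_lim_minus)
        then show ?thesis using y(2) \<open>0 < e\<close> by (intro bexI[of _ "to_lim y"]) auto
      qed
      then have "to_lim x \<in> norm_closure A_lim J" using x by (simp add: norm_closure_def A_lim_carrier)
      then show ?thesis using J x by (auto simp: closed_ideal_def)
    qed
  qed (auto simp: add smult mult A_lim_carrier limit_seqs_add limit_seqs_smult limit_seqs_mult
      simp flip: to_lim_add to_lim_smult to_lim_mult)
qed

theorem just_infinite_A_lim: "just_infinite A_lim"
  unfolding just_infinite_def
proof (intro conjI allI impI not_finite_dimensional_A_lim, elim conjE)
  fix J assume J: "closed_ideal J A_lim" and nz: "J \<noteq> {\<zero>\<^bsub>A_lim\<^esub>}"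
  interpret J: cstar_ideal A_lim J
  proof (intro cstar_ideal.intro cstar_ideal_axioms.intro cstar_algebra_A_lim)
    show "submodule class_ring J A_lim" using J by (simp add: closed_ideal_def)
    show "a \<otimes>\<^bsub>A_lim\<^esub> Y \<in> J" "Y \<otimes>\<^bsub>A_lim\<^esub> a \<in> J" if "a \<in> carrier A_lim" "Y \<in> J" for a Y
      using J that by (auto simp: closed_ideal_def)
  qed
  interpret I: limit_seqs_ideal "{x \<in> limit_seqs. to_lim x \<in> J}"
    by (rule limit_seqs_ideal_of_closed_ideal[OF J])
  obtain X where X: "X \<in> J" "X \<noteq> \<zero>\<^bsub>A_lim\<^esub>" using nz J.zero_mem by blast
  then obtain x where x: "x \<in> limit_seqs" "X = to_lim x" using J.ideal_subset by (auto simp: A_lim_carrier)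
  then have "x \<in> {x \<in> limit_seqs. to_lim x \<in> J}" "x \<noteq> (\<lambda>i. 0\<^sub>m (block_size i) (block_size i))"
    using X by (auto simp: to_lim_zero)
  from I.tail_subset[OF this] obtain m where m: "\<forall>y\<in>limit_seqs.
      (\<forall>i\<le>m. y i = 0\<^sub>m (block_size i) (block_size i)) \<longrightarrow> y \<in> {x \<in> limit_seqs. to_lim x \<in> J}" ..
  \<comment> \<open>Every y differs from \<open>diag_ext m y\<close> by a sequence that vanishes up
    to coordinate m and hence lies in the ideal. So each coset has a representative from stage m,
    which makes this map from A_(m+1) onto the quotient.\<close>
  let ?f = "\<lambda>a. J +>\<^bsub>A_lim\<^esub> to_lim (lift_seq m a)"
  have lim: "to_lim y \<in> carrier A_lim" if "y \<in> limit_seqs" for y using that by (simp add: A_lim_carrier)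
  have hom: "?f \<in> module_hom class_ring (A_seq (Suc m)) J.Q"
    by (auto simp: LinearCombinations.module_hom_def J.quot_carrier lift_seq_add lift_seq_smult lim lift_seq_in
        J.quot_add J.quot_smult to_lim_add to_lim_smult)
  have surj: "?f ` carrier (A_seq (Suc m)) = carrier J.Q"
  proof (intro equalityI subsetI)
    fix Z assume "Z \<in> carrier J.Q"
    then obtain y where y: "y \<in> limit_seqs" and Z: "Z = J +>\<^bsub>A_lim\<^esub> to_lim y"
      by (auto simp: J.quot_carrier A_lim_carrier)
    let ?y = "diag_ext m y"
    have yl: "?y \<in> limit_seqs" by (rule diag_ext_limit_seqs[OF limit_seqs_mat_seqs[OF y]])
    have "y i - ?y i = 0\<^sub>m (block_size i) (block_size i)" if "i \<le> m" for i
      using that limit_seqsD[OF y, of i] by (auto intro!: eq_matI)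
    with m limit_seqs_minus[OF y yl] have "(\<lambda>i. y i - ?y i) \<in> {x \<in> limit_seqs. to_lim x \<in> J}"
      by (metis (no_types, lifting))
    then have "Z = J +>\<^bsub>A_lim\<^esub> to_lim ?y"
      using y yl lim by (simp add: Z J.coset_eq_iff to_lim_minus)
    then show "Z \<in> ?f ` carrier (A_seq (Suc m))"
      using prefixes_in_A_seq[OF limit_seqs_mat_seqs[OF y], of m] lift_seq_prefixes[of m y]
      by (intro image_eqI[of _ _ "prefixes y m"]) auto
  qed (auto simp: J.quot_carrier lim lift_seq_in)
  show "finite_dimensional J.Q"
    using fin_dim_image[OF cstar_algebra.vectorspace[OF cstar_algebra_A_seq] J.vectorspace_quot hom surj]
      finite_dimensional_A_seq by (simp add: finite_dimensional_def)
qed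


theorem mainTheorem2:
  shows "(\<forall>n\<ge>1. k_seq (n + 1) = (\<Sum>j = 1..n. k_seq j)) \<and>
    (\<forall>n\<ge>1. cstar_algebra (A_seq n) \<and> unital (A_seq n)) \<and>
    (\<forall>n\<ge>1. \<phi>_seq n \<in> star_hom (A_seq n) (A_seq (n + 1)) \<and>
       \<phi>_seq n \<one>\<^bsub>A_seq n\<^esub> = \<one>\<^bsub>A_seq (n + 1)\<^esub> \<and>
       inj_on (\<phi>_seq n) (carrier (A_seq n))) \<and>
    (cstar_algebra A_lim \<and> unital A_lim \<and> AF_algebra A_lim \<and>
       just_infinite A_lim \<and> residually_finite_dimensional A_lim) \<and>
    (\<exists>B :: (nat \<Rightarrow> complex mat list) set cstar.
       cstar_algebra B \<and> unital B \<and> AF_algebra B \<and>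
       just_infinite B \<and> residually_finite_dimensional B)"
proof (intro conjI allI impI)
  show "k_seq (n + 1) = (\<Sum>j = 1..n. k_seq j)" if "1 \<le> n" for n
    using that by (rule k_seq_Suc_eq_sum)
  show "cstar_algebra (A_seq n)" "unital (A_seq n)" for n
    by (rule cstar_algebra_A_seq unital_A_seq)+
  show "\<phi>_seq n \<in> star_hom (A_seq n) (A_seq (n + 1))"
    "\<phi>_seq n \<one>\<^bsub>A_seq n\<^esub> = \<one>\<^bsub>A_seq (n + 1)\<^esub>" if "1 \<le> n" for n
  proof -
    have "0 < n" using that by simp
    then show "\<phi>_seq n \<in> star_hom (A_seq n) (A_seq (n + 1))"
      "\<phi>_seq n \<one>\<^bsub>A_seq n\<^esub> = \<one>\<^bsub>A_seq (n + 1)\<^esub>"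
      by (rule \<phi>_seq_star_hom, rule \<phi>_seq_one)
  qed
  show "inj_on (\<phi>_seq n) (carrier (A_seq n))" for n
    by (rule inj_on_\<phi>_seq)
  note A_lim = cstar_algebra_A_lim unital_A_lim AF_algebra_A_lim just_infinite_A_lim
    residually_finite_dimensional_A_lim
  show "cstar_algebra A_lim" "unital A_lim" "AF_algebra A_lim" "just_infinite A_lim"
    "residually_finite_dimensional A_lim"
    by (rule A_lim)+
  show "\<exists>B :: (nat \<Rightarrow> complex mat list) set cstar.
      cstar_algebra B \<and> unital B \<and> AF_algebra B \<and> just_infinite B \<and> residually_finite_dimensional B"
    using A_lim by blast
qed

end
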